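(* Fix an integer $\ell\geq4$. There is an algorithm which, given a candidate $G$, outputs in time $\mathcal{O}(|G|^{8\ell+4})$ a list of $\mathcal{O}(|G|^{8\ell+2})$ subsets of $V(G)$ with the following property: for every shortest long even hole $C$ of $G$ there is some set $X$ in the list such that $X$ contains all $C$-major vertices and $X\cap V(C)=\emptyset$.
   Context: $|G|$ is the number of vertices. A hole is an induced cycle of length at least four; long means length at least $\ell$; a shortest long even hole is an even long hole of minimum length in $G$. A vertex $v\notin V(C)$ is $C$-major if no subpath of $C$ of length three contains all its neighbours in $V(C)$. Jewel: for vertices $a,b$, induced $ab$-paths $Q_1,Q_2$ of different length parity and an induced $ab$-path $P$ of length $\geq\ell$ whose interior is disjoint from and anticomplete to the interiors of $Q_1,Q_2$, the subgraph induced on $V(P\cup Q_1\cup Q_2)$ is a jewel of order $\max(|V(Q_1)|,|V(Q_2)|)$, long if all its holes are long. A theta consists of non-adjacent $a,b$ and three $ab$-paths with disjoint interiors (no other edges), long if any two of its paths have total length $\geq\ell$. A ban-the-bomb consists of a hole $C'$ and a vertex $x'$ such that for some path $x\text{-}y\text{-}z$ of $C'$ and $w\in V(C')$ non-adjacent to $x,y$, $x'$ is adjacent to $w,x,z$ and has no neighbours in $V(C')\setminus\{w,x,y,z\}$; long if all its holes are long. A long near-prism consists of two triangles on $\{a_1,a_2,a_3\},\{b_1,b_2,b_3\}$ and pairwise vertex-disjoint paths $P_i$ with ends $a_i,b_i$ (no other edges), where the triangles are disjoint or $a_i=b_i$ for exactly one $i$, and at most one $P_i$ has length $<\ell$. A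 candidate is a graph containing (as induced subgraphs) no long even hole of length at most $2\ell+2$, no long jewel of order at most $\ell+3$, no long theta, no long ban-the-bomb, and no long near-prism. *)

theory Defs
  imports Complex_Main "HOL-Library.Landau_Symbols"
begin

section \<open>Graphs, paths and holes\<close>

record 'a sgraph =
  verts :: "'a set"
  adj :: "'a \<Rightarrow> 'a \<Rightarrow> bool"

definition simple_graph :: "'a sgraph \<Rightarrow> bool" where
  "simple_graph G \<longleftrightarrow> finite (verts G) \<and>
     (\<forall>u v. adj G u v \<longrightarrow> u \<in> verts G \<and> v \<in> verts G \<and> u \<noteq> v \<and> adj G v u)"

definition edges :: "'a sgraph \<Rightarrow> 'a set set" where
  "edges G = {{u, v} | u v. adj G u v}"

definition induce :: "'a sgraph \<Rightarrow> 'a set \<Rightarrow> 'a sgraph" where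
  "induce G X = \<lparr>verts = verts G \<inter> X, adj = (\<lambda>u v. u \<in> X \<and> v \<in> X \<and> adj G u v)\<rparr>"

definition contains_induced :: "'a sgraph \<Rightarrow> ('a sgraph \<Rightarrow> bool) \<Rightarrow> bool" where
  "contains_induced G P \<longleftrightarrow> (\<exists>X \<subseteq> verts G. P (induce G X))"

text \<open>Paths and cycles are represented by the list of their vertices in order; for a cycle the
  starting vertex and the direction are arbitrary. The length is always the number of edges,
  so a path \<open>p\<close> has length \<open>length p - 1\<close> and a cycle \<open>c\<close> has length \<open>length c\<close>.\<close>

definition path_edges :: "'a list \<Rightarrow> 'a set set" where
  "path_edges p = {{p ! i, p ! Suc i} | i. Suc i < length p}"

definition cycle_edges :: "'a list \<Rightarrow> 'a set set" where
  "cycle_edges c = insert {last c, hd c} (path_edges c)"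

definition plen :: "'a list \<Rightarrow> nat" where
  "plen p = length p - 1"

definition path_between :: "'a sgraph \<Rightarrow> 'a \<Rightarrow> 'a \<Rightarrow> 'a list \<Rightarrow> bool" where
  "path_between G a b p \<longleftrightarrow> p \<noteq> [] \<and> hd p = a \<and> last p = b \<and> distinct p \<and>
     set p \<subseteq> verts G \<and> path_edges p \<subseteq> edges G"

definition induced_path :: "'a sgraph \<Rightarrow> 'a \<Rightarrow> 'a \<Rightarrow> 'a list \<Rightarrow> bool" where
  "induced_path G a b p \<longleftrightarrow> path_between G a b p \<and> edges (induce G (set p)) = path_edges p"

definition path_interior :: "'a list \<Rightarrow> 'a set" where
  "path_interior p = set p - {hd p, last p}"

definition anticomplete :: "'a sgraph \<Rightarrow> 'a set \<Rightarrow> 'a set \<Rightarrow> bool" where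
  "anticomplete G X Y \<longleftrightarrow> (\<forall>x \<in> X. \<forall>y \<in> Y. \<not> adj G x y)"

definition hole :: "'a sgraph \<Rightarrow> 'a list \<Rightarrow> bool" where
  "hole G c \<longleftrightarrow> 4 \<le> length c \<and> distinct c \<and> set c \<subseteq> verts G \<and>
     edges (induce G (set c)) = cycle_edges c"

definition long_even_hole :: "nat \<Rightarrow> 'a sgraph \<Rightarrow> 'a list \<Rightarrow> bool" where
  "long_even_hole l G c \<longleftrightarrow> hole G c \<and> l \<le> length c \<and> even (length c)"

definition shortest_long_even_hole :: "nat \<Rightarrow> 'a sgraph \<Rightarrow> 'a list \<Rightarrow> bool" where
  "shortest_long_even_hole l G c \<longleftrightarrow> long_even_hole l G c \<and>
     (\<forall>c'. long_even_hole l G c' \<longrightarrow> length c \<le> length c')"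

definition all_holes_long :: "nat \<Rightarrow> 'a sgraph \<Rightarrow> bool" where
  "all_holes_long l G \<longleftrightarrow> (\<forall>c. hole G c \<longrightarrow> l \<le> length c)"

definition major :: "'a sgraph \<Rightarrow> 'a list \<Rightarrow> 'a \<Rightarrow> bool" where
  "major G c v \<longleftrightarrow> v \<in> verts G \<and> v \<notin> set c \<and>
     \<not> (\<exists>p. distinct p \<and> plen p = 3 \<and> path_edges p \<subseteq> cycle_edges c \<and>
            {u \<in> set c. adj G v u} \<subseteq> set p)"


section \<open>Candidates\<close>

definition jewel :: "nat \<Rightarrow> nat \<Rightarrow> 'a sgraph \<Rightarrow> bool" where
  "jewel l k H \<longleftrightarrow> (\<exists>a b P Q1 Q2.
     induced_path H a b P \<and> induced_path H a b Q1 \<and> induced_path H a b Q2 \<and>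
     (even (plen Q1) \<longleftrightarrow> odd (plen Q2)) \<and> l \<le> plen P \<and>
     (\<forall>Q \<in> {Q1, Q2}. path_interior P \<inter> path_interior Q = {} \<and>
                      anticomplete H (path_interior P) (path_interior Q)) \<and>
     verts H = set P \<union> set Q1 \<union> set Q2 \<and>
     k = max (length Q1) (length Q2))"

definition long_jewel :: "nat \<Rightarrow> nat \<Rightarrow> 'a sgraph \<Rightarrow> bool" where
  "long_jewel l k H \<longleftrightarrow> jewel l k H \<and> all_holes_long l H"

definition long_theta :: "nat \<Rightarrow> 'a sgraph \<Rightarrow> bool" where
  "long_theta l H \<longleftrightarrow> (\<exists>a b P1 P2 P3.
     a \<noteq> b \<and> \<not> adj H a b \<and> path_between H a b P1 \<and> path_between H a b P2 \<and> path_between H a b P3 \<and>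
     path_interior P1 \<inter> path_interior P2 = {} \<and> path_interior P1 \<inter> path_interior P3 = {} \<and>
     path_interior P2 \<inter> path_interior P3 = {} \<and>
     verts H = set P1 \<union> set P2 \<union> set P3 \<and>
     edges H = path_edges P1 \<union> path_edges P2 \<union> path_edges P3 \<and>
     l \<le> plen P1 + plen P2 \<and> l \<le> plen P1 + plen P3 \<and> l \<le> plen P2 + plen P3)"

text \<open>Non-adjacency of \<open>w\<close> to \<open>x\<close> and \<open>y\<close> already forces \<open>w\<close> to be distinct
  from \<open>x\<close>, \<open>y\<close> and \<open>z\<close>; whether \<open>x'\<close> is adjacent to \<open>y\<close> is left open.\<close>

definition ban_the_bomb :: "'a sgraph \<Rightarrow> bool" where
  "ban_the_bomb H \<longleftrightarrow> (\<exists>c x' x y z w.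
     hole H c \<and> x' \<notin> set c \<and> verts H = insert x' (set c) \<and>
     {x, y} \<in> cycle_edges c \<and> {y, z} \<in> cycle_edges c \<and> x \<noteq> z \<and>
     w \<in> set c \<and> \<not> adj H w x \<and> \<not> adj H w y \<and>
     adj H x' w \<and> adj H x' x \<and> adj H x' z \<and>
     (\<forall>v \<in> set c - {w, x, y, z}. \<not> adj H x' v))"

definition long_ban_the_bomb :: "nat \<Rightarrow> 'a sgraph \<Rightarrow> bool" where
  "long_ban_the_bomb l H \<longleftrightarrow> ban_the_bomb H \<and> all_holes_long l H"

text \<open>If \<open>a i = b i\<close>, then \<open>P i\<close> is a one-vertex path of length 0. The vertices of each
  triangle are distinct because the three paths are disjoint.\<close>

definition long_near_prism :: "nat \<Rightarrow> 'a sgraph \<Rightarrow> bool" where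
  "long_near_prism l H \<longleftrightarrow> (\<exists>(a :: nat \<Rightarrow> 'a) (b :: nat \<Rightarrow> 'a) (P :: nat \<Rightarrow> 'a list).
     let I = {1, 2, 3} in
     (\<forall>i \<in> I. path_between H (a i) (b i) (P i)) \<and>
     (\<forall>i \<in> I. \<forall>j \<in> I. i \<noteq> j \<longrightarrow> set (P i) \<inter> set (P j) = {}) \<and>
     verts H = (\<Union>i \<in> I. set (P i)) \<and>
     edges H = (\<Union>i \<in> I. path_edges (P i)) \<union>
       {{a i, a j} | i j. i \<in> I \<and> j \<in> I \<and> i \<noteq> j} \<union>
       {{b i, b j} | i j. i \<in> I \<and> j \<in> I \<and> i \<noteq> j} \<and>
     (a ` I \<inter> b ` I = {} \<or> (\<exists>!i. i \<in> I \<and> a i = b i)) \<and>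
     card {i \<in> I. plen (P i) < l} \<le> 1)"

definition candidate :: "nat \<Rightarrow> 'a sgraph \<Rightarrow> bool" where
  "candidate l G \<longleftrightarrow> simple_graph G \<and>
     \<not> (\<exists>c. long_even_hole l G c \<and> length c \<le> 2 * l + 2) \<and>
     \<not> (\<exists>k \<le> l + 3. contains_induced G (long_jewel l k)) \<and>
     \<not> contains_induced G (long_theta l) \<and>
     \<not> contains_induced G (long_ban_the_bomb l) \<and>
     \<not> contains_induced G (long_near_prism l)"


section \<open>Algorithms and running time\<close>

text \<open>Algorithms are programs of a random access machine with registers,
  an indirectly addressed memory and a write-only output tape. Control flow is structured. The
  arithmetic operations are addition and truncated subtraction; every operation
  has unit cost. The parameter \<open>W\<close> of the semantics bounds the numbers the machine can store: a
  program that tries to store a larger number has no run. Below, \<open>W\<close> is polynomial in the number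
  of vertices, that is, machine words have logarithmic size.\<close>

datatype expr =
    Const nat
  | Reg nat
  | Mem expr
  | Plus expr expr
  | Minus expr expr

datatype com =
    Skip
  | Assign nat expr
  | Store expr expr
  | Output expr
  | Seq com com
  | Cond expr com com
  | While expr com

record state =
  reg :: "nat \<Rightarrow> nat"
  mem :: "nat \<Rightarrow> nat"
  out :: "nat list"

primrec val :: "expr \<Rightarrow> state \<Rightarrow> nat" where
  "val (Const k) s = k"
| "val (Reg r) s = reg s r"
| "val (Mem e) s = mem s (val e s)"
| "val (Plus e f) s = val e s + val f s"
| "val (Minus e f) s = val e s - val f s"

primrec cost :: "expr \<Rightarrow> nat" where
  "cost (Const k) = 1"
| "cost (Reg r) = 1"
| "cost (Mem e) = cost e + 1"
| "cost (Plus e f) = cost e + cost f + 1"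
| "cost (Minus e f) = cost e + cost f + 1"

text \<open>\<open>run W c s t s'\<close>: started in state \<open>s\<close>, the program \<open>c\<close> halts in state \<open>s'\<close> after
  time \<open>t\<close>. Conditions are true when their value is nonzero.\<close>

inductive run :: "nat \<Rightarrow> com \<Rightarrow> state \<Rightarrow> nat \<Rightarrow> state \<Rightarrow> bool" for W :: nat where
  Skip: "run W Skip s 1 s"
| Assign: "val e s \<le> W \<Longrightarrow>
    run W (Assign r e) s (cost e + 1) (s\<lparr>reg := (reg s)(r := val e s)\<rparr>)"
| Store: "val f s \<le> W \<Longrightarrow> val e s \<le> W \<Longrightarrow>
    run W (Store e f) s (cost e + cost f + 1) (s\<lparr>mem := (mem s)(val e s := val f s)\<rparr>)"
| Output: "val e s \<le> W \<Longrightarrow>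
    run W (Output e) s (cost e + 1) (s\<lparr>out := out s @ [val e s]\<rparr>)"
| Seq: "run W c1 s t1 s' \<Longrightarrow> run W c2 s' t2 s'' \<Longrightarrow>
    run W (Seq c1 c2) s (t1 + t2) s''"
| CondTrue: "val e s \<noteq> 0 \<Longrightarrow> run W c1 s t s' \<Longrightarrow> run W (Cond e c1 c2) s (cost e + 1 + t) s'"
| CondFalse: "val e s = 0 \<Longrightarrow> run W c2 s t s' \<Longrightarrow> run W (Cond e c1 c2) s (cost e + 1 + t) s'"
| WhileTrue: "val e s \<noteq> 0 \<Longrightarrow> run W c s t1 s' \<Longrightarrow> run W (While e c) s' t2 s'' \<Longrightarrow>
    run W (While e c) s (cost e + 1 + t1 + t2) s''"
| WhileFalse: "val e s = 0 \<Longrightarrow> run W (While e c) s (cost e + 1) s"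

text \<open>The input is a graph with vertex set \<open>{..<n}\<close>: register 0 contains \<open>n\<close> and the memory
  cells below \<open>n * n\<close> contain the adjacency matrix row by row.\<close>

definition input_state :: "nat \<Rightarrow> nat sgraph \<Rightarrow> state" where
  "input_state n G =
     \<lparr>reg = (\<lambda>r. if r = 0 then n else 0),
      mem = (\<lambda>i. if i < n * n \<and> adj G (i div n) (i mod n) then 1 else 0),
      out = []\<rparr>"

text \<open>A list of subsets of \<open>{..<n}\<close> is output as the concatenation of their characteristic
  vectors.\<close>

definition encode_sets :: "nat \<Rightarrow> nat set list \<Rightarrow> nat list" where
  "encode_sets n Xs = concat (map (\<lambda>X. map (\<lambda>v. if v \<in> X then 1 else 0) [0..<n]) Xs)"

definition outputs_in_time :: "nat \<Rightarrow> com \<Rightarrow> nat \<Rightarrow> nat sgraph \<Rightarrow> real \<Rightarrow> nat set list \<Rightarrow> bool" where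
  "outputs_in_time W prog n G T Xs \<longleftrightarrow>
     (\<exists>t s. run W prog (input_state n G) t s \<and> real t \<le> T \<and> out s = encode_sets n Xs)"

end

theory Submission
  imports Defs
begin

text \<open>Fix a shortest long even hole \<open>C\<close>. The neighbours of a vertex \<open>x\<close> off \<open>C\<close> cut \<open>C\<close> into gaps,
  and a long gap of a major vertex has odd length, since it closes up with \<open>x\<close> to a hole. If some
  major vertex has a gap missing at most \<open>l + 1\<close> edges of \<open>C\<close>, then the few vertices of \<open>C\<close> outside
  the gap and near its ends meet the neighbourhood of every major vertex. Otherwise take a major vertex
  \<open>x\<close> with a longest (pseudo-)gap, and guess the \<open>O(l)\<close> vertices of \<open>C\<close> near its ends. Parity
  arguments on holes through \<open>x\<close> and a second major vertex, together with the absence of long thetas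
  and long near-prisms, show that every major vertex that sees no guessed vertex is adjacent to \<open>x\<close>.
  Repeating this among those vertices gives a major vertex \<open>y\<close> such that each remaining major
  vertex is adjacent to \<open>x\<close> and \<open>y\<close> and has a neighbour in the part \<open>S\<close> of \<open>C\<close> where the two
  pseudo-gaps overlap.
  The algorithm does not know \<open>S\<close>, but it can compute everything reachable from the two ends of
  \<open>S\<close> through vertices adjacent to neither \<open>x\<close>, \<open>y\<close> nor any guessed vertex; all such vertices off
  \<open>C\<close> are nonmajor, and a shortest path through them from \<open>S\<close> to a common neighbour of \<open>x\<close> and
  \<open>y\<close> on \<open>C\<close> would create a long theta or a long near-prism. So the set of vertices that see a
  guessed vertex, or see \<open>x\<close>, \<open>y\<close> and the reached set, contains the major vertices and avoids \<open>C\<close>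
  once the guessed vertices and their neighbours on \<open>C\<close> are removed. Guessing \<open>8 l\<close> vertices suffices.\<close>

section \<open>Induced paths as lists\<close>

text \<open>A stretch of \<open>C\<close> and one or two major vertices close up to a hole, and its
  oddness is one linear relation mod 2 between positions on \<open>C\<close>; the contradictions are
  inconsistent systems of such relations. A relation is available only if the hole has length at
  least \<open>l\<close>, so neighbours must keep a distance \<open>rho = max 2 (l - 3)\<close> from
  the ends of a gap: \<open>l - 3\<close> makes a hole through two adjacent vertices long,
  \<open>2\<close> keeps two stretches anticomplete. The paths of a near-prism need the larger
  distance \<open>l - 1\<close>. Guessing all vertices below these distances enforces them. A guess
  costs two covers of pseudo-gaps with at most \<open>4 * l - 10\<close> vertices each, and four
  vertices for widening to \<open>l - 1\<close>. A vertex of \<open>C\<close> next to a guessed one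
  sees it and would wrongly be output, so it is guessed too and subtracted: six per pseudo-gap, and
  the two vertices where the search in \<open>S\<close> starts. With \<open>x\<close> and
  \<open>y\<close> this makes \<open>2 * (4 * l - 10) + 4 + 12 + 2 + 2 = 8 * l\<close>.\<close>

lemma adj_sym: "simple_graph G \<Longrightarrow> adj G u v \<Longrightarrow> adj G v u"
  and adj_irrefl: "simple_graph G \<Longrightarrow> \<not> adj G u u"
  and adj_verts: "simple_graph G \<Longrightarrow> adj G u v \<Longrightarrow> u \<in> verts G \<and> v \<in> verts G"
  unfolding simple_graph_def by blast+

lemma adj_commute: "simple_graph G \<Longrightarrow> adj G u v \<longleftrightarrow> adj G v u"
  using adj_sym by metis

text \<open>The recursive form reduces inducedness of a concatenation to its two parts and the edges
  between them, which is how all paths below are assembled.\<close>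

primrec ipath :: "'a sgraph \<Rightarrow> 'a list \<Rightarrow> bool" where
  "ipath G [] = True"
| "ipath G (v # p) \<longleftrightarrow> v \<in> verts G \<and> v \<notin> set p \<and> (\<forall>w\<in>set p. adj G v w \<longleftrightarrow> w = hd p) \<and> ipath G p"

lemma ipath_distinct: "ipath G p \<Longrightarrow> distinct p"
  by (induction p) auto

lemma ipath_verts: "ipath G p \<Longrightarrow> set p \<subseteq> verts G"
  by (induction p) auto

lemma ipath_append:
  "ipath G (p @ q) \<longleftrightarrow> ipath G p \<and> ipath G q \<and> set p \<inter> set q = {} \<and>
     (\<forall>u\<in>set p. \<forall>w\<in>set q. adj G u w \<longleftrightarrow> u = last p \<and> w = hd q)"
proof (induction p)
  case (Cons v p)
  show ?case (is "_ \<longleftrightarrow> ?rhs")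
  proof (cases "p = []")
    case False
    then have h: "last p \<in> set p" "hd p \<in> set p" "last (v # p) = last p" "hd (p @ q) = hd p" by auto
    \<comment> \<open>For nonempty \<open>p\<close> both right-hand sides are false on
      \<open>q\<close>, so each merely says that \<open>v\<close> has no neighbour there.\<close>
    have key: "(\<forall>w\<in>set q. adj G v w \<longleftrightarrow> w = hd p) \<longleftrightarrow> (\<forall>w\<in>set q. adj G v w \<longleftrightarrow> v = last p \<and> w = hd q)"
      if "v \<notin> set p" "set p \<inter> set q = {}"
    proof -
      have "v \<noteq> last p" using that(1) h(1) by metis
      moreover have "w \<noteq> hd p" if "w \<in> set q" for w using that h(2) \<open>set p \<inter> set q = {}\<close> by blast
      ultimately show ?thesis by simp
    qed
    have "ipath G ((v # p) @ q) \<longleftrightarrow> v \<in> verts G \<and> v \<notin> set p \<and> v \<notin> set q \<and>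
        (\<forall>w\<in>set p. adj G v w \<longleftrightarrow> w = hd p) \<and> (\<forall>w\<in>set q. adj G v w \<longleftrightarrow> w = hd p) \<and>
        ipath G p \<and> ipath G q \<and> set p \<inter> set q = {} \<and>
        (\<forall>u\<in>set p. \<forall>w\<in>set q. adj G u w \<longleftrightarrow> u = last p \<and> w = hd q)"
      unfolding append_Cons ipath.simps(2) Cons.IH h(4) set_append ball_Un Un_iff de_Morgan_disj
      by (simp only: conj_assoc)
    also have "\<dots> \<longleftrightarrow> v \<in> verts G \<and> v \<notin> set p \<and> v \<notin> set q \<and>
        (\<forall>w\<in>set p. adj G v w \<longleftrightarrow> w = hd p) \<and> (\<forall>w\<in>set q. adj G v w \<longleftrightarrow> v = last p \<and> w = hd q) \<and>
        ipath G p \<and> ipath G q \<and> set p \<inter> set q = {} \<and>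
        (\<forall>u\<in>set p. \<forall>w\<in>set q. adj G u w \<longleftrightarrow> u = last p \<and> w = hd q)"
    proof (cases "v \<notin> set p \<and> set p \<inter> set q = {}")
      case True
      show ?thesis unfolding key[OF conjunct1[OF True] conjunct2[OF True]] by (rule refl)
    next
      case False
      then show ?thesis by blast
    qed
    also have "\<dots> \<longleftrightarrow> ?rhs"
      unfolding ipath.simps(2) set_simps h(3) Int_insert_left using h(1) by (auto simp del: h(3))
    finally show ?thesis .
  qed auto
qed auto

lemma ipath_rev: "simple_graph G \<Longrightarrow> ipath G (rev p) = ipath G p"
proof (induction p)
  case (Cons v p)
  then show ?case by (auto simp: ipath_append last_rev adj_commute[of G v])
qed auto

lemma path_edges_Cons: "path_edges (v # p) = (if p = [] then {} else insert {v, hd p} (path_edges p))"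
proof (cases p)
  case (Cons w q)
  have "path_edges (v # p) = {{(v # p) ! i, (v # p) ! Suc i} | i. i < length p}"
    by (simp add: path_edges_def)
  also have "\<dots> = insert {v, hd p} {{(v # p) ! Suc i, (v # p) ! Suc (Suc i)} | i. Suc i < length p}"
  proof (intro set_eqI iffI)
    fix e assume "e \<in> {{(v # p) ! i, (v # p) ! Suc i} | i. i < length p}"
    then obtain i where "i < length p" "e = {(v # p) ! i, (v # p) ! Suc i}" by blast
    then show "e \<in> insert {v, hd p} {{(v # p) ! Suc i, (v # p) ! Suc (Suc i)} | i. Suc i < length p}"
      using Cons by (cases i) auto
  next
    fix e assume "e \<in> insert {v, hd p} {{(v # p) ! Suc i, (v # p) ! Suc (Suc i)} | i. Suc i < length p}"
    then show "e \<in> {{(v # p) ! i, (v # p) ! Suc i} | i. i < length p}"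
    proof
      assume "e = {v, hd p}"
      then show ?thesis using Cons by (intro CollectI exI[of _ 0]) auto
    qed blast
  qed
  finally show ?thesis using Cons by (simp add: path_edges_def)
qed (auto simp: path_edges_def)

lemma path_edges_Nil [simp]: "path_edges [] = {}"
  by (simp add: path_edges_def)

lemma edges_induce: "edges (induce G X) = {{u, w} | u w. u \<in> X \<and> w \<in> X \<and> adj G u w}"
  unfolding edges_def induce_def by auto

lemma edges_induce_insert:
  assumes "simple_graph G"
  shows "edges (induce G (insert v X)) = edges (induce G X) \<union> {{v, w} | w. w \<in> X \<and> adj G v w}"
proof (intro set_eqI iffI)
  fix e assume "e \<in> edges (induce G (insert v X))"
  then obtain u w where *: "u \<in> insert v X" "w \<in> insert v X" "adj G u w" "e = {u, w}"
    unfolding edges_induce by blast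
  then show "e \<in> edges (induce G X) \<union> {{v, w} | w. w \<in> X \<and> adj G v w}"
    using adj_irrefl[OF assms] adj_sym[OF assms] unfolding edges_induce
    by (smt (verit) CollectI UnCI insert_iff insert_commute)
qed (auto simp: edges_induce)

lemma ipath_edges:
  "simple_graph G \<Longrightarrow> ipath G p \<Longrightarrow> edges (induce G (set p)) = path_edges p"
proof (induction p)
  case (Cons v p)
  have "{{v, w} | w. w \<in> set p \<and> adj G v w} = (if p = [] then {} else {{v, hd p}})"
    using Cons.prems(2) by auto
  with Cons show ?case by (auto simp: edges_induce_insert path_edges_Cons)
qed (auto simp: edges_induce)

lemma path_betweenI:
  assumes "simple_graph G" "ipath G p" "p \<noteq> []" "set p \<subseteq> X"
  shows "path_between (induce G X) (hd p) (last p) p"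
proof -
  have "path_edges p \<subseteq> edges (induce G X)"
    using assms(4) unfolding ipath_edges[OF assms(1,2), symmetric] edges_induce by blast
  with assms ipath_distinct[OF assms(2)] ipath_verts[OF assms(2)] show ?thesis
    unfolding path_between_def by (auto simp: induce_def)
qed

lemma hole_ConsI:
  assumes "simple_graph G" "ipath G p" "3 \<le> length p" "v \<in> verts G" "v \<notin> set p"
    and "\<And>w. w \<in> set p \<Longrightarrow> adj G v w \<longleftrightarrow> w = hd p \<or> w = last p"
  shows "hole G (v # p)"
proof -
  have ne: "p \<noteq> []" using assms(3) by auto
  have "{{v, w} | w. w \<in> set p \<and> adj G v w} = {{v, hd p}, {last p, v}}"
    using assms(6) ne by (auto simp: insert_commute)
  then have "edges (induce G (set (v # p))) = cycle_edges (v # p)"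
    using ne ipath_edges[OF assms(1,2)] assms(1)
    by (auto simp: edges_induce_insert cycle_edges_def path_edges_Cons)
  then show ?thesis
    using assms ipath_distinct[OF assms(2)] ipath_verts[OF assms(2)] unfolding hole_def by auto
qed

text \<open>The hypothesis has the form that a shortest walk provides: a repetition or a chord
  between two positions would allow the part between them to be cut out.\<close>

lemma walk_ipathI:
  assumes "set r \<subseteq> verts G" "successively (adj G) r"
    and "\<And>xs u ys v zs. r = xs @ u # ys @ v # zs \<Longrightarrow> u \<noteq> v \<and> (adj G u v \<longrightarrow> ys = [])"
  shows "ipath G r"
  using assms
proof (induction r)
  case (Cons a r)
  have *: "a \<noteq> w \<and> (adj G a w \<longleftrightarrow> w = hd r)" if w: "w \<in> set r" for w
  proof -
    from w obtain ys zs where r: "r = ys @ w # zs" by (meson split_list)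
    have "a \<noteq> w \<and> (adj G a w \<longrightarrow> ys = [])" using Cons.prems(3)[of "[]" a ys w zs] r by simp
    moreover have "adj G a (hd r)" using Cons.prems(2) w by (cases r) auto
    ultimately show ?thesis using r by auto
  qed
  have "ipath G r"
  proof (rule Cons.IH)
    show "set r \<subseteq> verts G" using Cons.prems by auto
    show "successively (adj G) r" using Cons.prems by (auto simp: successively_Cons)
    fix xs u ys v zs assume "r = xs @ u # ys @ v # zs"
    then show "u \<noteq> v \<and> (adj G u v \<longrightarrow> ys = [])" using Cons.prems(3)[of "a # xs" u ys v zs] by simp
  qed
  with * Cons.prems(1) show ?case by auto
qed auto

text \<open>Take a shortest walk inside \<open>set w\<close> from \<open>A\<close> to
  \<open>B\<close>. A repeated vertex or a chord would shorten it, and so would a second visit to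
  \<open>A\<close> or \<open>B\<close>.\<close>

lemma connecting_ipath:
  assumes "set w \<subseteq> verts G" "w \<noteq> []" "successively (adj G) w" "hd w \<in> A" "last w \<in> B"
  obtains r where "ipath G r" "r \<noteq> []" "set r \<subseteq> set w" "set r \<inter> A = {hd r}" "set r \<inter> B = {last r}"
proof -
  define Q where "Q r \<longleftrightarrow> r \<noteq> [] \<and> set r \<subseteq> set w \<and> successively (adj G) r \<and> hd r \<in> A \<and> last r \<in> B" for r
  have "Q w" using assms by (simp add: Q_def)
  then obtain r where r: "Q r" and min: "\<And>r'. Q r' \<Longrightarrow> length r \<le> length r'"
    using ex_has_least_nat[of Q w length] by blast
  have "ipath G r"
  proof (rule walk_ipathI)
    show "set r \<subseteq> verts G" "successively (adj G) r" using r assms(1) by (auto simp: Q_def)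
    fix xs u ys v zs assume eq: "r = xs @ u # ys @ v # zs"
    have "Q (xs @ v # zs)" if "u = v"
      using r that unfolding Q_def eq
      by (auto simp: successively_append_iff successively_Cons hd_append split: if_splits)
    then have "u \<noteq> v" using min[of "xs @ v # zs"] eq by force
    moreover have "Q (xs @ u # v # zs)" if "adj G u v"
      using r that unfolding Q_def eq
      by (auto simp: successively_append_iff successively_Cons hd_append split: if_splits)
    then have "adj G u v \<longrightarrow> ys = []" using min[of "xs @ u # v # zs"] eq by force
    ultimately show "u \<noteq> v \<and> (adj G u v \<longrightarrow> ys = [])" by blast
  qed
  moreover have "set r \<inter> A = {hd r}"
  proof -
    have "u = hd r" if u: "u \<in> set r" "u \<in> A" for u
    proof -
      from u obtain xs ys where eq: "r = xs @ u # ys" by (meson split_list)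
      have "Q (u # ys)" using r u unfolding Q_def eq
        by (auto simp: successively_append_iff split: if_splits)
      then have "xs = []" using min[of "u # ys"] eq by simp
      then show ?thesis using eq by simp
    qed
    then show ?thesis using r by (auto simp: Q_def)
  qed
  moreover have "set r \<inter> B = {last r}"
  proof -
    have "u = last r" if u: "u \<in> set r" "u \<in> B" for u
    proof -
      from u obtain xs ys where eq: "r = xs @ u # ys" by (meson split_list)
      have "Q (xs @ [u])" using r u unfolding Q_def eq
        by (auto simp: successively_append_iff successively_Cons hd_append split: if_splits)
      then have "ys = []" using min[of "xs @ [u]"] eq by simp
      then show ?thesis using eq by simp
    qed
    then show ?thesis using r by (auto simp: Q_def)
  qed
  ultimately show ?thesis using that r by (auto simp: Q_def)
qed

section \<open>Thetas and near-prisms from induced paths\<close>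

lemma long_thetaI:
  assumes G: "simple_graph G" and "\<not> adj G a b" "a \<noteq> b"
    and "p1 \<noteq> []" "p2 \<noteq> []" "p3 \<noteq> []"
    and P: "ipath G (a # p1 @ [b])" "ipath G (a # p2 @ [b])" "ipath G (a # p3 @ [b])"
    and D: "set p1 \<inter> set p2 = {}" "set p1 \<inter> set p3 = {}" "set p2 \<inter> set p3 = {}"
    and A: "anticomplete G (set p1) (set p2)" "anticomplete G (set p1) (set p3)"
      "anticomplete G (set p2) (set p3)"
    and L: "l \<le> length p1 + length p2 + 2" "l \<le> length p1 + length p3 + 2"
      "l \<le> length p2 + length p3 + 2"
  shows "contains_induced G (long_theta l)"
proof -
  define X where "X = set (a # p1 @ [b]) \<union> set (a # p2 @ [b]) \<union> set (a # p3 @ [b])"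
  have XV: "X \<subseteq> verts G" using P[THEN ipath_verts] unfolding X_def by blast
  have int: "path_interior (a # p @ [b]) = set p" if "ipath G (a # p @ [b])" for p
    using ipath_distinct[OF that] by (auto simp: path_interior_def)
  have pb: "path_between (induce G X) a b (a # p @ [b])"
    if "ipath G (a # p @ [b])" "set (a # p @ [b]) \<subseteq> X" for p
    using path_betweenI[OF G that(1) _ that(2)] by simp
  have A': "\<not> adj G u w" "\<not> adj G w u"
    if "u \<in> set p \<and> w \<in> set q" "(p, q) \<in> {(p1, p2), (p1, p3), (p2, p3)}" for u w p q
    using that A adj_sym[OF G] unfolding anticomplete_def by blast+
  have edg: "edges (induce G X) = path_edges (a # p1 @ [b]) \<union> path_edges (a # p2 @ [b]) \<union> path_edges (a # p3 @ [b])"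
    (is "_ = ?R")
  proof
    show "?R \<subseteq> edges (induce G X)"
      unfolding ipath_edges[OF G P(1), symmetric] ipath_edges[OF G P(2), symmetric]
        ipath_edges[OF G P(3), symmetric] edges_induce X_def by blast
    have "{u, w} \<in> ?R" if uw: "u \<in> X" "w \<in> X" "adj G u w" for u w
    proof -
      have "\<exists>p\<in>{p1, p2, p3}. u \<in> set (a # p @ [b]) \<and> w \<in> set (a # p @ [b])"
        using uw A'[of u p1 w p2] A'[of u p1 w p3] A'[of u p2 w p3]
          A'[of w p1 u p2] A'[of w p1 u p3] A'[of w p2 u p3] unfolding X_def by auto
      then show ?thesis using uw(3)
        unfolding ipath_edges[OF G P(1), symmetric] ipath_edges[OF G P(2), symmetric]
          ipath_edges[OF G P(3), symmetric] edges_induce by auto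
    qed
    then show "edges (induce G X) \<subseteq> ?R" unfolding edges_induce by blast
  qed
  have vX: "verts (induce G X) = X" and nab: "\<not> adj (induce G X) a b"
    using XV assms(2) by (auto simp: induce_def)
  have sub: "set (a # p1 @ [b]) \<subseteq> X" "set (a # p2 @ [b]) \<subseteq> X" "set (a # p3 @ [b]) \<subseteq> X"
    unfolding X_def by blast+
  have len: "l \<le> plen (a # p @ [b]) + plen (a # q @ [b])" if "l \<le> length p + length q + 2" for p q
    using that by (simp add: plen_def)
  have "long_theta l (induce G X)"
    unfolding long_theta_def
    apply (rule exI[of _ a], rule exI[of _ b], rule exI[of _ "a # p1 @ [b]"],
        rule exI[of _ "a # p2 @ [b]"], rule exI[of _ "a # p3 @ [b]"])
    unfolding int[OF P(1)] int[OF P(2)] int[OF P(3)] vX edg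
    using assms(3) nab pb[OF P(1) sub(1)] pb[OF P(2) sub(2)] pb[OF P(3) sub(3)] D
      len[OF L(1)] len[OF L(2)] len[OF L(3)] X_def
    apply -
    by (intro conjI; (assumption | rule refl))
  then show ?thesis using XV unfolding contains_induced_def by blast
qed

text \<open>Only \<open>p1\<close> may be short. It may even be a single vertex, which is then
  shared by the two triangles. The bounds count vertices: \<open>l < length p2\<close> means at
  least \<open>l\<close> edges.\<close>

lemma long_near_prismI:
  assumes G: "simple_graph G" and ne: "p1 \<noteq> []" "p2 \<noteq> []" "p3 \<noteq> []"
    and P: "ipath G p1" "ipath G p2" "ipath G p3"
    and D: "set p1 \<inter> set p2 = {}" "set p1 \<inter> set p3 = {}" "set p2 \<inter> set p3 = {}"
    and A12: "\<And>u w. u \<in> set p1 \<Longrightarrow> w \<in> set p2 \<Longrightarrow>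
      adj G u w \<longleftrightarrow> u = hd p1 \<and> w = hd p2 \<or> u = last p1 \<and> w = last p2"
    and A13: "\<And>u w. u \<in> set p1 \<Longrightarrow> w \<in> set p3 \<Longrightarrow>
      adj G u w \<longleftrightarrow> u = hd p1 \<and> w = hd p3 \<or> u = last p1 \<and> w = last p3"
    and A23: "\<And>u w. u \<in> set p2 \<Longrightarrow> w \<in> set p3 \<Longrightarrow>
      adj G u w \<longleftrightarrow> u = hd p2 \<and> w = hd p3 \<or> u = last p2 \<and> w = last p3"
    and L: "0 < l" "l < length p2" "l < length p3"
  shows "contains_induced G (long_near_prism l)"
proof -
  define X where "X = set p1 \<union> set p2 \<union> set p3"
  define P where "P = (\<lambda>i::nat. if i = 1 then p1 else if i = 2 then p2 else p3)"
  define a where "a = (\<lambda>i. hd (P i))"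
  define b where "b = (\<lambda>i. last (P i))"
  have Ps: "P 1 = p1" "P 2 = p2" "P 3 = p3" "P (Suc 0) = p1" by (auto simp: P_def)
  have as: "a 1 = hd p1" "a 2 = hd p2" "a 3 = hd p3" "b 1 = last p1" "b 2 = last p2" "b 3 = last p3"
    "a (Suc 0) = hd p1" "b (Suc 0) = last p1"
    by (auto simp: a_def b_def Ps)
  have XV: "X \<subseteq> verts G" using assms(5-7)[THEN ipath_verts] unfolding X_def by blast
  have mem: "hd p1 \<in> set p1" "hd p2 \<in> set p2" "hd p3 \<in> set p3"
    "last p1 \<in> set p1" "last p2 \<in> set p2" "last p3 \<in> set p3" using ne by auto
  have d: "hd p2 \<noteq> last p2" "hd p3 \<noteq> last p3"
    using L(2,3) assms(6,7)[THEN ipath_distinct] ne(2,3)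
    by (metis distinct.simps(2) last.simps last_in_set length_0_conv length_Cons less_one list.exhaust_sel
      L(1) not_less_iff_gr_or_eq One_nat_def)+
  let ?I = "{1, 2, 3::nat}"
  have E: "edges (induce G X) = (\<Union>i \<in> ?I. path_edges (P i)) \<union>
       {{a i, a j} | i j. i \<in> ?I \<and> j \<in> ?I \<and> i \<noteq> j} \<union>
       {{b i, b j} | i j. i \<in> ?I \<and> j \<in> ?I \<and> i \<noteq> j}" (is "_ = ?R")
  proof
    have ea: "{{f i, f j} | i j. i \<in> ?I \<and> j \<in> ?I \<and> i \<noteq> j} = {{f 1, f 2}, {f 1, f 3}, {f 2, f 3}}"
      for f :: "nat \<Rightarrow> 'a"
    proof (intro subset_antisym subsetI)
      fix e assume "e \<in> {{f i, f j} | i j. i \<in> ?I \<and> j \<in> ?I \<and> i \<noteq> j}"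
      then obtain i j where "i \<in> ?I" "j \<in> ?I" "i \<noteq> j" "e = {f i, f j}" by blast
      then show "e \<in> {{f 1, f 2}, {f 1, f 3}, {f 2, f 3}}"
        by (elim insertE emptyE) (simp_all add: insert_commute)
    next
      fix e assume "e \<in> {{f 1, f 2}, {f 1, f 3}, {f 2, f 3}}"
      then consider "e = {f 1, f 2}" | "e = {f 1, f 3}" | "e = {f 2, f 3}" by blast
      then show "e \<in> {{f i, f j} | i j. i \<in> ?I \<and> j \<in> ?I \<and> i \<noteq> j}"
      proof cases
        case 1 then show ?thesis by (rule_tac CollectI, rule_tac exI[of _ 1], rule_tac exI[of _ 2]) simp
      next
        case 2 then show ?thesis by (rule_tac CollectI, rule_tac exI[of _ 1], rule_tac exI[of _ 3]) simp
      next
        case 3 then show ?thesis by (rule_tac CollectI, rule_tac exI[of _ 2], rule_tac exI[of _ 3]) simp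
      qed
    qed
    have R: "?R = edges (induce G (set p1)) \<union> edges (induce G (set p2)) \<union> edges (induce G (set p3))
      \<union> {{hd p1, hd p2}, {hd p1, hd p3}, {hd p2, hd p3}}
      \<union> {{last p1, last p2}, {last p1, last p3}, {last p2, last p3}}"
      unfolding ea as ipath_edges[OF G assms(5)] ipath_edges[OF G assms(6)] ipath_edges[OF G assms(7)]
      by (simp add: Ps Un_assoc)
    show "?R \<subseteq> edges (induce G X)"
    proof -
      have "adj G (hd p1) (hd p2)" "adj G (hd p1) (hd p3)" "adj G (hd p2) (hd p3)"
        "adj G (last p1) (last p2)" "adj G (last p1) (last p3)" "adj G (last p2) (last p3)"
        using A12 A13 A23 mem by auto
      then show ?thesis unfolding R edges_induce X_def using mem by blast
    qed
    have "{u, w} \<in> ?R" if uw: "u \<in> X" "w \<in> X" "adj G u w" for u w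
    proof -
      have c: "{u, w} \<in> {{hd p1, hd p2}, {hd p1, hd p3}, {hd p2, hd p3}}
          \<union> {{last p1, last p2}, {last p1, last p3}, {last p2, last p3}}"
        if "adj G u w"
          "u \<in> set p1 \<and> w \<in> set p2 \<or> u \<in> set p1 \<and> w \<in> set p3 \<or> u \<in> set p2 \<and> w \<in> set p3" for u w
        using that(2)
      proof (elim disjE conjE)
        assume "u \<in> set p1" "w \<in> set p2"
        then have "u = hd p1 \<and> w = hd p2 \<or> u = last p1 \<and> w = last p2"
          using A12[of u w] that(1) by metis
        then show ?thesis by (elim disjE conjE) (simp_all only: insert_iff Un_iff simp_thms)
      next
        assume "u \<in> set p1" "w \<in> set p3"
        then have "u = hd p1 \<and> w = hd p3 \<or> u = last p1 \<and> w = last p3"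
          using A13[of u w] that(1) by metis
        then show ?thesis by (elim disjE conjE) (simp_all only: insert_iff Un_iff simp_thms)
      next
        assume "u \<in> set p2" "w \<in> set p3"
        then have "u = hd p2 \<and> w = hd p3 \<or> u = last p2 \<and> w = last p3"
          using A23[of u w] that(1) by metis
        then show ?thesis by (elim disjE conjE) (simp_all only: insert_iff Un_iff simp_thms)
      qed
      note c1 = c[OF uw(3)] and c2 = c[OF adj_sym[OF G uw(3)], unfolded insert_commute[of w u "{}"]]
      consider "u \<in> set p1 \<and> w \<in> set p1 \<or> u \<in> set p2 \<and> w \<in> set p2 \<or> u \<in> set p3 \<and> w \<in> set p3"
        | "u \<in> set p1 \<and> w \<in> set p2 \<or> u \<in> set p1 \<and> w \<in> set p3 \<or> u \<in> set p2 \<and> w \<in> set p3"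
        | "w \<in> set p1 \<and> u \<in> set p2 \<or> w \<in> set p1 \<and> u \<in> set p3 \<or> w \<in> set p2 \<and> u \<in> set p3"
        using uw(1,2) unfolding X_def Un_iff by argo
      then show ?thesis
      proof cases
        case 1
        have "{u, w} \<in> edges (induce G S)" if "u \<in> S \<and> w \<in> S" for S
          unfolding edges_induce using that uw(3) by blast
        with 1 show ?thesis unfolding R Un_iff by metis
      next
        case 2 from c1[OF 2] show ?thesis unfolding R Un_iff by argo
      next
        case 3 from c2[OF 3] show ?thesis unfolding R Un_iff by argo
      qed
    qed
    then show "edges (induce G X) \<subseteq> ?R" unfolding edges_induce by blast
  qed
  have pb: "path_between (induce G X) (a i) (b i) (P i)" if "i \<in> ?I" for i
  proof -
    have "set p1 \<subseteq> X" "set p2 \<subseteq> X" "set p3 \<subseteq> X" by (auto simp: X_def)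
    then show ?thesis
      using that path_betweenI[OF G assms(5) ne(1)] path_betweenI[OF G assms(6) ne(2)]
        path_betweenI[OF G assms(7) ne(3)] by (elim insertE emptyE) (simp_all add: as Ps)
  qed
  have dis: "set (P i) \<inter> set (P j) = {}" if "i \<in> ?I" "j \<in> ?I" "i \<noteq> j" for i j
    using that D by (auto simp: Ps)
  have ab: "a ` ?I \<inter> b ` ?I = {} \<or> (\<exists>!i. i \<in> ?I \<and> a i = b i)"
  proof (cases "hd p1 = last p1")
    case True
    then have "\<exists>!i. i \<in> ?I \<and> a i = b i" using d by (intro ex1I[of _ 1]) (auto simp: as)
    then show ?thesis ..
  next
    case False
    then have "a ` ?I \<inter> b ` ?I = {}" using d D mem by (auto simp: as)
    then show ?thesis ..
  qed
  have "{i \<in> ?I. plen (P i) < l} \<subseteq> {1}" using L by (auto simp: Ps plen_def)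
  then have "card {i \<in> ?I. plen (P i) < l} \<le> card {1::nat}" by (intro card_mono) auto
  then have "card {i \<in> ?I. plen (P i) < l} \<le> 1" by simp
  moreover have "verts (induce G X) = (\<Union>i \<in> ?I. set (P i))"
    using XV by (auto simp: induce_def X_def Ps)
  ultimately have "long_near_prism l (induce G X)" unfolding long_near_prism_def Let_def
    using E ab
    apply -
    apply (rule exI[of _ a], rule exI[of _ b], rule exI[of _ P])
    by (intro conjI ballI impI; (assumption | (rule pb, assumption) | (rule dis, assumption+)))
  then show ?thesis using XV unfolding contains_induced_def by blast
qed

text \<open>The interior of an induced path from \<open>a\<close> to \<open>b\<close>, leaving open
  whether \<open>a\<close> and \<open>b\<close> are adjacent: the same notion serves a hole closed
  by the edge \<open>ab\<close>, a hole made of two such paths, and a theta made of three.\<close>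

definition lnk :: "'a sgraph \<Rightarrow> 'a \<Rightarrow> 'a \<Rightarrow> 'a list \<Rightarrow> bool" where
  "lnk G a b p \<longleftrightarrow> p \<noteq> [] \<and> ipath G p \<and> a \<notin> set p \<and> b \<notin> set p \<and>
     (\<forall>w\<in>set p. adj G a w \<longleftrightarrow> w = hd p) \<and> (\<forall>w\<in>set p. adj G b w \<longleftrightarrow> w = last p)"

lemma lnk_rev: "simple_graph G \<Longrightarrow> lnk G a b p \<Longrightarrow> lnk G b a (rev p)"
  unfolding lnk_def by (simp add: ipath_rev hd_rev last_rev)

lemma lnk_ipath:
  assumes G: "simple_graph G" and "a \<in> verts G" "b \<in> verts G" "a \<noteq> b" "\<not> adj G a b" "lnk G a b p"
  shows "ipath G (a # p @ [b])"
proof -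
  have p: "p \<noteq> []" "ipath G p" "a \<notin> set p" "b \<notin> set p"
    "\<And>w. w \<in> set p \<Longrightarrow> adj G a w \<longleftrightarrow> w = hd p" "\<And>w. w \<in> set p \<Longrightarrow> adj G w b \<longleftrightarrow> w = last p"
    using assms(6) adj_commute[OF G] unfolding lnk_def by blast+
  have "hd p \<in> set p" using p(1) by simp
  then have "b \<noteq> hd p" using p(4) by metis
  then show ?thesis using p assms(2-5) by (simp add: ipath_append)
qed

lemma hole_lnk1:
  assumes G: "simple_graph G" and "a \<in> verts G" "b \<in> verts G" "adj G a b" "lnk G a b p" "2 \<le> length p"
  shows "hole G (a # p @ [b])"
proof -
  have p: "p \<noteq> []" "ipath G p" "a \<notin> set p" "b \<notin> set p"
    "\<And>w. w \<in> set p \<Longrightarrow> adj G a w \<longleftrightarrow> w = hd p" "\<And>w. w \<in> set p \<Longrightarrow> adj G w b \<longleftrightarrow> w = last p"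
    using assms(5) adj_commute[OF G] unfolding lnk_def by blast+
  have last: "last p \<in> set p" using p(1) by simp
  have ab: "a \<noteq> b" using assms(4) adj_irrefl[OF G] by metis
  show ?thesis
  proof (rule hole_ConsI[OF G])
    show "ipath G (p @ [b])" using p assms(3) by (simp add: ipath_append)
    show "a \<notin> set (p @ [b])" using p(3) ab by simp
    fix w assume "w \<in> set (p @ [b])"
    then consider "w \<in> set p" | "w = b" by auto
    then show "adj G a w \<longleftrightarrow> w = hd (p @ [b]) \<or> w = last (p @ [b])"
    proof cases
      case 1
      then have "w \<noteq> b" using p(4) by metis
      with 1 p(1,5) show ?thesis by simp
    qed (use assms(4) in simp)
  qed (use assms(2,6) in simp_all)
qed

lemma hole_lnk2:
  assumes G: "simple_graph G" and "a \<in> verts G" "b \<in> verts G" "a \<noteq> b" "\<not> adj G a b"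
    and p: "lnk G a b p" and q: "lnk G a b q"
    and D: "set p \<inter> set q = {}" "anticomplete G (set p) (set q)"
  shows "hole G (a # p @ b # rev q)"
proof -
  note P = p[unfolded lnk_def] and Q = q[unfolded lnk_def]
  have mem: "hd p \<in> set p" "last p \<in> set p" "hd q \<in> set q" "last q \<in> set q" using P Q by auto
  have np: "\<not> adj G u w" if "u \<in> set p" "w \<in> set q" for u w
    using D(2) that unfolding anticomplete_def by blast
  have bq: "ipath G (b # rev q)"
    using Q assms(3) by (simp add: ipath_rev[OF G] hd_rev)
  have ipa: "ipath G (p @ b # rev q)"
    unfolding ipath_append
  proof (intro conjI ballI)
    show "set p \<inter> set (b # rev q) = {}" using P D(1) by auto
    fix u w assume u: "u \<in> set p" and "w \<in> set (b # rev q)"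
    then consider "w = b" | "w \<in> set q" by auto
    then show "adj G u w \<longleftrightarrow> u = last p \<and> w = hd (b # rev q)"
    proof cases
      case 1 then show ?thesis using P u adj_commute[OF G, of u b] by auto
    next
      case 2
      then have "w \<noteq> b" using Q by metis
      with 2 np[OF u] show ?thesis by auto
    qed
  qed (use P bq in auto)
  show ?thesis
  proof (rule hole_ConsI[OF G ipa])
    have "1 \<le> length p" "1 \<le> length q" using P Q by (simp_all add: Suc_le_eq)
    then show "3 \<le> length (p @ b # rev q)" by simp
    show "a \<notin> set (p @ b # rev q)" using P Q assms(4) by simp
    fix w assume "w \<in> set (p @ b # rev q)"
    then consider "w \<in> set p" | "w = b" | "w \<in> set q" by auto
    moreover have e: "hd (p @ b # rev q) = hd p" "last (p @ b # rev q) = hd q"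
      using P Q by (simp_all add: last_rev)
    ultimately show "adj G a w \<longleftrightarrow> w = hd (p @ b # rev q) \<or> w = last (p @ b # rev q)"
    proof cases
      case 1
      then have "w \<noteq> hd q" using D(1) mem(3) by blast
      with 1 show ?thesis unfolding e using P by simp
    next
      case 2
      have "b \<noteq> hd p" "b \<noteq> hd q" using mem P Q by metis+
      with 2 assms(5) show ?thesis unfolding e by simp
    next
      case 3
      then have "w \<noteq> hd p" using D(1) mem(1) by blast
      with 3 show ?thesis unfolding e using Q by simp
    qed
  qed (use assms(2) in simp)
qed

lemma long_theta_lnk:
  assumes G: "simple_graph G" and "a \<in> verts G" "b \<in> verts G" "a \<noteq> b" "\<not> adj G a b"
    and P: "lnk G a b p1" "lnk G a b p2" "lnk G a b p3"
    and D: "set p1 \<inter> set p2 = {}" "set p1 \<inter> set p3 = {}" "set p2 \<inter> set p3 = {}"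
    and A: "anticomplete G (set p1) (set p2)" "anticomplete G (set p1) (set p3)"
      "anticomplete G (set p2) (set p3)"
    and L: "l \<le> length p1 + length p2 + 2" "l \<le> length p1 + length p3 + 2"
      "l \<le> length p2 + length p3 + 2"
  shows "contains_induced G (long_theta l)"
  using P by (intro long_thetaI[OF G assms(5,4) _ _ _ P[THEN lnk_ipath[OF G assms(2-5)]] D A L])
    (auto simp: lnk_def)

section \<open>Cyclic coordinates on a hole\<close>

locale hole_graph =
  fixes G :: "'a sgraph" and C :: "'a list"
  assumes G: "simple_graph G" and C: "hole G C"
begin

text \<open>Positions are arbitrary integers rather than residues, so that an arc passing the first
  vertex of the list is still an interval and order arguments remain linear arithmetic.\<close>

definition N :: int where "N = int (length C)"
definition c :: "int \<Rightarrow> 'a" where "c i = C ! nat (i mod N)"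

lemma N4: "4 \<le> N" using C by (simp add: hole_def N_def)

lemma nat_mod_less: "nat (i mod N) < length C"
proof -
  have "0 \<le> i mod N \<and> i mod N < N" using N4 by simp
  then show ?thesis unfolding N_def by linarith
qed

lemma c_in: "c i \<in> set C" unfolding c_def using nat_mod_less by simp

lemma c_verts: "c i \<in> verts G" using c_in C unfolding hole_def by blast

lemma c_eq: "c i = c j \<longleftrightarrow> i mod N = j mod N"
proof -
  have "0 \<le> i mod N" "0 \<le> j mod N" using N4 by simp_all
  then have "nat (i mod N) = nat (j mod N) \<longleftrightarrow> i mod N = j mod N" by linarith
  then show ?thesis unfolding c_def using nat_mod_less C by (simp add: hole_def nth_eq_iff_index_eq)
qed

lemma c_add [simp]: "c (i + N) = c i" "c (i - N) = c i" "c (N + i) = c i"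
  by (simp_all add: c_eq)

lemma in_C:
  assumes "v \<in> set C"
  obtains i where "m \<le> i" "i < m + N" "c i = v"
proof -
  obtain k where k: "k < length C" "v = C ! k" using assms by (metis in_set_conv_nth)
  define i where "i = m + (int k - m) mod N"
  have "0 \<le> (int k - m) mod N \<and> (int k - m) mod N < N" using N4 by simp
  then have "m \<le> i" "i < m + N" by (simp_all add: i_def)
  moreover have "i mod N = int k" using k(1) unfolding i_def N_def by (simp add: mod_simps)
  then have "c i = v" using k(2) by (simp add: c_def)
  ultimately show ?thesis using that by blast
qed

lemma shift_into:
  obtains i' where "m \<le> i'" "i' < m + N" "c i' = c i"
  using in_C[OF c_in] by blast

lemma c_window: "\<bar>i - j\<bar> < N \<Longrightarrow> c i = c j \<longleftrightarrow> i = j"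
proof
  assume a: "\<bar>i - j\<bar> < N" "c i = c j"
  then have "N dvd i - j" by (simp add: c_eq mod_eq_dvd_iff)
  with a(1) show "i = j" using zdvd_imp_le[of N "\<bar>i - j\<bar>"] by fastforce
qed simp

lemma adj_C: "adj G u w \<longleftrightarrow> {u, w} \<in> cycle_edges C" if "u \<in> set C" "w \<in> set C"
proof -
  have "cycle_edges C = {{u, w} | u w. u \<in> set C \<and> w \<in> set C \<and> adj G u w}"
    using C unfolding hole_def edges_induce by simp
  moreover have "adj G u w" if "{u, w} = {u', w'}" "adj G u' w'" for u' w'
    using that adj_sym[OF G] by (metis doubleton_eq_iff)
  ultimately show ?thesis using that by blast
qed

lemma cycle_edges_nth:
  assumes "a < length C" "b < length C"
  shows "{C ! a, C ! b} \<in> cycle_edges C \<longleftrightarrow>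
    b = Suc a \<or> a = Suc b \<or> a = 0 \<and> b = length C - 1 \<or> b = 0 \<and> a = length C - 1"
proof -
  have ne: "C \<noteq> []" and d: "distinct C" using C unfolding hole_def by auto
  have eq: "{C ! a, C ! b} = {C ! i, C ! j} \<longleftrightarrow> a = i \<and> b = j \<or> a = j \<and> b = i"
    if "i < length C" "j < length C" for i j
    using that assms d by (simp add: doubleton_eq_iff nth_eq_iff_index_eq)
  have 1: "{C ! a, C ! b} = {last C, hd C} \<longleftrightarrow> a = 0 \<and> b = length C - 1 \<or> b = 0 \<and> a = length C - 1"
    using eq[of "length C - 1" 0] ne by (auto simp: last_conv_nth hd_conv_nth)
  have 2: "{C ! a, C ! b} \<in> path_edges C \<longleftrightarrow> b = Suc a \<or> a = Suc b"
  proof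
    assume "{C ! a, C ! b} \<in> path_edges C"
    then obtain i where "Suc i < length C" "{C ! a, C ! b} = {C ! i, C ! Suc i}"
      unfolding path_edges_def by blast
    then show "b = Suc a \<or> a = Suc b" using eq[of i "Suc i"] by auto
  next
    assume "b = Suc a \<or> a = Suc b"
    then show "{C ! a, C ! b} \<in> path_edges C"
      using assms unfolding path_edges_def by (auto simp: insert_commute)
  qed
  show ?thesis unfolding cycle_edges_def using 1 2 by blast
qed

lemma N_dvd_small: "- N - 1 < d \<Longrightarrow> d < N \<Longrightarrow> N dvd d \<longleftrightarrow> d = 0 \<or> d = - N"
proof
  assume b: "- N - 1 < d" "d < N" and "N dvd d"
  then obtain k where k: "d = N * k" by auto
  have "k < 1"
  proof (rule ccontr)
    assume "\<not> k < 1"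
    then have "N * 1 \<le> N * k" using N4 by (intro mult_left_mono) auto
    then show False using b k by linarith
  qed
  moreover have "- 2 < k"
  proof (rule ccontr)
    assume "\<not> - 2 < k"
    then have "N * k \<le> N * (- 2)" using N4 by (intro mult_left_mono) auto
    then show False using b k N4 by linarith
  qed
  ultimately have "k = 0 \<or> k = - 1" by linarith
  then show "d = 0 \<or> d = - N" using k by auto
qed auto

lemma adj_c_mod: "adj G (c i) (c j) \<longleftrightarrow> N dvd j - i - 1 \<or> N dvd i - j - 1"
proof -
  define a b where "a = i mod N" and "b = j mod N"
  have ab: "0 \<le> a" "a < N" "0 \<le> b" "b < N" using N4 by (simp_all add: a_def b_def)
  obtain a' b' where ab': "a = int a'" "b = int b'" using ab by (metis nonneg_int_cases)
  have l: "a' < length C" "b' < length C" using ab unfolding ab' N_def by simp_all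
  have "adj G (c i) (c j) \<longleftrightarrow> {C ! a', C ! b'} \<in> cycle_edges C"
    using adj_C[OF c_in c_in, of i j] unfolding c_def a_def[symmetric] b_def[symmetric] ab' by simp
  also have "\<dots> \<longleftrightarrow> b = a + 1 \<or> a = b + 1 \<or> a = 0 \<and> b = N - 1 \<or> b = 0 \<and> a = N - 1"
    unfolding cycle_edges_nth[OF l] ab' N_def using l by presburger
  also have "\<dots> \<longleftrightarrow> N dvd b - a - 1 \<or> N dvd a - b - 1"
  proof -
    have 1: "N dvd b - a - 1 \<longleftrightarrow> b - a - 1 = 0 \<or> b - a - 1 = - N"
      and 2: "N dvd a - b - 1 \<longleftrightarrow> a - b - 1 = 0 \<or> a - b - 1 = - N"
      using ab by (intro N_dvd_small; linarith)+
    show ?thesis unfolding 1 2 using ab N4 by presburger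
  qed
  also have "\<dots> \<longleftrightarrow> N dvd j - i - 1 \<or> N dvd i - j - 1"
  proof -
    have "(b - a - 1) mod N = (j - i - 1) mod N" "(a - b - 1) mod N = (i - j - 1) mod N"
      unfolding a_def b_def by (intro mod_diff_cong; simp)+
    then show ?thesis by (simp add: dvd_eq_mod_eq_0)
  qed
  finally show ?thesis .
qed

lemma adj_c:
  assumes "\<bar>i - j\<bar> < N"
  shows "adj G (c i) (c j) \<longleftrightarrow> \<bar>i - j\<bar> = 1 \<or> \<bar>i - j\<bar> = N - 1"
proof -
  have 1: "N dvd j - i - 1 \<longleftrightarrow> j - i - 1 = 0 \<or> j - i - 1 = - N"
    and 2: "N dvd i - j - 1 \<longleftrightarrow> i - j - 1 = 0 \<or> i - j - 1 = - N"
    using assms by (intro N_dvd_small; linarith)+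
  show ?thesis unfolding adj_c_mod 1 2 using assms N4 by presburger
qed

lemma adj_c_succ: "adj G (c i) (c (i + 1))"
  by (simp add: adj_c_mod)

lemma nbr_c: "adj G (c k) w \<Longrightarrow> w \<in> set C \<Longrightarrow> w = c (k + 1) \<or> w = c (k - 1)"
proof -
  assume a: "adj G (c k) w" "w \<in> set C"
  obtain j where j: "k - 1 \<le> j" "j < k - 1 + N" "c j = w" using in_C[OF a(2)] by blast
  then have "\<bar>k - j\<bar> < N" using N4 by linarith
  then have "\<bar>k - j\<bar> = 1 \<or> \<bar>k - j\<bar> = N - 1" using adj_c a(1) j(3) by blast
  then have "j = k + 1 \<or> j = k - 1" using j N4 by linarith
  then show ?thesis using j(3) by blast
qed

section \<open>Arcs of the hole\<close>

definition seg :: "int \<Rightarrow> int \<Rightarrow> 'a list" where "seg m n = map c [m..n]"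

lemma set_seg: "set (seg m n) = c ` {m..n}" by (simp add: seg_def)
lemma length_seg: "length (seg m n) = nat (n - m + 1)" by (simp add: seg_def)
lemma hd_seg: "m \<le> n \<Longrightarrow> hd (seg m n) = c m" by (simp add: seg_def upto_rec1)
lemma last_seg: "m \<le> n \<Longrightarrow> last (seg m n) = c n" by (simp add: seg_def upto_rec2)
lemma seg_ne: "m \<le> n \<Longrightarrow> seg m n \<noteq> []" by (simp add: seg_def)
lemma seg_sub: "set (seg m n) \<subseteq> set C" using c_in by (auto simp: set_seg)

lemma ipath_seg: "n - m \<le> N - 2 \<Longrightarrow> ipath G (seg m n)"
proof (induction m n rule: upto.induct)
  case (1 m n)
  show ?case
  proof (cases "m \<le> n")
    case True
    have eq: "seg m n = c m # seg (m + 1) n" using True by (simp add: seg_def upto_rec1)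
    have mem: "\<exists>k. m < k \<and> k \<le> n \<and> w = c k" if "w \<in> set (seg (m + 1) n)" for w
      using that unfolding set_seg by force
    have "c m \<notin> set (seg (m + 1) n)"
    proof
      assume "c m \<in> set (seg (m + 1) n)"
      then obtain k where "m < k" "k \<le> n" "c m = c k" using mem by blast
      then show False using c_window[of m k] 1(2) by simp
    qed
    moreover have "adj G (c m) w \<longleftrightarrow> w = hd (seg (m + 1) n)" if w: "w \<in> set (seg (m + 1) n)" for w
    proof -
      obtain k where k: "m < k" "k \<le> n" "w = c k" using mem[OF w] by blast
      have "adj G (c m) (c k) \<longleftrightarrow> k = m + 1" using adj_c[of m k] k 1(2) by auto
      moreover have "c k = c (m + 1) \<longleftrightarrow> k = m + 1" using c_window[of k "m + 1"] k 1(2) by simp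
      ultimately show ?thesis using k hd_seg[of "m + 1" n] by simp
    qed
    moreover have "ipath G (seg (m + 1) n)" using 1 True by simp
    ultimately show ?thesis unfolding eq using c_verts by simp
  next
    case False then show ?thesis by (simp add: seg_def)
  qed
qed

lemma seg_disjoint:
  assumes "n < m'" "n' < m + N"
  shows "set (seg m n) \<inter> set (seg m' n') = {}"
  unfolding set_seg using assms c_window by fastforce

lemma seg_anticomplete:
  assumes "n + 2 \<le> m'" "n' + 2 \<le> m + N"
  shows "anticomplete G (set (seg m n)) (set (seg m' n'))"
  unfolding anticomplete_def set_seg using assms adj_c by fastforce

section \<open>Marks, gaps and links\<close>

definition mk :: "'a \<Rightarrow> int \<Rightarrow> bool" where "mk v i \<longleftrightarrow> adj G v (c i)"

lemma mk_add [simp]: "mk v (i + N) = mk v i" "mk v (i - N) = mk v i" "mk v (N + i) = mk v i"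
  by (simp_all add: mk_def)

text \<open>If \<open>v\<close> has a single neighbour on \<open>C\<close>, its gap goes once around
  and has length \<open>N\<close>.\<close>

definition gap :: "'a \<Rightarrow> int \<Rightarrow> int \<Rightarrow> bool" where
  "gap v i j \<longleftrightarrow> i < j \<and> mk v i \<and> mk v j \<and> (\<forall>k. i < k \<and> k < j \<longrightarrow> \<not> mk v k)"

lemma gap_add: "gap v i j \<Longrightarrow> gap v (i + N) (j + N)" "gap v i j \<Longrightarrow> gap v (i - N) (j - N)"
proof -
  assume g: "gap v i j"
  have "\<not> mk v k" if "i + N < k" "k < j + N" for k
  proof -
    have "i < k - N" "k - N < j" using that by linarith+
    then have "\<not> mk v (k - N)" using g unfolding gap_def by blast
    then show ?thesis by simp
  qed
  then show "gap v (i + N) (j + N)" using g unfolding gap_def by simp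
  have "\<not> mk v k" if "i - N < k" "k < j - N" for k
  proof -
    have "i < k + N" "k + N < j" using that by linarith+
    then have "\<not> mk v (k + N)" using g unfolding gap_def by blast
    then show ?thesis by simp
  qed
  then show "gap v (i - N) (j - N)" using g unfolding gap_def by simp
qed

text \<open>A stretch of \<open>C\<close> that is the interior of an induced path between
  \<open>x\<close> and \<open>y\<close>, in either direction; \<open>m = n\<close> is a common
  neighbour.\<close>

definition link :: "'a \<Rightarrow> 'a \<Rightarrow> int \<Rightarrow> int \<Rightarrow> bool" where
  "link x y m n \<longleftrightarrow> m \<le> n \<and>
     ((\<forall>k. m \<le> k \<and> k \<le> n \<longrightarrow> (mk x k \<longleftrightarrow> k = m) \<and> (mk y k \<longleftrightarrow> k = n)) \<or>
      (\<forall>k. m \<le> k \<and> k \<le> n \<longrightarrow> (mk y k \<longleftrightarrow> k = m) \<and> (mk x k \<longleftrightarrow> k = n)))"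

lemma next_mark:
  assumes "mk v k" "k \<ge> i"
  obtains j where "i \<le> j" "j \<le> k" "mk v j" "\<And>k. i \<le> k \<Longrightarrow> k < j \<Longrightarrow> \<not> mk v k"
proof -
  define P where "P t \<longleftrightarrow> mk v (i + int t)" for t
  have "P (nat (k - i))" using assms by (simp add: P_def)
  then have L: "P (LEAST t. P t)" "(LEAST t. P t) \<le> nat (k - i)" by (rule LeastI, rule Least_le)
  have no: "\<not> mk v k'" if "i \<le> k'" "k' < i + int (LEAST t. P t)" for k'
    using not_less_Least[of "nat (k' - i)" P] that by (simp add: P_def)
  show ?thesis
  proof (rule that[of "i + int (LEAST t. P t)"])
    show "i + int (LEAST t. P t) \<le> k" using L(2) assms(2) by linarith
    show "mk v (i + int (LEAST t. P t))" using L(1) by (simp only: P_def)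
  qed (simp, rule no)
qed

lemma prev_mark:
  assumes "mk v k" "k \<le> i"
  obtains j where "k \<le> j" "j \<le> i" "mk v j" "\<And>k. j < k \<Longrightarrow> k \<le> i \<Longrightarrow> \<not> mk v k"
proof -
  define P where "P t \<longleftrightarrow> mk v (i - int t)" for t
  have "P (nat (i - k))" using assms by (simp add: P_def)
  then have L: "P (LEAST t. P t)" "(LEAST t. P t) \<le> nat (i - k)" by (rule LeastI, rule Least_le)
  have no: "\<not> mk v k'" if "i - int (LEAST t. P t) < k'" "k' \<le> i" for k'
    using not_less_Least[of "nat (i - k')" P] that by (simp add: P_def)
  show ?thesis
  proof (rule that[of "i - int (LEAST t. P t)"])
    show "k \<le> i - int (LEAST t. P t)" using L(2) assms(2) by linarith
    show "mk v (i - int (LEAST t. P t))" using L(1) by (simp only: P_def)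
  qed (simp, rule no)
qed

text \<open>If the \<open>x\<close>-mark comes first, pass to the last \<open>x\<close>-mark up to
  the \<open>y\<close>-mark and from there to the first \<open>y\<close>-mark. The other order is
  symmetric.\<close>

lemma link_exists:
  assumes "mk x i" "mk y j" "m \<le> i" "i \<le> n" "m \<le> j" "j \<le> n"
  obtains m' n' where "m \<le> m'" "n' \<le> n" "link x y m' n'"
proof -
  have *: "\<exists>m' n'. m \<le> m' \<and> n' \<le> n \<and> link x y m' n'"
    if as: "mk x i" "mk y j" "m \<le> i" "i \<le> j" "j \<le> n" for x y i j
  proof -
    obtain i' where i': "i \<le> i'" "i' \<le> j" "mk x i'" "\<And>k. i' < k \<Longrightarrow> k \<le> j \<Longrightarrow> \<not> mk x k"
      using prev_mark[OF as(1,4)] by blast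
    obtain j' where j': "i' \<le> j'" "j' \<le> j" "mk y j'" "\<And>k. i' \<le> k \<Longrightarrow> k < j' \<Longrightarrow> \<not> mk y k"
      using next_mark[OF as(2) i'(2)] by blast
    have "link x y i' j'" unfolding link_def using i' j' by (smt (verit))
    then show ?thesis using i' j' as by (smt (verit))
  qed
  have sym: "link x y m' n'" if "link y x m' n'" for m' n' using that unfolding link_def by blast
  show ?thesis
  proof (cases "i \<le> j")
    case True then show ?thesis using *[of x i y j] assms that by blast
  next
    case False then show ?thesis using *[of y j x i] assms that sym by (smt (verit))
  qed
qed

lemma lnk_of_link:
  assumes "link x y m n" "n - m \<le> N - 2" "x \<notin> set C" "y \<notin> set C"
  obtains p where "lnk G x y p" "set p = set (seg m n)" "int (length p) = n - m + 1"
proof -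
  have mn: "m \<le> n" using assms(1) by (simp add: link_def)
  have xy: "x \<notin> set (seg m n)" "y \<notin> set (seg m n)" using assms(3,4) seg_sub by blast+
  have w: "c k = c k' \<longleftrightarrow> k = k'" if "m \<le> k" "k \<le> n" "m \<le> k'" "k' \<le> n" for k k'
    using c_window[of k k'] that assms(2) by linarith
  consider "\<forall>k. m \<le> k \<and> k \<le> n \<longrightarrow> (mk x k \<longleftrightarrow> k = m) \<and> (mk y k \<longleftrightarrow> k = n)"
    | "\<forall>k. m \<le> k \<and> k \<le> n \<longrightarrow> (mk y k \<longleftrightarrow> k = m) \<and> (mk x k \<longleftrightarrow> k = n)"
    using assms(1) unfolding link_def by blast
  then show ?thesis
  proof cases
    case 1
    have "lnk G x y (seg m n)"
      unfolding lnk_def using xy ipath_seg[OF assms(2)] seg_ne[OF mn] 1 w mn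
      by (auto simp: hd_seg last_seg set_seg mk_def)
    then show ?thesis using that[of "seg m n"] mn by (simp add: length_seg)
  next
    case 2
    have "lnk G y x (seg m n)"
      unfolding lnk_def using xy ipath_seg[OF assms(2)] seg_ne[OF mn] 2 w mn
      by (auto simp: hd_seg last_seg set_seg mk_def)
    then show ?thesis using that[of "rev (seg m n)"] mn lnk_rev[OF G] by (simp add: length_seg)
  qed
qed

text \<open>A position \<open>k\<close> violating this would make \<open>seg k (k + 3)\<close> a
  subpath of length three that contains all neighbours of \<open>v\<close> on
  \<open>C\<close>.\<close>

lemma major_spread:
  assumes "major G C v"
  shows "\<exists>i. mk v i \<and> (\<forall>i'. k \<le> i' \<and> i' \<le> k + 3 \<longrightarrow> c i' \<noteq> c i)"
proof (rule ccontr)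
  assume "\<not> ?thesis"
  then have a: "\<exists>i'. k \<le> i' \<and> i' \<le> k + 3 \<and> c i' = c i" if "mk v i" for i using that by blast
  have s: "seg k (k + 3) = [c k, c (k + 1), c (k + 2), c (k + 3)]"
  proof -
    have "[k..k + 3] = [k, k + 1, k + 2, k + 3]" by (simp add: upto_rec1)
    then show ?thesis by (simp add: seg_def)
  qed
  have "distinct (seg k (k + 3))"
    using N4 c_window[of k "k + 1"] c_window[of k "k + 2"] c_window[of k "k + 3"]
      c_window[of "k + 1" "k + 2"] c_window[of "k + 1" "k + 3"] c_window[of "k + 2" "k + 3"]
    unfolding s by simp
  moreover have "plen (seg k (k + 3)) = 3" by (simp add: s plen_def)
  moreover have "path_edges (seg k (k + 3)) \<subseteq> cycle_edges C"
    using adj_c_succ[of k] adj_c_succ[of "k + 1"] adj_c_succ[of "k + 2"] adj_C[OF c_in c_in]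
    by (simp add: s path_edges_Cons add.assoc)
  moreover have "{u \<in> set C. adj G v u} \<subseteq> set (seg k (k + 3))"
  proof
    fix u assume "u \<in> {u \<in> set C. adj G v u}"
    then obtain i where i: "mk v i" "c i = u" using in_C[of u 0] unfolding mk_def by blast
    then obtain i' where "k \<le> i'" "i' \<le> k + 3" "c i' = u" using a by metis
    then show "u \<in> set (seg k (k + 3))" unfolding set_seg by auto
  qed
  ultimately show False using assms unfolding major_def by blast
qed

text \<open>The list in the definition of \<open>major\<close> is only known to use edges of
  \<open>C\<close>. Being free of repetitions it cannot turn back, so it is an arc in one of the two
  directions.\<close>

lemma nonmajor_window:
  assumes "v \<in> verts G" "v \<notin> set C" "\<not> major G C v"
  obtains k where "\<And>i. mk v i \<Longrightarrow> \<exists>i'. k \<le> i' \<and> i' \<le> k + 3 \<and> c i' = c i"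
proof -
  obtain p where p: "distinct p" "plen p = 3" "path_edges p \<subseteq> cycle_edges C"
    "{u \<in> set C. adj G v u} \<subseteq> set p" using assms unfolding major_def by blast
  obtain p0 p1 p2 p3 where p4: "p = [p0, p1, p2, p3]"
  proof -
    have "length p = 4" using p(2) by (simp add: plen_def)
    then show ?thesis using that by (auto simp: numeral_eq_Suc length_Suc_conv)
  qed
  have ed: "adj G u w \<and> u \<in> set C \<and> w \<in> set C" if "{u, w} \<in> cycle_edges C" for u w
  proof -
    have "{u, w} \<in> edges (induce G (set C))" using that C unfolding hole_def by simp
    then obtain u' w' where "{u, w} = {u', w'}" "u' \<in> set C" "w' \<in> set C" "adj G u' w'"
      unfolding edges_induce by blast
    then show ?thesis using adj_sym[OF G] by (metis doubleton_eq_iff)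
  qed
  have e: "adj G p0 p1 \<and> p0 \<in> set C \<and> p1 \<in> set C" "adj G p1 p2 \<and> p2 \<in> set C" "adj G p2 p3 \<and> p3 \<in> set C"
    using p(3) ed unfolding p4 by (auto simp: path_edges_Cons)
  obtain k where k: "c k = p0" using in_C e(1) by metis
  have "p1 = c (k + 1) \<or> p1 = c (k - 1)" using nbr_c[of k p1] e k by simp
  then have "\<exists>k. set p = c ` {k..k + 3}"
  proof
    assume 1: "p1 = c (k + 1)"
    have 2: "p2 = c (k + 2)" using nbr_c[of "k + 1" p2] e 1 k p(1) p4 by (auto simp: add.assoc)
    have e3: "k + 2 + 1 = k + 3" "k + 2 - 1 = k + 1" by simp_all
    have "p3 = c (k + 3) \<or> p3 = c (k + 1)" using nbr_c[of "k + 2" p3, unfolded e3] e(3) 2 by blast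
    then have 3: "p3 = c (k + 3)" using 1 p(1) p4 by auto
    have "{k..k + 3} = {k, k + 1, k + 2, k + 3}" by auto
    then show ?thesis using 1 2 3 k p4 by (intro exI[of _ k]) simp
  next
    assume 1: "p1 = c (k - 1)"
    have 2: "p2 = c (k - 2)" using nbr_c[of "k - 1" p2] e 1 k p(1) p4 by auto
    have "k - 2 - 1 = k - 3" "k - 2 + 1 = k - 1" by simp_all
    then have 3: "p3 = c (k - 3)" using nbr_c[of "k - 2" p3] e 1 2 k p(1) p4 by auto
    have "{k - 3..k - 3 + 3} = {k, k - 1, k - 2, k - 3}" by auto
    then show ?thesis using 1 2 3 k p4 by (intro exI[of _ "k - 3"]) simp
  qed
  then obtain k' where k': "set p = c ` {k'..k' + 3}" by blast
  show ?thesis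
  proof (rule that[of k'])
    fix i assume "mk v i"
    then have "c i \<in> c ` {k'..k' + 3}" using p(4) c_in k' unfolding mk_def by auto
    then show "\<exists>i'. k' \<le> i' \<and> i' \<le> k' + 3 \<and> c i' = c i" by force
  qed
qed

end

section \<open>Parity of gaps and links\<close>

locale shortest_hole = hole_graph G C for G :: "'a sgraph" and C +
  fixes l :: nat
  assumes cand: "candidate l G" and shortest: "shortest_long_even_hole l G C" and l4: "4 \<le> l"
begin

abbreviation L :: int where "L \<equiv> int l"

text \<open>Candidates exclude long even holes of length at most \<open>2 * l + 2\<close>, and
  \<open>2 * l + 3\<close> is odd.\<close>

lemma N_even: "even N" and N_large: "2 * L + 4 \<le> N"
proof -
  have h: "even (length C)" "\<not> length C \<le> 2 * l + 2"
    using shortest cand unfolding shortest_long_even_hole_def candidate_def long_even_hole_def by blast+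
  then show "even N" by (simp add: N_def)
  have "2 * l + 4 \<le> length C" using h by presburger
  then show "2 * L + 4 \<le> N" unfolding N_def by linarith
qed

text \<open>The source of all parity statements: an even hole in this range of lengths would be a
  long even hole shorter than \<open>C\<close>.\<close>

lemma odd_hole:
  assumes "hole G h" "int (length h) = k" "L \<le> k" "k < N"
  shows "odd k"
proof -
  have "odd (length h)"
    using assms shortest unfolding shortest_long_even_hole_def long_even_hole_def N_def by fastforce
  then show ?thesis using assms(2) by auto
qed

lemma no_theta: "\<not> contains_induced G (long_theta l)"
  and no_near_prism: "\<not> contains_induced G (long_near_prism l)"
  using cand unfolding candidate_def by blast+

definition off :: "'a \<Rightarrow> bool" where "off v \<longleftrightarrow> v \<in> verts G \<and> v \<notin> set C"

lemma major_off: "major G C v \<Longrightarrow> off v"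
  by (simp add: major_def off_def)

text \<open>The gap and \<open>v\<close> form a hole with \<open>j - i + 2\<close> vertices; the two
  bounds put this length into the range of \<open>odd_hole\<close>.\<close>

lemma gap_odd:
  assumes v: "off v" and g: "gap v i j" and "L - 2 \<le> j - i" "j - i \<le> N - 3"
  shows "odd (j - i)"
proof -
  have ij: "i < j" "mk v i" "mk v j" "\<And>k. i < k \<Longrightarrow> k < j \<Longrightarrow> \<not> mk v k" using g unfolding gap_def by blast+
  have "hole G (v # seg i j)"
  proof (rule hole_ConsI[OF G])
    show "ipath G (seg i j)" using assms(4) by (intro ipath_seg) simp
    show "3 \<le> length (seg i j)" using assms(3) l4 ij(1) by (simp add: length_seg)
    show "v \<in> verts G" "v \<notin> set (seg i j)" using v seg_sub unfolding off_def by blast+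
    fix w assume "w \<in> set (seg i j)"
    then obtain k where k: "i \<le> k" "k \<le> j" "w = c k" unfolding set_seg by auto
    have "mk v k \<longleftrightarrow> k = i \<or> k = j" using ij k by force
    moreover have "c k = c i \<longleftrightarrow> k = i" "c k = c j \<longleftrightarrow> k = j"
      using c_window[of k i] c_window[of k j] k assms(4) N4 by auto
    ultimately show "adj G v w \<longleftrightarrow> w = hd (seg i j) \<or> w = last (seg i j)"
      using ij(1) k by (simp add: hd_seg last_seg mk_def)
  qed
  moreover have "int (length (v # seg i j)) = j - i + 2" using ij(1) by (simp add: length_seg)
  ultimately have "odd (j - i + 2)" using odd_hole[of "v # seg i j" "j - i + 2"] assms(3,4) by simp
  then show ?thesis by simp
qed

text \<open>The link, \<open>x\<close> and \<open>y\<close> form a hole of length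
  \<open>n - m + 3\<close>, closed by the edge between \<open>x\<close> and
  \<open>y\<close>.\<close>

lemma link_even:
  assumes x: "off x" and y: "off y" and a: "adj G x y" and k: "link x y m n"
    and len: "L \<le> n - m + 3" "n - m + 3 < N"
  shows "even (n - m)"
proof -
  obtain p where p: "lnk G x y p" "int (length p) = n - m + 1"
    using lnk_of_link[OF k] len x y unfolding off_def by auto
  have "hole G (x # p @ [y])"
    using x y a p l4 len by (intro hole_lnk1[OF G]) (auto simp: off_def)
  then have "odd (n - m + 3)" using odd_hole[of "x # p @ [y]" "n - m + 3"] p(2) len by simp
  then show ?thesis by simp
qed

text \<open>Two anticomplete links close up through \<open>x\<close> and \<open>y\<close> to a hole
  of length \<open>n - m + (n' - m') + 4\<close>. The last part of \<open>sep\<close> says that this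
  is less than \<open>N\<close>.\<close>

lemma links_odd:
  assumes x: "off x" and y: "off y" and a: "\<not> adj G x y" "x \<noteq> y" and k: "link x y m n" "link x y m' n'"
    and sep: "n + 2 \<le> m'" "n' + 2 \<le> m + N" "4 < m' - n + (m + N - n')"
    and len: "L \<le> n - m + (n' - m') + 4"
  shows "odd (n - m + (n' - m'))"
proof -
  have mn: "m \<le> n" "m' \<le> n'" using k by (auto simp: link_def)
  obtain p where p: "lnk G x y p" "set p = set (seg m n)" "int (length p) = n - m + 1"
    using lnk_of_link[OF k(1)] mn sep x y unfolding off_def by auto
  obtain q where q: "lnk G x y q" "set q = set (seg m' n')" "int (length q) = n' - m' + 1"
    using lnk_of_link[OF k(2)] mn sep x y unfolding off_def by auto
  have "hole G (x # p @ y # rev q)"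
    using x y a p q seg_disjoint[of n m' n' m] seg_anticomplete[of n m' n' m] sep
    by (intro hole_lnk2[OF G]) (auto simp: off_def)
  then have "odd (n - m + (n' - m') + 4)"
    using odd_hole[of "x # p @ y # rev q" "n - m + (n' - m') + 4"] p(3) q(3) len sep by simp
  then show ?thesis by simp
qed

text \<open>The path through \<open>v\<close> and the two arcs of \<open>C\<close> between the marks
  would form a long theta with ends \<open>c i\<close> and \<open>c j\<close>.\<close>

lemma not_two_marks:
  assumes v: "off v" and ij: "i + 2 \<le> j" "j + 2 \<le> i + N" "L \<le> j - i + 2" "L \<le> i + N - j + 2"
    and m: "\<And>k. i \<le> k \<Longrightarrow> k < i + N \<Longrightarrow> mk v k \<longleftrightarrow> k = i \<or> k = j"
  shows False
proof -
  have nv: "c k \<noteq> v" for k using v c_in unfolding off_def by metis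
  have vk: "adj G (c k) v \<longleftrightarrow> mk v k" for k using adj_commute[OF G] unfolding mk_def by metis
  have n: "\<not> mk v k" if "i < k" "k < i + N" "k \<noteq> j" for k using m[of k] that by simp
  have mij: "mk v i" "mk v j" using m[of i] m[of j] ij by auto
  have ci: "c i = c (i + N)" by simp
  have "lnk G (c i) (c j) [v]"
    unfolding lnk_def using nv vk mij v by (simp add: off_def)
  moreover have "lnk G (c i) (c j) (seg (i + 1) (j - 1))"
    unfolding lnk_def
  proof (intro conjI ballI)
    show "seg (i + 1) (j - 1) \<noteq> []" "ipath G (seg (i + 1) (j - 1))"
      using ij by (simp_all add: seg_ne ipath_seg)
    show "c i \<notin> set (seg (i + 1) (j - 1))" "c j \<notin> set (seg (i + 1) (j - 1))"
      unfolding set_seg using c_window ij by fastforce+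
    fix w assume "w \<in> set (seg (i + 1) (j - 1))"
    then obtain k where k: "i < k" "k < j" "w = c k" unfolding set_seg by force
    have "adj G (c i) (c k) \<longleftrightarrow> k = i + 1" "adj G (c j) (c k) \<longleftrightarrow> k = j - 1"
      using adj_c[of i k] adj_c[of j k] k ij by auto
    moreover have "c k = c (i + 1) \<longleftrightarrow> k = i + 1" "c k = c (j - 1) \<longleftrightarrow> k = j - 1"
      using c_window[of k "i + 1"] c_window[of k "j - 1"] k ij by auto
    ultimately show "adj G (c i) w \<longleftrightarrow> w = hd (seg (i + 1) (j - 1))"
      "adj G (c j) w \<longleftrightarrow> w = last (seg (i + 1) (j - 1))"
      using k ij by (simp_all add: hd_seg last_seg)
  qed
  moreover have "lnk G (c i) (c j) (rev (seg (j + 1) (i + N - 1)))"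
  proof (rule lnk_rev[OF G], unfold lnk_def, intro conjI ballI)
    show "seg (j + 1) (i + N - 1) \<noteq> []" "ipath G (seg (j + 1) (i + N - 1))"
      using ij by (simp_all add: seg_ne ipath_seg)
    show "c i \<notin> set (seg (j + 1) (i + N - 1))" "c j \<notin> set (seg (j + 1) (i + N - 1))"
      unfolding set_seg using c_window ij by fastforce+
    fix w assume "w \<in> set (seg (j + 1) (i + N - 1))"
    then obtain k where k: "j < k" "k < i + N" "w = c k" unfolding set_seg by force
    have "adj G (c (i + N)) (c k) \<longleftrightarrow> k = i + N - 1" "adj G (c j) (c k) \<longleftrightarrow> k = j + 1"
      using adj_c[of "i + N" k] adj_c[of j k] k ij by auto
    moreover have "c k = c (j + 1) \<longleftrightarrow> k = j + 1" "c k = c (i + N - 1) \<longleftrightarrow> k = i + N - 1"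
      using c_window[of k "j + 1"] c_window[of k "i + N - 1"] k ij by auto
    ultimately show "adj G (c j) w \<longleftrightarrow> w = hd (seg (j + 1) (i + N - 1))"
      "adj G (c i) w \<longleftrightarrow> w = last (seg (j + 1) (i + N - 1))"
      using k ij unfolding ci by (simp_all add: hd_seg last_seg)
  qed
  moreover have "\<not> adj G (c i) (c j)" "c i \<noteq> c j" using adj_c[of i j] c_window[of i j] ij by auto
  moreover have "set [v] \<inter> set (seg m n) = {}" for m n using nv by (auto simp: set_seg)
  moreover have "set (seg (i + 1) (j - 1)) \<inter> set (rev (seg (j + 1) (i + N - 1))) = {}"
    using seg_disjoint[of "j - 1" "j + 1" "i + N - 1" "i + 1"] by simp
  moreover have "anticomplete G (set [v]) (set (seg (i + 1) (j - 1)))"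
    "anticomplete G (set [v]) (set (rev (seg (j + 1) (i + N - 1))))"
    unfolding anticomplete_def set_seg using n ij by (auto simp: mk_def set_seg)
  moreover have "anticomplete G (set (seg (i + 1) (j - 1))) (set (rev (seg (j + 1) (i + N - 1))))"
    using seg_anticomplete[of "j - 1" "j + 1" "i + N - 1" "i + 1"] by simp
  ultimately have "contains_induced G (long_theta l)"
    using c_verts ij N_large by (intro long_theta_lnk[OF G c_verts c_verts,
      of i j "[v]" "seg (i + 1) (j - 1)" "rev (seg (j + 1) (i + N - 1))"]) (auto simp: length_seg)
  then show False using no_theta by blast
qed

text \<open>The two arcs of \<open>C\<close> between the marked edges and the one-vertex path
  \<open>[v]\<close> would form a long near-prism whose triangles share \<open>v\<close>.\<close>

lemma not_two_edges:
  assumes v: "off v" and ij: "L \<le> j - (i + 1)" "L \<le> i + N - (j + 1)"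
    and m: "\<And>k. i \<le> k \<Longrightarrow> k < i + N \<Longrightarrow> mk v k \<longleftrightarrow> k = i \<or> k = i + 1 \<or> k = j \<or> k = j + 1"
  shows False
proof -
  have nv: "c k \<noteq> v" for k using v c_in unfolding off_def by metis
  have mN: "mk v (i + N)" using m[of i] N4 by simp
  let ?p = "seg (i + 1) j" and ?q = "rev (seg (j + 1) (i + N))"
  have hl: "hd ?p = c (i + 1)" "last ?p = c j" "hd ?q = c (i + N)" "last ?q = c (j + 1)"
    using ij l4 by (simp_all add: hd_seg last_seg hd_rev last_rev seg_ne)
  have "contains_induced G (long_near_prism l)"
  proof (rule long_near_prismI[OF G, of "[v]" ?p ?q])
    show "ipath G [v]" "[v] \<noteq> []" using v by (simp_all add: off_def)
    show "?p \<noteq> []" "?q \<noteq> []" using ij l4 by (simp_all add: seg_ne)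
    show "ipath G ?p" "ipath G ?q" using ij l4 by (simp_all add: ipath_seg ipath_rev[OF G])
    show "set [v] \<inter> set ?p = {}" "set [v] \<inter> set ?q = {}" using nv by (auto simp: set_seg)
    show "set ?p \<inter> set ?q = {}" using seg_disjoint[of j "j + 1" "i + N" "i + 1"] by simp
    show "0 < l" "l < length ?p" "l < length ?q" using l4 ij by (simp_all add: length_seg)
    show "adj G u w \<longleftrightarrow> u = hd [v] \<and> w = hd ?p \<or> u = last [v] \<and> w = last ?p"
      if uw: "u \<in> set [v]" "w \<in> set ?p" for u w
    proof -
      obtain k where k: "i + 1 \<le> k" "k \<le> j" "w = c k" using uw(2) unfolding set_seg by auto
      have "mk v k \<longleftrightarrow> k = i + 1 \<or> k = j" using m[of k] k ij l4 by auto
      moreover have "c k = c (i + 1) \<longleftrightarrow> k = i + 1" "c k = c j \<longleftrightarrow> k = j"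
        using c_window[of k "i + 1"] c_window[of k j] k ij l4 by auto
      ultimately show ?thesis using uw(1) k unfolding hl by (simp add: mk_def)
    qed
    show "adj G u w \<longleftrightarrow> u = hd [v] \<and> w = hd ?q \<or> u = last [v] \<and> w = last ?q"
      if uw: "u \<in> set [v]" "w \<in> set ?q" for u w
    proof -
      obtain k where k: "j + 1 \<le> k" "k \<le> i + N" "w = c k" using uw(2) unfolding set_rev set_seg by auto
      have "mk v k \<longleftrightarrow> k = j + 1 \<or> k = i + N" using m[of k] mN k ij l4 by (cases "k = i + N") auto
      moreover have "c k = c (i + N) \<longleftrightarrow> k = i + N" "c k = c (j + 1) \<longleftrightarrow> k = j + 1"
        using c_window[of k "i + N"] c_window[of k "j + 1"] k ij l4 by (auto simp del: c_add)
      ultimately show ?thesis using uw(1) k unfolding hl by (auto simp add: mk_def simp del: c_add)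
    qed
    show "adj G u w \<longleftrightarrow> u = hd ?p \<and> w = hd ?q \<or> u = last ?p \<and> w = last ?q"
      if uw: "u \<in> set ?p" "w \<in> set ?q" for u w
    proof -
      obtain k where k: "i + 1 \<le> k" "k \<le> j" "u = c k" using uw(1) unfolding set_seg by auto
      obtain k' where k': "j + 1 \<le> k'" "k' \<le> i + N" "w = c k'" using uw(2) unfolding set_rev set_seg by auto
      have "adj G (c k) (c k') \<longleftrightarrow> k = j \<and> k' = j + 1 \<or> k = i + 1 \<and> k' = i + N"
        using adj_c[of k k'] k k' by auto
      moreover have "c k = c (i + 1) \<longleftrightarrow> k = i + 1" "c k = c j \<longleftrightarrow> k = j"
        using c_window[of k "i + 1"] c_window[of k j] k ij l4 by auto
      moreover have "c k' = c (i + N) \<longleftrightarrow> k' = i + N" "c k' = c (j + 1) \<longleftrightarrow> k' = j + 1"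
        using c_window[of k' "i + N"] c_window[of k' "j + 1"] k' ij l4 by (auto simp del: c_add)
      ultimately show ?thesis using k k' unfolding hl by (auto simp del: c_add)
    qed
  qed
  then show False using no_near_prism by blast
qed

end

section \<open>Pairs of nonadjacent major vertices\<close>

context shortest_hole begin

text \<open>The distance kept between a mark of a second vertex and the end of a gap. A link of
  length \<open>l - 3\<close> makes the hole in \<open>link_even\<close> long. For
  \<open>l = 4\<close> this would be only 1, whereas anticomplete links must be 2 apart.\<close>

definition rho :: int where "rho = max 2 (L - 3)"

lemma rho: "2 \<le> rho" "L - 3 \<le> rho" "l = 4 \<Longrightarrow> rho = 2" "5 \<le> l \<Longrightarrow> rho = L - 3"
  using l4 unfolding rho_def by auto

lemma link_add: "link x y m n \<Longrightarrow> link x y (m + N) (n + N)"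
proof -
  assume k: "link x y m n"
  have s: "mk v k \<longleftrightarrow> mk v (k - N)" for v k by simp
  have t: "m \<le> k - N \<and> k - N \<le> n \<and> (k - N = m \<longleftrightarrow> k = m + N) \<and> (k - N = n \<longleftrightarrow> k = n + N)"
    if "m + N \<le> k \<and> k \<le> n + N" for k using that by auto
  show ?thesis
    unfolding link_def
  proof (intro conjI)
    show "m + N \<le> n + N" using k by (simp add: link_def)
    from k consider "\<forall>k. m \<le> k \<and> k \<le> n \<longrightarrow> (mk x k \<longleftrightarrow> k = m) \<and> (mk y k \<longleftrightarrow> k = n)"
      | "\<forall>k. m \<le> k \<and> k \<le> n \<longrightarrow> (mk y k \<longleftrightarrow> k = m) \<and> (mk x k \<longleftrightarrow> k = n)"
      unfolding link_def by blast
    then show "(\<forall>k. m + N \<le> k \<and> k \<le> n + N \<longrightarrow> (mk x k \<longleftrightarrow> k = m + N) \<and> (mk y k \<longleftrightarrow> k = n + N)) \<or>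
      (\<forall>k. m + N \<le> k \<and> k \<le> n + N \<longrightarrow> (mk y k \<longleftrightarrow> k = m + N) \<and> (mk x k \<longleftrightarrow> k = n + N))"
    proof cases
      case 1 then show ?thesis using s t by (intro disjI1) metis
    next
      case 2 then show ?thesis using s t by (intro disjI2) metis
    qed
  qed
qed

lemma linkI1: "m \<le> n \<Longrightarrow> mk x m \<Longrightarrow> mk y n \<Longrightarrow> (\<And>k. m < k \<Longrightarrow> k \<le> n \<Longrightarrow> \<not> mk x k) \<Longrightarrow>
    (\<And>k. m \<le> k \<Longrightarrow> k < n \<Longrightarrow> \<not> mk y k) \<Longrightarrow> link x y m n"
  unfolding link_def by (smt (verit))

lemma linkI2: "m \<le> n \<Longrightarrow> mk y m \<Longrightarrow> mk x n \<Longrightarrow> (\<And>k. m < k \<Longrightarrow> k \<le> n \<Longrightarrow> \<not> mk y k) \<Longrightarrow>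
    (\<And>k. m \<le> k \<Longrightarrow> k < n \<Longrightarrow> \<not> mk x k) \<Longrightarrow> link x y m n"
  unfolding link_def by (smt (verit))

text \<open>Otherwise the arc outside the gap has at most four vertices and contains all neighbours
  of \<open>x\<close> on \<open>C\<close>.\<close>

lemma major_gap:
  assumes x: "major G C x" and g: "gap x i j"
  shows "j - i \<le> N - 4"
proof -
  obtain i0 where i0: "mk x i0" "\<forall>i'. j \<le> i' \<and> i' \<le> j + 3 \<longrightarrow> c i' \<noteq> c i0"
    using major_spread[OF x, of j] by blast
  obtain i1 where i1: "j \<le> i1" "i1 < j + N" "c i1 = c i0" using shift_into[of j i0] by blast
  have "mk x i1" using i0(1) i1(3) by (simp add: mk_def)
  moreover have "\<not> i1 \<le> j + 3" using i0(2) i1 by blast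
  moreover have "mk x (i + N)" using g by (simp add: gap_def)
  moreover have "\<not> mk x k" if "i + N < k" "k < j + N" for k
    using gap_add(1)[OF g] that unfolding gap_def by blast
  ultimately show ?thesis using i1(2) by force
qed

text \<open>Let \<open>c1\<close> and \<open>c2\<close> be the extreme marks of \<open>y\<close>.
  Three holes are odd: \<open>x\<close> with its gap, \<open>y\<close> with the arc of
  \<open>C\<close> from \<open>c2\<close> around to \<open>c1\<close>, and \<open>x\<close>,
  \<open>y\<close> with the two links at the ends of the gap. As \<open>N\<close> is even,
  \<open>c2 - c1\<close> and \<open>c1 - i + (j - c2)\<close> are both odd, yet they add up to the
  odd number \<open>j - i\<close>.\<close>

lemma no_major_inside_gap:
  assumes x: "major G C x" and y: "major G C y" and na: "\<not> adj G x y" "x \<noteq> y" and gx: "gap x i j"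
    and inside: "\<And>k. i < k \<Longrightarrow> k \<le> i + N \<Longrightarrow> mk y k \<Longrightarrow> i + rho \<le> k \<and> k \<le> j - rho"
  shows False
proof -
  note ox = major_off[OF x] and oy = major_off[OF y]
  have xi: "mk x i" and xj: "mk x j" and xn: "\<And>k. i < k \<Longrightarrow> k < j \<Longrightarrow> \<not> mk x k" and ij: "i < j"
    using gx unfolding gap_def by blast+
  obtain k0 where k0: "i < k0" "k0 \<le> i + N" "mk y k0"
  proof -
    obtain k where "mk y k" using major_spread[OF y] by blast
    moreover obtain k' where "i + 1 \<le> k'" "k' < i + 1 + N" "c k' = c k" using shift_into by blast
    ultimately show ?thesis using that[of k'] by (simp add: mk_def)
  qed
  obtain c1 where c1: "i + 1 \<le> c1" "c1 \<le> k0" "mk y c1" "\<And>k. i + 1 \<le> k \<Longrightarrow> k < c1 \<Longrightarrow> \<not> mk y k"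
    using next_mark[OF k0(3), of "i + 1"] k0(1) by auto
  obtain c2 where c2: "k0 \<le> c2" "c2 \<le> i + N" "mk y c2" "\<And>k. c2 < k \<Longrightarrow> k \<le> i + N \<Longrightarrow> \<not> mk y k"
    using prev_mark[OF k0(3,2)] by blast
  have ar: "i + rho \<le> c1" "c2 \<le> j - rho" "c1 \<le> c2" "j - i \<le> N - 4"
    using inside[of c1] inside[of c2] c1 c2 k0 major_gap[OF x gx] by auto
  note ar = ar rho(1,2) l4
  have d: "odd (j - i)" using gap_odd[OF ox gx] ar by linarith
  have lk1: "link x y i c1"
  proof (intro linkI1)
    show "\<not> mk y k" if "i \<le> k" "k < c1" for k
    proof (cases "k = i")
      case True
      \<comment> \<open>The hypothesis \<open>inside\<close> starts after \<open>i\<close>, so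
        \<open>i\<close> is tested at its other representative \<open>i + N\<close>.\<close>
      have "mk y (i + N) = mk y i" by simp
      then show ?thesis using inside[of "i + N"] True ar by force
    qed (use c1(4)[of k] that in auto)
  qed (use c1 ar xi xn in auto)
  have lk2: "link x y c2 j"
    using c2 ar xj xn by (intro linkI2) auto
  have g: "gap y c2 (c1 + N)"
    unfolding gap_def
  proof (intro conjI allI impI)
    fix k assume k: "c2 < k \<and> k < c1 + N"
    show "\<not> mk y k"
    proof (cases "k \<le> i + N")
      case True then show ?thesis using c2(4)[of k] k by auto
    next
      case F: False
      have "\<not> mk y (k - N)" using c1(4)[of "k - N"] k F by linarith
      then show ?thesis by simp
    qed
  qed (use c1 c2 ar in auto)
  have "odd (c1 + N - c2)" using gap_odd[OF oy g] major_gap[OF y g] ar by linarith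
  then have "odd (c2 - c1)" using N_even by presburger
  moreover have "odd (c1 - i + (j - c2))"
    using links_odd[OF ox oy na lk1 lk2] major_gap[OF y g] ar by linarith
  ultimately show ?thesis using d by presburger
qed

text \<open>Let \<open>c1\<close> and \<open>c2\<close> be the extreme marks of \<open>y\<close>
  inside the gap, and \<open>e\<close>, \<open>f\<close> the nearest marks of \<open>y\<close>
  outside. Parity of the holes through \<open>x\<close> and \<open>y\<close> excludes everything
  except \<open>c2 = c1 + 1\<close>. Then \<open>y\<close> has two gaps that are separated by one
  edge and together extend beyond the gap of \<open>x\<close> on both sides. The parities of
  \<open>i - m\<close> and \<open>n - j\<close> are what later carries the argument across the inner
  edge of a pseudo-gap.\<close>

lemma nonadjacent_major:
  assumes x: "major G C x" and y: "major G C y" and na: "\<not> adj G x y" "x \<noteq> y"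
    and gx: "gap x i j" and compl: "L + 2 \<le> N - (j - i)"
    and ni: "\<And>k. i - 1 \<le> k \<Longrightarrow> k < i + rho \<Longrightarrow> \<not> mk y k"
    and nj: "\<And>k. j - rho < k \<Longrightarrow> k \<le> j + 1 \<Longrightarrow> \<not> mk y k"
    and k0: "i < k0" "k0 < j" "mk y k0"
  obtains e f g m n where "5 \<le> l" "e < i - 1" "j + 1 < f" "f \<le> e + N" "gap y e g" "gap y (g + 1) f"
    "i + rho \<le> g" "g + 1 \<le> j - rho"
    "e \<le> m" "m \<le> i" "mk x m" "\<And>k. e \<le> k \<Longrightarrow> k < m \<Longrightarrow> \<not> mk x k" "even (i - m)"
    "j \<le> n" "n \<le> f" "mk x n" "\<And>k. n < k \<Longrightarrow> k \<le> f \<Longrightarrow> \<not> mk x k" "even (n - j)"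
proof -
  note ox = major_off[OF x] and oy = major_off[OF y]
  have xi: "mk x i" and xj: "mk x j" and xn: "\<And>k. i < k \<Longrightarrow> k < j \<Longrightarrow> \<not> mk x k" and ij: "i < j"
    using gx unfolding gap_def by blast+
  obtain c1 where c1: "i \<le> c1" "c1 \<le> k0" "mk y c1" "\<And>k. i \<le> k \<Longrightarrow> k < c1 \<Longrightarrow> \<not> mk y k"
    using next_mark[OF k0(3), of i] k0(1) by auto
  obtain c2 where c2: "k0 \<le> c2" "c2 \<le> j" "mk y c2" "\<And>k. c2 < k \<Longrightarrow> k \<le> j \<Longrightarrow> \<not> mk y k"
    using prev_mark[OF k0(3), of j] k0(2) by auto
  have c1i: "i + rho \<le> c1" using ni[of c1] c1 by linarith
  have c2j: "c2 \<le> j - rho" using nj[of c2] c2 by linarith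
  have c12: "c1 \<le> c2" using c1 c2 by linarith
  note ar = c1i c2j c12 rho(1,2) compl l4
  have d: "odd (j - i)" using gap_odd[OF ox gx] ar by linarith
  have lk1: "link x y i c1"
    using c1 ar xi xn by (intro linkI1) auto
  have lk2: "link x y c2 j"
    using c2 ar xj xn by (intro linkI2) auto
  show ?thesis
  proof (cases "\<exists>k. j < k \<and> k < i + N \<and> mk y k")
    case False
    have "i + rho \<le> k \<and> k \<le> j - rho" if k: "i < k" "k \<le> i + N" "mk y k" for k
    proof -
      have "k \<noteq> i + N" using ni[of i] k(3) rho(1) by auto
      then have "k \<le> j" using False k by force
      then show ?thesis using ni[of k] nj[of k] k by linarith
    qed
    then show ?thesis using no_major_inside_gap[OF x y na gx] by blast
  next
    case True
    then obtain k1 where k1: "j < k1" "k1 < i + N" "mk y k1" by blast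
    obtain f where f: "j \<le> f" "f \<le> k1" "mk y f" "\<And>k. j \<le> k \<Longrightarrow> k < f \<Longrightarrow> \<not> mk y k"
      using next_mark[OF k1(3), of j] k1(1) by auto
    obtain e' where e': "k1 \<le> e'" "e' \<le> i + N" "mk y e'" "\<And>k. e' < k \<Longrightarrow> k \<le> i + N \<Longrightarrow> \<not> mk y k"
      using prev_mark[OF k1(3), of "i + N"] k1(2) by auto
    define e where "e = e' - N"
    have ye: "mk y e" using e'(3) by (simp add: e_def)
    have yne: "\<not> mk y k" if "e < k" "k \<le> i" for k
      using e'(4)[of "k + N"] that by (simp add: e_def)
    have fj: "j + 2 \<le> f" using nj[of f] f ar by force
    have ei: "e \<le> i - 2" using ni[of e] ye e'(2) ar unfolding e_def by force
    have fe: "f \<le> e + N" using f e' by (simp add: e_def)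
    have g1: "gap y e c1" unfolding gap_def
    proof (intro conjI allI impI)
      fix k assume "e < k \<and> k < c1" then show "\<not> mk y k" using yne[of k] c1(4)[of k] by linarith
    qed (use ye c1 ei ar in auto)
    have g2: "gap y c2 f" unfolding gap_def
    proof (intro conjI allI impI)
      fix k assume "c2 < k \<and> k < f" then show "\<not> mk y k" using c2(4)[of k] f(4)[of k] by linarith
    qed (use f c2 fj ar in auto)
    note ar = ar fj ei fe
    have o1: "odd (c1 - e)" using gap_odd[OF oy g1] ar by linarith
    have o2: "odd (f - c2)" using gap_odd[OF oy g2] ar by linarith
    obtain m where m: "e \<le> m" "m \<le> i" "mk x m" "\<And>k. e \<le> k \<Longrightarrow> k < m \<Longrightarrow> \<not> mk x k"
      using next_mark[OF xi, of e] ei by auto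
    obtain n where n: "j \<le> n" "n \<le> f" "mk x n" "\<And>k. n < k \<Longrightarrow> k \<le> f \<Longrightarrow> \<not> mk x k"
      using prev_mark[OF xj, of f] fj by auto
    have lk3: "link x y e m"
      using m ye yne by (intro linkI2) auto
    have lk4: "link x y n f"
      using n f by (intro linkI1) auto
    have ym: "mk y k \<longleftrightarrow> k = c1 \<or> k = c2 \<or> k = f \<or> k = e + N"
      if "c1 \<le> k" "k < c1 + N" "f = e + N \<or> f + 1 = e + N" "c1 = c2 \<or> c1 + 1 = c2" for k
    proof -
      have "\<not> mk y k" if "e + N < k" "k < c1 + N" for k
        using g1 that gap_add(1)[OF g1] unfolding gap_def by blast
      moreover have "mk y (e + N)" using ye by simp
      ultimately show ?thesis using g2 c1(3) that unfolding gap_def by (smt (verit))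
    qed
    \<comment> \<open>With one mark inside the gap and one outside, \<open>y\<close> would have
      exactly two marks.\<close>
    have strict: "c1 \<noteq> c2 \<or> f \<noteq> e + N"
    proof (rule ccontr)
      assume "\<not> ?thesis"
      then have eq: "c1 = c2" "f = e + N" by auto
      show False
        using not_two_marks[OF oy, of c1 f] ym eq ar by force
    qed
    \<comment> \<open>The outer link on one side and the inner link on the other are always
      anticomplete; \<open>strict\<close> supplies the unit that makes their hole shorter than
      \<open>C\<close>.\<close>
    have S1: "odd (m - e + (j - c2))"
      using links_odd[OF ox oy na lk3 lk2] m ar strict by linarith
    have S2: "odd (c1 - i + (f - n))"
      using links_odd[OF ox oy na lk1 lk4] n ar strict by linarith
    show ?thesis
    proof (cases "c2 = c1 + 1")
      case False
      \<comment> \<open>For \<open>c1 = c2\<close> this is the parity of the gap of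
        \<open>x\<close>; otherwise the two inner links are anticomplete and close up to a
        hole.\<close>
      have dd: "odd (c1 - i + (j - c2))"
      proof (cases "c1 = c2")
        case True then show ?thesis using d by presburger
      next
        case F: False
        then show ?thesis using links_odd[OF ox oy na lk1 lk2] False ar by linarith
      qed
      \<comment> \<open>Parity makes \<open>i - m\<close> odd. If it were larger than 1, the links
        ending in \<open>m\<close> and starting in \<open>i\<close> would be anticomplete, and the
        oddness of their hole contradicts \<open>dd\<close> and \<open>S1\<close>: the three odd
        quantities have an even sum.\<close>
      have mi: "m = i - 1"
      proof (rule ccontr)
        assume "m \<noteq> i - 1"
        moreover have "odd (i - m)" using dd S1 o1 by presburger
        moreover have "m \<noteq> i" using \<open>odd (i - m)\<close> by auto
        ultimately have "m + 2 \<le> i" using m by linarith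
        then have "odd (m - e + (c1 - i))" using links_odd[OF ox oy na lk3 lk1] m ar by linarith
        then show False using dd S1 by presburger
      qed
      have nj1: "n = j + 1"
      proof (rule ccontr)
        assume "n \<noteq> j + 1"
        moreover have "odd (n - j)" using dd S2 o2 by presburger
        moreover have "n \<noteq> j" using \<open>odd (n - j)\<close> by auto
        ultimately have "j + 2 \<le> n" using n by linarith
        then have "odd (j - c2 + (f - n))" using links_odd[OF ox oy na lk2 lk4] n ar by linarith
        then show False using dd S2 by presburger
      qed
      have False
      \<comment> \<open>A further mark of \<open>x\<close> beyond \<open>f\<close> gives a link from
        \<open>s\<close> to \<open>e1\<close> that closes up with each of the two inner links, so
        \<open>c1 - i\<close> and \<open>j - c2\<close> have equal parity, against
        \<open>dd\<close>. Without such a mark the neighbours of \<open>x\<close> are the ends of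
        exactly two edges of \<open>C\<close>.\<close>
      proof (cases "\<exists>s. f < s \<and> s < e + N \<and> mk x s")
        case True
        then obtain s0 where s0: "f < s0" "s0 < e + N" "mk x s0" by blast
        obtain s where s: "s0 \<le> s" "s \<le> e + N" "mk x s" "\<And>k. s < k \<Longrightarrow> k \<le> e + N \<Longrightarrow> \<not> mk x k"
          using prev_mark[OF s0(3), of "e + N"] s0(2) by auto
        have yeN: "mk y (e + N)" using ye by simp
        obtain e1 where e1: "s \<le> e1" "e1 \<le> e + N" "mk y e1" "\<And>k. s \<le> k \<Longrightarrow> k < e1 \<Longrightarrow> \<not> mk y k"
          using next_mark[OF yeN s(2)] by blast
        have lk5: "link x y s e1" using s e1 by (intro linkI1) auto
        have "odd (c1 - i + (e1 - s))" using links_odd[OF ox oy na lk1 lk5] s0 s e1 ar by linarith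
        moreover have "odd (j - c2 + (e1 - s))" using links_odd[OF ox oy na lk2 lk5] s0 s e1 ar by linarith
        ultimately show False using dd by presburger
      next
        case F: False
        have xm: "mk x k \<longleftrightarrow> k = i - 1 \<or> k = i - 1 + 1 \<or> k = j \<or> k = j + 1"
          if "i - 1 \<le> k" "k < i - 1 + N" for k
        proof -
          have "\<not> mk x k" if "e + N \<le> k" "k < i - 1 + N" for k
            using m(4)[of "k - N"] mi that by simp
          then have "\<not> mk x k" if "f < k" "k < i - 1 + N" for k using F that by (meson not_le)
          then have "\<not> mk x k" if "j + 1 < k" "k < i - 1 + N" for k
            using n(4)[of k] nj1 that by (meson not_le)
          then show ?thesis using xn xi xj m(3) n(3) mi nj1 that by (smt (verit))
        qed
        \<comment> \<open>For \<open>l = 5\<close> the margins only give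
          \<open>4 \<le> j - i\<close>; oddness of the gap supplies the missing unit.\<close>
        have "L \<le> j - (i - 1 + 1)"
        proof -
          have "4 \<le> j - i" "2 * L - 6 \<le> j - i" using ar by linarith+
          then show ?thesis using d by presburger
        qed
        then show False using not_two_edges[OF ox, of j "i - 1"] xm ar by force
      qed
      then show ?thesis ..
    next
      case True
      have em: "even (i - m)" using o1 S1 d True by presburger
      have en: "even (n - j)" using o2 S2 d True by presburger
      \<comment> \<open>For \<open>l = 4\<close> every hole is long, so the two outer links can be
        combined as well, and the margin 2 already puts two marked edges far enough apart for
        \<open>not_two_edges\<close>.\<close>
      have "5 \<le> l"
      proof (rule ccontr)
        assume "\<not> 5 \<le> l"
        then have l: "l = 4" using l4 by simp
        consider "f = e + N" | "f + 1 = e + N" | "f + 2 \<le> e + N" using fe by linarith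
        then show False
        proof cases
          case 1
          then show False using o1 o2 True N_even by presburger
        next
          case 2
          show False
            using not_two_edges[OF oy, of f c1] ym 2 True ar l by force
        next
          case 3
          have "odd (f - n + (m + N - (e + N)))"
            using links_odd[OF ox oy na lk4 link_add[OF lk3]] 3 m n ar l by linarith
          then show False using S1 S2 d True by presburger
        qed
      qed
      then show ?thesis
        using that[of e f c1 m n] g1 g2 m n em en ar True by auto
    qed
  qed
qed

end

section \<open>Paths leaving a gap\<close>

text \<open>The start vertices need not satisfy \<open>A\<close>: in the application they are ends
  of an arc, next to guessed vertices and hence not allowed themselves.\<close>

inductive_set reach :: "'a sgraph \<Rightarrow> ('a \<Rightarrow> bool) \<Rightarrow> 'a set \<Rightarrow> 'a set" for G A Q where
  base: "q \<in> Q \<Longrightarrow> q \<in> reach G A Q"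
| step: "u \<in> reach G A Q \<Longrightarrow> adj G u v \<Longrightarrow> A v \<Longrightarrow> v \<in> reach G A Q"

lemma ipath_successively: "ipath G p \<Longrightarrow> successively (adj G) p"
  by (induction p) (auto simp: successively_Cons dest: hd_in_set)

context shortest_hole begin

text \<open>All neighbours of \<open>v\<close> on \<open>C\<close> are among four consecutive
  vertices, so any two of them differ by a shift of at most three.\<close>

lemma nonmajor_close:
  assumes "off v" "\<not> major G C v" "mk v i" "mk v k"
  obtains d where "\<bar>d\<bar> \<le> 3" "mk v (i + d)" "c (i + d) = c k"
proof -
  obtain w where w: "\<And>i. mk v i \<Longrightarrow> \<exists>i'. w \<le> i' \<and> i' \<le> w + 3 \<and> c i' = c i"
    using nonmajor_window assms(1,2) unfolding off_def by blast
  obtain i1 where i1: "w \<le> i1" "i1 \<le> w + 3" "c i1 = c i" using w[OF assms(3)] by blast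
  obtain k1 where k1: "w \<le> k1" "k1 \<le> w + 3" "c k1 = c k" using w[OF assms(4)] by blast
  have "c (i + (k1 - i1)) = c k1"
  proof -
    have "i mod N = i1 mod N" using i1(3) by (simp add: c_eq)
    then have "(i + (k1 - i1)) mod N = (i1 + (k1 - i1)) mod N" by (rule mod_add_cong) simp
    then show ?thesis unfolding c_eq by simp
  qed
  then show ?thesis using that[of "k1 - i1"] i1 k1 assms(4) by (simp add: mk_def)
qed

lemma c_notin: "k < m \<or> n < k \<Longrightarrow> n - k < N \<Longrightarrow> k - m < N \<Longrightarrow> c k \<notin> c ` {m..n}"
proof
  assume a: "k < m \<or> n < k" "n - k < N" "k - m < N" "c k \<in> c ` {m..n}"
  then obtain k' where k': "m \<le> k'" "k' \<le> n" "c k = c k'" by auto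
  then show False using c_window[of k k'] a(1-3) by linarith
qed

lemma lnk_below:
  assumes x: "off x" and "i < p" "p - i \<le> N - 2" "mk x i" "\<And>k. i < k \<Longrightarrow> k < p \<Longrightarrow> \<not> mk x k"
  shows "lnk G x (c p) (seg i (p - 1))"
  unfolding lnk_def
proof (intro conjI ballI)
  show "seg i (p - 1) \<noteq> []" "ipath G (seg i (p - 1))" using assms by (simp_all add: seg_ne ipath_seg)
  show "x \<notin> set (seg i (p - 1))" using x seg_sub unfolding off_def by blast
  show "c p \<notin> set (seg i (p - 1))" unfolding set_seg using assms(2,3) by (intro c_notin) auto
  fix w assume "w \<in> set (seg i (p - 1))"
  then obtain k where k: "i \<le> k" "k < p" "w = c k" unfolding set_seg by force
  have "mk x k \<longleftrightarrow> k = i" using assms k by force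
  moreover have "adj G (c p) (c k) \<longleftrightarrow> k = p - 1" using adj_c[of p k] k assms(3) by auto
  moreover have "c k = c i \<longleftrightarrow> k = i" "c k = c (p - 1) \<longleftrightarrow> k = p - 1"
    using c_window[of k i] c_window[of k "p - 1"] k assms(2,3) by auto
  ultimately show "adj G x w \<longleftrightarrow> w = hd (seg i (p - 1))" "adj G (c p) w \<longleftrightarrow> w = last (seg i (p - 1))"
    using k by (simp_all add: hd_seg last_seg mk_def)
qed

lemma lnk_above:
  assumes x: "off x" and "p < j" "j - p \<le> N - 2" "mk x j" "\<And>k. p < k \<Longrightarrow> k < j \<Longrightarrow> \<not> mk x k"
  shows "lnk G x (c p) (rev (seg (p + 1) j))"
proof (rule lnk_rev[OF G], unfold lnk_def, intro conjI ballI)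
  show "seg (p + 1) j \<noteq> []" "ipath G (seg (p + 1) j)" using assms by (simp_all add: seg_ne ipath_seg)
  show "x \<notin> set (seg (p + 1) j)" using x seg_sub unfolding off_def by blast
  show "c p \<notin> set (seg (p + 1) j)" unfolding set_seg using assms(2,3) by (intro c_notin) auto
  fix w assume "w \<in> set (seg (p + 1) j)"
  then obtain k where k: "p < k" "k \<le> j" "w = c k" unfolding set_seg by force
  have "mk x k \<longleftrightarrow> k = j" using assms k by force
  moreover have "adj G (c p) (c k) \<longleftrightarrow> k = p + 1" using adj_c[of p k] k assms(3) by auto
  moreover have "c k = c j \<longleftrightarrow> k = j" "c k = c (p + 1) \<longleftrightarrow> k = p + 1"
    using c_window[of k j] c_window[of k "p + 1"] k assms(2,3) by auto
  ultimately show "adj G (c p) w \<longleftrightarrow> w = hd (seg (p + 1) j)" "adj G x w \<longleftrightarrow> w = last (seg (p + 1) j)"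
    using k by (simp_all add: hd_seg last_seg mk_def)
qed

lemma c_image_window:
  assumes "c k \<in> c ` {m..n}" "\<bar>k - m\<bar> < N" "\<bar>k - n\<bar> < N"
  shows "m \<le> k \<and> k \<le> n"
proof -
  obtain k' where k': "m \<le> k'" "k' \<le> n" "c k = c k'" using assms(1) by auto
  then have "\<bar>k - k'\<bar> < N" using assms(2,3) by linarith
  then have "k = k'" using c_window[of k k'] k'(3) by simp
  then show ?thesis using k' by simp
qed

text \<open>Three paths start in \<open>x\<close>: along the gap from \<open>i\<close> to
  \<open>p1\<close>, along the gap from \<open>j\<close> to \<open>p2\<close>, and along
  \<open>C\<close> outside the gap followed by \<open>r\<close> backwards. They meet in
  \<open>hd r\<close>, or in \<open>c p1\<close> if \<open>p1 = p2\<close>, and form a long theta.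
  For \<open>p2 = p1 + 1\<close> a triangle would arise at that end; this case is left to
  \<open>no_prism_path\<close>.\<close>

lemma no_leaving_path:
  assumes x: "off x" and g: "gap x i j"
    and p: "i < p1" "p1 \<le> p2" "p2 < j" "L - 3 \<le> p1 - i" "L - 3 \<le> j - p2" "p2 \<noteq> p1 + 1"
    and r: "ipath G r" "2 \<le> length r" "set r \<inter> set C = {}" "x \<notin> set r" "\<And>w. w \<in> set r \<Longrightarrow> \<not> adj G x w"
    and h: "mk (hd r) p1" "mk (hd r) p2" "\<And>k. mk (hd r) k \<Longrightarrow> c k \<in> c ` {p1..p2}"
    and md: "\<And>w k. w \<in> set r \<Longrightarrow> w \<noteq> hd r \<Longrightarrow> w \<noteq> last r \<Longrightarrow> \<not> mk w k"
    and z: "mk (last r) k1" "\<And>k. mk (last r) k \<Longrightarrow> c k \<in> c ` {j + 2..i + N - 2}"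
    and xo: "mk x k2" "j + 2 \<le> k2" "k2 \<le> i + N - 2"
  shows False
proof -
  obtain v r' where rv: "r = v # r'" "r' \<noteq> []" using r(2) by (cases r; cases "tl r") auto
  have hv: "hd r = v" and lv: "last r = last r'" using rv by simp_all
  have zin: "last r' \<in> set r'" using rv by simp
  have vz: "v \<noteq> last r'" using r(1) zin unfolding rv by auto
  have oz: "off (last r')" and ov: "off v"
    using r(3) ipath_verts[OF r(1)] zin unfolding rv off_def by auto
  have xg: "mk x i" "mk x j" "\<And>k. i < k \<Longrightarrow> k < j \<Longrightarrow> \<not> mk x k" "i < j" using g unfolding gap_def by blast+
  obtain k1' where k1': "j + 2 \<le> k1'" "k1' \<le> i + N - 2" "mk (last r') k1'"
  proof -
    obtain k1' where "j + 2 \<le> k1'" "k1' \<le> i + N - 2" "c k1' = c k1" using z(2)[OF z(1)] by auto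
    then show ?thesis using that z(1) lv by (simp add: mk_def)
  qed
  \<comment> \<open>Both \<open>x\<close> and the last vertex of \<open>r\<close> have neighbours
    beyond the gap. A link between them, possibly a common neighbour, completes the third
    path.\<close>
  obtain m n where mn: "j + 2 \<le> m" "n \<le> i + N - 2" "link (last r') x m n"
    using link_exists[OF k1'(3) xo(1) k1'(1,2) xo(2,3)] by blast
  have mn': "m \<le> n" using mn(3) by (simp add: link_def)
  obtain q where q: "lnk G (last r') x q" "set q = set (seg m n)"
  proof -
    have "n - m \<le> N - 2" using mn xg(4) by linarith
    then show ?thesis using lnk_of_link[OF mn(3)] oz x that unfolding off_def by metis
  qed
  have Q: "q \<noteq> []" "ipath G q" "\<And>w. w \<in> set q \<Longrightarrow> adj G (last r') w \<longleftrightarrow> w = hd q"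
    "\<And>w. w \<in> set q \<Longrightarrow> adj G x w \<longleftrightarrow> w = last q" "x \<notin> set q"
    using q(1) unfolding lnk_def by blast+
  have qC: "set q \<subseteq> set C" using q(2) seg_sub by simp
  have qk: "\<exists>k. m \<le> k \<and> k \<le> n \<and> w = c k" if "w \<in> set q" for w
    using that unfolding q(2) set_seg by auto
  have vno: "\<not> mk v k" if "m \<le> k" "k \<le> n" for k
  proof
    assume "mk v k"
    then have "c k \<in> c ` {p1..p2}" using h(3) hv by simp
    then have "p1 \<le> k \<and> k \<le> p2" by (rule c_image_window) (use that mn p xg in auto)
    then show False using that mn p by linarith
  qed
  have vin: "p1 \<le> k \<and> k \<le> p2" if "i \<le> k" "k \<le> j" "mk v k" for k
  proof -
    have "c k \<in> c ` {p1..p2}" using h(3) hv that(3) by simp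
    then show ?thesis by (rule c_image_window) (use that mn mn' p xg in auto)
  qed
  have zno: "\<not> mk (last r') k" if "i \<le> k" "k \<le> j" for k
  proof
    assume "mk (last r') k"
    then have "c k \<in> c ` {j + 2..i + N - 2}" using z(2) lv by simp
    then have "j + 2 \<le> k \<and> k \<le> i + N - 2" by (rule c_image_window) (use that mn mn' in auto)
    then show False using that by linarith
  qed
  have r'no: "\<not> mk w k" if "w \<in> set r'" "i \<le> k" "k \<le> j" for w k
    using md[of w k] zno[of k] that r(1) hv lv unfolding rv by (cases "w = last r'") auto
  have ipq: "ipath G (r' @ q)"
    unfolding ipath_append
  proof (intro conjI ballI)
    show "ipath G r'" using r(1) by (simp add: rv)
    show "set r' \<inter> set q = {}" using r(3) qC unfolding rv by auto
    fix u w assume uw: "u \<in> set r'" "w \<in> set q"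
    show "adj G u w \<longleftrightarrow> u = last r' \<and> w = hd q"
    proof (cases "u = last r'")
      case True then show ?thesis using Q(3) uw by simp
    next
      case False
      obtain k where "w = c k" using qk[OF uw(2)] by blast
      moreover have "u \<noteq> v" using uw(1) r(1) unfolding rv by auto
      ultimately show ?thesis using md[of u k] uw(1) False hv lv rv by (auto simp: mk_def)
    qed
  qed (rule Q(2))
  have vq: "\<not> adj G v w" if "w \<in> set q" for w using qk[OF that] vno unfolding mk_def by blast
  have r'x: "\<not> adj G x w" if "w \<in> set r" for w using r(5) that by simp
  show False
  proof (cases "p1 = p2")
    case False
    then have p12: "p1 + 2 \<le> p2" using p by linarith
    have nxv: "\<not> adj G x v" "x \<noteq> v" using r(4,5) rv by auto
    have lk: "link x v i p1" "link x v p2 j"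
      using p xg vin h(1,2) hv by (auto intro!: linkI1[of i p1] linkI2[of p2 j]) (smt (verit))+
    obtain a where a: "lnk G x v a" "set a = set (seg i p1)" "int (length a) = p1 - i + 1"
      using lnk_of_link[OF lk(1)] x ov p mn mn' unfolding off_def by auto
    obtain b where b: "lnk G x v b" "set b = set (seg p2 j)" "int (length b) = j - p2 + 1"
      using lnk_of_link[OF lk(2)] x ov p mn mn' unfolding off_def by auto
    have "lnk G v x (r' @ q)"
      unfolding lnk_def
    proof (intro conjI ballI)
      show "r' @ q \<noteq> []" using rv by simp
      show "v \<notin> set (r' @ q)" using r(1,3) qC unfolding rv by auto
      show "x \<notin> set (r' @ q)" using r(4) Q(5) unfolding rv by simp
      fix w assume w: "w \<in> set (r' @ q)"
      have "hd r' \<in> set r'" using rv(2) by simp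
      then have hdin: "hd r' \<notin> set q" using r(3) qC unfolding rv(1) by auto
      show "adj G v w \<longleftrightarrow> w = hd (r' @ q)"
        using w r(1) vq rv hdin by auto
      have "last q \<notin> set r'" using r(3) qC Q(1) rv last_in_set by fastforce
      then show "adj G x w \<longleftrightarrow> w = last (r' @ q)"
        using w r'x Q(1,4) rv by auto
    qed (rule ipq)
    then have c': "lnk G x v (rev (r' @ q))" by (rule lnk_rev[OF G])
    have "contains_induced G (long_theta l)"
    proof (rule long_theta_lnk[OF G _ _ nxv(2,1) a(1) b(1) c'])
      show "x \<in> verts G" "v \<in> verts G" using x ov unfolding off_def by simp_all
      show "set a \<inter> set b = {}" unfolding a b using p12 mn mn' by (intro seg_disjoint) auto
      show "anticomplete G (set a) (set b)" unfolding a b using p12 mn mn' by (intro seg_anticomplete) auto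
      have r'C: "set r' \<inter> set (seg k k') = {}" for k k' using r(3) seg_sub[of k k'] rv by auto
      have 1: "set (seg k k') \<inter> set (rev (r' @ q)) = {}" "anticomplete G (set (seg k k')) (set (rev (r' @ q)))"
        if "i \<le> k" "k' \<le> j" for k k'
      proof -
        have "set (seg k k') \<inter> set (seg m n) = {}" using that mn by (intro seg_disjoint) auto
        then show "set (seg k k') \<inter> set (rev (r' @ q)) = {}" using r'C[of k k'] q(2) by auto
        have "anticomplete G (set (seg k k')) (set (seg m n))" using that mn by (intro seg_anticomplete) auto
        moreover have "\<not> adj G (c t) w" if "k \<le> t" "t \<le> k'" "w \<in> set r'" for t w
          using r'no[of w t] that \<open>i \<le> k\<close> \<open>k' \<le> j\<close> adj_commute[OF G, of "c t" w] by (simp add: mk_def)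
        ultimately show "anticomplete G (set (seg k k')) (set (rev (r' @ q)))"
          unfolding anticomplete_def using q(2) by (auto simp: set_seg)
      qed
      show "set a \<inter> set (rev (r' @ q)) = {}" "anticomplete G (set a) (set (rev (r' @ q)))"
        "set b \<inter> set (rev (r' @ q)) = {}" "anticomplete G (set b) (set (rev (r' @ q)))"
        unfolding a(2) b(2) using 1 p by simp_all
      have len: "2 \<le> length (rev (r' @ q))" using rv(2) Q(1) by (cases r'; cases q) auto
      show "l \<le> length a + length b + 2" "l \<le> length a + length (rev (r' @ q)) + 2"
        "l \<le> length b + length (rev (r' @ q)) + 2"
        using len a(3) b(3) p by linarith+
    qed
    then show False using no_theta by blast
  next
    case True
    let ?a = "seg i (p1 - 1)" and ?b = "rev (seg (p1 + 1) j)"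
    have nxp: "\<not> adj G x (c p1)" "x \<noteq> c p1" using xg(3)[of p1] p True x c_in unfolding mk_def off_def by auto
    have a: "lnk G x (c p1) ?a" using p xg True mn mn' by (intro lnk_below[OF x]) auto
    have b: "lnk G x (c p1) ?b" using p xg True mn mn' by (intro lnk_above[OF x]) auto
    have vm: "mk v k \<longleftrightarrow> k = p1" if "i \<le> k" "k \<le> j" for k
      using vin[OF that] h(1) hv True by force
    have ad: "adj G w (c k) \<longleftrightarrow> w = v \<and> k = p1" if "w \<in> set r" "i \<le> k" "k \<le> j" for w k
      using r'no[of w k] vm[of k] that r(1) unfolding rv mk_def by auto
    have pq: "\<not> adj G (c p1) w" if wq: "w \<in> set q" for w
    proof -
      obtain k where "m \<le> k" "k \<le> n" "w = c k" using qk[OF wq] by blast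
      then show ?thesis using adj_c[of p1 k] mn p True by auto
    qed
    have "lnk G (c p1) x (r @ q)"
      unfolding lnk_def
    proof (intro conjI ballI)
      show "r @ q \<noteq> []" using rv by simp
      show "ipath G (r @ q)" unfolding ipath_append
      proof (intro conjI ballI)
        show "set r \<inter> set q = {}" using r(3) qC by auto
        fix u w assume uw: "u \<in> set r" "w \<in> set q"
        show "adj G u w \<longleftrightarrow> u = last r \<and> w = hd q"
        proof (cases "u = v")
          case True then show ?thesis using vq[OF uw(2)] vz lv by simp
        next
          case False
          then have "u \<in> set r'" using uw(1) rv by simp
          then show ?thesis using ipq uw(2) lv unfolding ipath_append by simp
        qed
      qed (use r(1) Q(2) in auto)
      show "c p1 \<notin> set (r @ q)"
      proof -
        have "c p1 \<notin> set (seg m n)" unfolding set_seg using mn p True N4 by (intro c_notin) auto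
        then show ?thesis using r(3) c_in[of p1] q(2) by auto
      qed
      show "x \<notin> set (r @ q)" using r(4) Q(5) by simp
      fix w assume w: "w \<in> set (r @ q)"
      have "v \<notin> set q" using r(3) qC rv by auto
      then show "adj G (c p1) w \<longleftrightarrow> w = hd (r @ q)"
        using w ad[of w p1] p True pq adj_commute[OF G, of "c p1" w] rv by auto
      have "last q \<notin> set r" using r(3) qC Q(1) last_in_set by fastforce
      then show "adj G x w \<longleftrightarrow> w = last (r @ q)"
        using w r'x Q(1,4) rv by auto
    qed
    then have c': "lnk G x (c p1) (rev (r @ q))" by (rule lnk_rev[OF G])
    have "contains_induced G (long_theta l)"
    proof (rule long_theta_lnk[OF G _ _ nxp(2,1) a b c'])
      show "x \<in> verts G" "c p1 \<in> verts G" using x c_verts unfolding off_def by simp_all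
      show "set ?a \<inter> set ?b = {}" unfolding set_rev using p True mn mn' by (intro seg_disjoint) auto
      show "anticomplete G (set ?a) (set ?b)" unfolding set_rev using p True mn mn' by (intro seg_anticomplete) auto
      have rC: "set r \<inter> set (seg k k') = {}" for k k' using r(3) seg_sub[of k k'] by auto
      have 1: "set (seg k k') \<inter> set (rev (r @ q)) = {}" "anticomplete G (set (seg k k')) (set (rev (r @ q)))"
        if "i \<le> k" "k' \<le> j" "p1 < k \<or> k' < p1" for k k'
      proof -
        have "set (seg k k') \<inter> set (seg m n) = {}" using that mn by (intro seg_disjoint) auto
        then show "set (seg k k') \<inter> set (rev (r @ q)) = {}" using rC[of k k'] q(2) by auto
        have "anticomplete G (set (seg k k')) (set (seg m n))" using that mn by (intro seg_anticomplete) auto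
        moreover have "\<not> adj G (c t) w" if "k \<le> t" "t \<le> k'" "w \<in> set r" for t w
          using ad[of w t] that \<open>i \<le> k\<close> \<open>k' \<le> j\<close> \<open>p1 < k \<or> k' < p1\<close> adj_commute[OF G, of "c t" w] by auto
        ultimately show "anticomplete G (set (seg k k')) (set (rev (r @ q)))"
          unfolding anticomplete_def using q(2) by (auto simp: set_seg)
      qed
      show "set ?a \<inter> set (rev (r @ q)) = {}" "anticomplete G (set ?a) (set (rev (r @ q)))"
        "set ?b \<inter> set (rev (r @ q)) = {}" "anticomplete G (set ?b) (set (rev (r @ q)))"
        unfolding set_rev[of "seg (p1 + 1) j"] using 1 p True by simp_all
      have len: "3 \<le> length (rev (r @ q))" using r(2) Q(1) by (cases q) auto
      have "int (length ?a) = p1 - i" "int (length ?b) = j - p1" using p True by (simp_all add: length_seg)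
      then show "l \<le> length ?a + length ?b + 2" "l \<le> length ?a + length (rev (r @ q)) + 2"
        "l \<le> length ?b + length (rev (r @ q)) + 2"
        using len p True by linarith+
    qed
    then show False using no_theta by blast
  qed
qed

text \<open>The triangles are \<open>{hd r, c p, c (p + 1)}\<close> and \<open>{c p0, x, y}\<close>.
  They are joined by \<open>r\<close> and by the two stretches of \<open>C\<close> from the middle
  to \<open>s\<close> and to \<open>t\<close>. Each stretch gains one edge at \<open>x\<close> or
  \<open>y\<close>, so \<open>l - 1\<close> edges on \<open>C\<close> give a path of length
  \<open>l\<close>; the path along \<open>r\<close> may be short.\<close>

lemma no_prism_path:
  assumes x: "off x" and y: "off y" and xy: "adj G x y"
    and st: "s < p" "p + 1 < t" "L - 1 \<le> p - s" "L - 1 \<le> t - (p + 1)"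
    and p0: "t + 2 \<le> p0" "p0 \<le> s + N - 2" "mk x p0" "mk y p0"
    and xm: "\<And>k. s \<le> k \<Longrightarrow> k \<le> t \<Longrightarrow> mk x k \<longleftrightarrow> k = s"
    and ym: "\<And>k. s \<le> k \<Longrightarrow> k \<le> t \<Longrightarrow> mk y k \<longleftrightarrow> k = t"
    and r: "ipath G r" "r \<noteq> []" "x \<notin> set r" "y \<notin> set r" "c p0 \<notin> set r" "set r \<inter> set (seg s t) = {}"
      "\<And>w. w \<in> set r \<Longrightarrow> \<not> adj G x w" "\<And>w. w \<in> set r \<Longrightarrow> \<not> adj G y w"
    and h: "\<And>k. s \<le> k \<Longrightarrow> k \<le> t \<Longrightarrow> mk (hd r) k \<longleftrightarrow> k = p \<or> k = p + 1"
    and md: "\<And>w k. w \<in> set r \<Longrightarrow> w \<noteq> hd r \<Longrightarrow> s \<le> k \<Longrightarrow> k \<le> t \<Longrightarrow> \<not> mk w k"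
    and z: "\<And>w. w \<in> set r \<Longrightarrow> mk w p0 \<longleftrightarrow> w = last r"
  shows False
proof -
  let ?u = "c p0"
  let ?a = "r @ [?u]" and ?b = "rev (seg s p) @ [x]" and ?d = "seg (p + 1) t @ [y]"
  have C': "c k \<noteq> x" "c k \<noteq> y" for k using x y c_in unfolding off_def by metis+
  have xny: "x \<noteq> y" using xy adj_irrefl[OF G] by metis
  have hl: "hd ?a = hd r" "last ?a = ?u" "hd ?b = c p" "last ?b = x" "hd ?d = c (p + 1)" "last ?d = y"
    using r(2) st by (simp_all add: hd_rev last_seg hd_seg seg_ne hd_append)
  have sub: "set (seg s p) \<subseteq> set (seg s t)" "set (seg (p + 1) t) \<subseteq> set (seg s t)"
    using st unfolding set_seg by auto
  have cw: "c k = c k' \<longleftrightarrow> k = k'" if "s \<le> k" "k \<le> t" "s \<le> k'" "k' \<le> t" for k k'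
    using c_window[of k k'] that p0 by linarith
  have ua: "\<not> adj G ?u (c k)" "?u \<noteq> c k" if "s \<le> k" "k \<le> t" for k
    using adj_c[of p0 k] c_window[of p0 k] that p0 by auto
  have rs: "adj G w (c k) \<longleftrightarrow> w = hd r \<and> (k = p \<or> k = p + 1)" if "w \<in> set r" "s \<le> k" "k \<le> t" for w k
    using md[OF that(1) _ that(2,3)] h[OF that(2,3)] unfolding mk_def by blast
  have "contains_induced G (long_near_prism l)"
  proof (rule long_near_prismI[OF G, of ?a ?b ?d])
    show "?a \<noteq> []" "?b \<noteq> []" "?d \<noteq> []" by simp_all
    show "ipath G ?a" unfolding ipath_append using r z c_verts by (auto simp: mk_def)
    show "ipath G ?b" unfolding ipath_append
    proof (intro conjI ballI)
      show "ipath G (rev (seg s p))" using st p0 by (simp add: ipath_rev[OF G] ipath_seg)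
      fix u w assume "u \<in> set (rev (seg s p))" and w: "w \<in> set [x]"
      then obtain k where k: "s \<le> k" "k \<le> p" "u = c k" unfolding set_rev set_seg by auto
      have "last (rev (seg s p)) = c s" using st by (simp add: last_rev hd_seg seg_ne)
      then show "adj G u w \<longleftrightarrow> u = last (rev (seg s p)) \<and> w = hd [x]"
        using xm[of k] k st w cw[of k s] adj_commute[OF G, of x "c k"] by (auto simp: mk_def)
    qed (use x C' in \<open>auto simp: set_seg off_def\<close>)
    show "ipath G ?d" unfolding ipath_append
    proof (intro conjI ballI)
      show "ipath G (seg (p + 1) t)" using st p0 by (simp add: ipath_seg)
      fix u w assume "u \<in> set (seg (p + 1) t)" and w: "w \<in> set [y]"
      then obtain k where k: "p + 1 \<le> k" "k \<le> t" "u = c k" unfolding set_seg by auto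
      have "last (seg (p + 1) t) = c t" using st by (simp add: last_seg)
      then show "adj G u w \<longleftrightarrow> u = last (seg (p + 1) t) \<and> w = hd [y]"
        using ym[of k] k st w cw[of k t] adj_commute[OF G, of y "c k"] by (auto simp: mk_def)
    qed (use y C' in \<open>auto simp: set_seg off_def\<close>)
    have rsub: "set r \<inter> set (seg s p) = {}" "set r \<inter> set (seg (p + 1) t) = {}" using r(6) sub by blast+
    have us: "?u \<notin> set (seg s p)" "?u \<notin> set (seg (p + 1) t)"
      unfolding set_seg using st p0 by (intro c_notin; simp)+
    have Cs: "x \<notin> set (seg k k')" "y \<notin> set (seg k k')" for k k' using C' by (auto simp: set_seg)
    show "set ?a \<inter> set ?b = {}" using r(3) rsub(1) us(1) C'(1)[of p0] by auto
    show "set ?a \<inter> set ?d = {}" using r(4) rsub(2) us(2) C'(2)[of p0] by auto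
    show "set ?b \<inter> set ?d = {}" using xny Cs seg_disjoint[of p "p + 1" t s] st p0 by auto
    show "0 < l" "l < length ?b" "l < length ?d" using l4 st by (simp_all add: length_seg)
    have uh: "?u \<noteq> hd r" using r(2,5) by (metis hd_in_set)
    have xu: "adj G ?u x" "adj G ?u y" using p0 adj_commute[OF G] unfolding mk_def by metis+
    show "adj G u w \<longleftrightarrow> u = hd ?a \<and> w = hd ?b \<or> u = last ?a \<and> w = last ?b"
      if uw: "u \<in> set ?a" "w \<in> set ?b" for u w
    proof -
      have "adj G u w \<longleftrightarrow> u = hd r \<and> w = c p \<or> u = ?u \<and> w = x"
      proof -
      consider "u \<in> set r" | "u = ?u" using uw(1) by auto
      then show ?thesis
      proof cases
        case 1
        then have n: "u \<noteq> ?u" "\<not> adj G u x" using r(5,7) adj_commute[OF G, of u x] by auto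
        consider k where "s \<le> k" "k \<le> p" "w = c k" | "w = x" using uw(2) by (auto simp: set_seg)
        then show ?thesis
        proof cases
          case k: 1
          have "w = c p \<longleftrightarrow> k = p" using cw[of k p] k st by simp
          then show ?thesis using rs[OF 1, of k] k n(1) st C'(1) by auto
        next
          case 2 then show ?thesis using n C'(1) by metis
        qed
      next
        case 2
        consider k where "s \<le> k" "k \<le> p" "w = c k" | "w = x" using uw(2) by (auto simp: set_seg)
        then show ?thesis
        proof cases
          case k: 1 then show ?thesis using ua[of k] 2 uh C'(1) st by auto
        next
          case x: 2 then show ?thesis using xu 2 by simp
        qed
      qed
      qed
      then show ?thesis unfolding hl .
    qed
    show "adj G u w \<longleftrightarrow> u = hd ?a \<and> w = hd ?d \<or> u = last ?a \<and> w = last ?d"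
      if uw: "u \<in> set ?a" "w \<in> set ?d" for u w
    proof -
      have "adj G u w \<longleftrightarrow> u = hd r \<and> w = c (p + 1) \<or> u = ?u \<and> w = y"
      proof -
      consider "u \<in> set r" | "u = ?u" using uw(1) by auto
      then show ?thesis
      proof cases
        case 1
        then have n: "u \<noteq> ?u" "\<not> adj G u y" using r(5,8) adj_commute[OF G, of u y] by auto
        consider k where "p + 1 \<le> k" "k \<le> t" "w = c k" | "w = y" using uw(2) by (auto simp: set_seg)
        then show ?thesis
        proof cases
          case k: 1
          have "w = c (p + 1) \<longleftrightarrow> k = p + 1" using cw[of k "p + 1"] k st by simp
          then show ?thesis using rs[OF 1, of k] k n(1) st C'(2) by auto
        next
          case 2 then show ?thesis using n C'(2) by metis
        qed
      next
        case 2
        consider k where "p + 1 \<le> k" "k \<le> t" "w = c k" | "w = y" using uw(2) by (auto simp: set_seg)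
        then show ?thesis
        proof cases
          case k: 1 then show ?thesis using ua[of k] 2 uh C'(2) st by auto
        next
          case y: 2 then show ?thesis using xu 2 by simp
        qed
      qed
      qed
      then show ?thesis unfolding hl .
    qed
    show "adj G u w \<longleftrightarrow> u = hd ?b \<and> w = hd ?d \<or> u = last ?b \<and> w = last ?d"
      if uw: "u \<in> set ?b" "w \<in> set ?d" for u w
    proof -
      have "adj G u w \<longleftrightarrow> u = c p \<and> w = c (p + 1) \<or> u = x \<and> w = y"
      proof -
      consider k where "s \<le> k" "k \<le> p" "u = c k" | "u = x" using uw(1) by (auto simp: set_seg)
      then show ?thesis
      proof cases
        case k: 1
        consider k' where "p + 1 \<le> k'" "k' \<le> t" "w = c k'" | "w = y" using uw(2) by (auto simp: set_seg)
        then show ?thesis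
        proof cases
          case k': 1
          have "adj G (c k) (c k') \<longleftrightarrow> k = p \<and> k' = p + 1" using adj_c[of k k'] k k' p0 by auto
          moreover have "c k = c p \<longleftrightarrow> k = p" "c k' = c (p + 1) \<longleftrightarrow> k' = p + 1"
            using cw[of k p] cw[of k' "p + 1"] k k' st by simp_all
          ultimately show ?thesis using k k' C' by auto
        next
          case 2
          then show ?thesis using ym[of k] k st C' adj_commute[OF G, of y "c k"] by (auto simp: mk_def)
        qed
      next
        case x: 2
        consider k' where "p + 1 \<le> k'" "k' \<le> t" "w = c k'" | "w = y" using uw(2) by (auto simp: set_seg)
        then show ?thesis
        proof cases
          case k': 1
          then show ?thesis using xm[of k'] x st C' by (auto simp: mk_def)
        next
          case 2 then show ?thesis using x xy by simp
        qed
      qed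
      qed
      then show ?thesis unfolding hl .
    qed
  qed
  then show False using no_near_prism by blast
qed

end

section \<open>Searching the overlap of two gaps\<close>

definition allowed :: "'a sgraph \<Rightarrow> 'a set \<Rightarrow> 'a \<Rightarrow> 'a \<Rightarrow> 'a \<Rightarrow> bool" where
  "allowed G J x y v \<longleftrightarrow> v \<in> verts G \<and> \<not> adj G x v \<and> \<not> adj G y v \<and> (\<forall>j\<in>J. \<not> adj G j v)"

context shortest_hole begin

text \<open>The vertices off \<open>C\<close> that carry the search are nonmajor, so each sees
  \<open>C\<close> only locally, and \<open>J\<close> keeps these neighbours away from
  \<open>s\<close>, \<open>t\<close> and \<open>b\<close>. Cut a walk to a neighbour of
  \<open>c p0\<close> down to an induced path that leaves the searched arc \<open>?I\<close> once.
  If its first vertex sees exactly two consecutive vertices of \<open>?I\<close>, follow the path up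
  to \<open>c p0\<close> and obtain a near-prism. Otherwise stop where the path first sees
  \<open>C\<close> outside \<open>?I\<close> and obtain a theta through \<open>x\<close> or
  \<open>y\<close>.\<close>

lemma no_reach:
  assumes x: "off x" and y: "off y" and xy: "adj G x y"
    and gx: "gap x s b" and gy: "gap y e t" and ord: "e < s" "s + (L - 1) \<le> t - (L - 1)" "t < b"
    and Js: "\<And>k. s - 1 \<le> k \<Longrightarrow> k < s + (L - 1) \<Longrightarrow> c k \<in> J"
    and Jt: "\<And>k. t - (L - 1) < k \<Longrightarrow> k \<le> t + 1 \<Longrightarrow> c k \<in> J"
    and Jb: "\<And>k. b - 1 \<le> k \<Longrightarrow> k \<le> b + 1 \<Longrightarrow> c k \<in> J"
    and p0: "b + 2 \<le> p0" "p0 \<le> s + N - 2" "p0 + 2 \<le> e + N" "mk x p0" "mk y p0"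
    and nm: "\<And>v. allowed G J x y v \<Longrightarrow> v \<notin> set C \<Longrightarrow> \<not> major G C v"
    and w: "w \<in> reach G (allowed G J x y) {c (s + (L - 1)), c (t - (L - 1))}"
  shows "\<not> adj G w (c p0)"
proof
  assume wu: "adj G w (c p0)"
  define R where "R = L - 1"
  have R: "3 \<le> R" using l4 by (simp add: R_def)
  note ord = ord[folded R_def] and Js = Js[folded R_def] and Jt = Jt[folded R_def]
  let ?I = "c ` {s + R..t - R}"
  define S where "S = {v. allowed G J x y v \<and> v \<notin> ?I}"
  define A where "A = {v. \<exists>k. s + R \<le> k \<and> k \<le> t - R \<and> mk v k}"
  define B where "B = {v. \<exists>k. mk v k \<and> c k \<notin> ?I}"
  have xm: "mk x k \<longleftrightarrow> k = s" if "s \<le> k" "k \<le> t" for k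
    using gx that ord unfolding gap_def by (smt (verit))
  have ym: "mk y k \<longleftrightarrow> k = t" if "s \<le> k" "k \<le> t" for k
    using gy that ord unfolding gap_def by (smt (verit))
  have nJ: "c k \<notin> J" if "allowed G J x y v" "mk v k" for v k
    using that adj_commute[OF G, of v "c k"] unfolding allowed_def mk_def by blast
  have winI: "s + R \<le> k \<and> k \<le> t - R" if "c k \<in> ?I" "s - 3 \<le> k" "k < s + N" for k
    using that(1) by (rule c_image_window) (use that ord p0 R in auto)
  have p0I: "c p0 \<notin> ?I" using ord p0 R by (intro c_notin) auto
  have Sv: "s + R \<le> k \<and> k \<le> t - R" if "v \<in> S" "mk v k" "s \<le> k" "k \<le> t" for v k
    using nJ[of v k] that Js[of k] Jt[of k] unfolding S_def by (smt (verit) mem_Collect_eq)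
  \<comment> \<open>Only the part of the walk after its last visit to \<open>?I\<close> is
    kept.\<close>
  have "w \<in> ?I \<or> (\<exists>wl. wl \<noteq> [] \<and> set wl \<subseteq> S \<and> successively (adj G) wl \<and> hd wl \<in> A \<and> last wl = w)"
    using w[folded R_def]
  proof (induction rule: reach.induct)
    case (base q)
    then show ?case using ord by auto
  next
    case (step u v)
    show ?case
    proof (cases "v \<in> ?I")
      case False
      then have vS: "v \<in> S" using step by (simp add: S_def)
      from step.IH show ?thesis
      proof (elim disjE exE conjE)
        assume "u \<in> ?I"
        then have "v \<in> A" using step.hyps(2) adj_commute[OF G, of u v] unfolding A_def mk_def by auto
        then show ?thesis using vS by (intro disjI2 exI[of _ "[v]"]) simp
      next
        fix wl assume "wl \<noteq> []" "set wl \<subseteq> S" "successively (adj G) wl" "hd wl \<in> A" "last wl = u"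
        then show ?thesis using vS step.hyps(2)
          by (intro disjI2 exI[of _ "wl @ [v]"]) (simp add: successively_append_iff)
      qed
    qed simp
  qed
  moreover have "w \<notin> ?I"
  proof
    assume "w \<in> ?I"
    then obtain k where "s + R \<le> k" "k \<le> t - R" "w = c k" by auto
    then show False using wu adj_c[of k p0] ord p0 R by auto
  qed
  ultimately obtain wl where wl: "wl \<noteq> []" "set wl \<subseteq> S" "successively (adj G) wl" "hd wl \<in> A" "last wl = w"
    by blast
  have SV: "S \<subseteq> verts G" by (auto simp: S_def allowed_def)
  have "last wl \<in> {v. mk v p0}" using wu wl(5) by (simp add: mk_def)
  then obtain r where r: "ipath G r" "r \<noteq> []" "set r \<subseteq> set wl" "set r \<inter> A = {hd r}"
    "set r \<inter> {v. mk v p0} = {last r}"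
    using connecting_ipath[of wl G A "{v. mk v p0}"] wl SV by blast
  have rS: "set r \<subseteq> S" using r(3) wl(2) by simp
  have "last r \<in> B" using r(5) p0I by (auto simp: B_def)
  moreover have "hd r \<in> A" using r(4) by blast
  \<comment> \<open>Both paths start in \<open>hd r\<close>. While \<open>r\<close> ends in a
    neighbour of \<open>c p0\<close>, as the near-prism requires, \<open>r'\<close> stops at the
    first vertex that sees \<open>C\<close> outside \<open>?I\<close>, as the theta
    requires.\<close>
  ultimately obtain r' where r': "ipath G r'" "r' \<noteq> []" "set r' \<subseteq> set r" "set r' \<inter> A = {hd r'}"
    "set r' \<inter> B = {last r'}"
    using connecting_ipath[of r G A B] r rS SV ipath_successively[OF r(1)] by blast
  have hd_eq: "hd r' = hd r" using r'(3,4) r(4) by blast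
  have r'S: "set r' \<subseteq> S" using r'(3) rS by simp
  have hdS: "hd r \<in> S" using r(2) rS by auto
  have hdA: "\<exists>k. s + R \<le> k \<and> k \<le> t - R \<and> mk (hd r) k" using \<open>hd r \<in> A\<close> by (simp add: A_def)
  \<comment> \<open>A vertex of \<open>r'\<close> on \<open>C\<close> that comes first is next to
    \<open>?I\<close> and therefore sees \<open>J\<close>; if it comes later, its predecessor sees
    \<open>C\<close> outside \<open>?I\<close>, so \<open>r'\<close> would have ended
    before.\<close>
  have notC: "v \<notin> set C" if v: "v \<in> set r'" for v
  proof
    assume "v \<in> set C"
    then obtain k where k: "s \<le> k" "k < s + N" "v = c k" using in_C by blast
    have vS: "v \<in> S" using v r'S by blast
    show False
    proof (cases "v = hd r'")
      case True
      then obtain k' where k': "s + R \<le> k'" "k' \<le> t - R" "mk v k'" using hdA hd_eq by metis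
      have "\<bar>k - k'\<bar> = 1 \<or> \<bar>k - k'\<bar> = N - 1"
        using adj_c[of k k'] k' k ord p0 R unfolding mk_def by auto
      then have "\<bar>k - k'\<bar> = 1" using k k' ord p0 R by auto
      moreover have "\<not> (s + R \<le> k \<and> k \<le> t - R)" using vS k(3) unfolding S_def by auto
      ultimately have "k = s + R - 1 \<or> k = t - R + 1" using k' by linarith
      then show False
      proof
        assume "k = s + R - 1"
        moreover have "mk v (k - 1)" using k(3) adj_c_succ[of "k - 1"] adj_commute[OF G] by (auto simp: mk_def)
        ultimately show False using nJ[of v "k - 1"] vS Js[of "k - 1"] R unfolding S_def by auto
      next
        assume "k = t - R + 1"
        moreover have "mk v (k + 1)" using k(3) adj_c_succ[of k] by (auto simp: mk_def)
        ultimately show False using nJ[of v "k + 1"] vS Jt[of "k + 1"] R unfolding S_def by auto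
      qed
    next
      case False
      then obtain xs v' ys where sp: "r' = xs @ v' # v # ys"
      proof -
        obtain xs ys where "r' = xs @ v # ys" using split_list[OF v] by blast
        moreover have "xs \<noteq> []" using False calculation by auto
        ultimately show ?thesis using that[of "butlast xs" "last xs" ys] by simp
      qed
      have "adj G v' v" using r'(1) unfolding sp by (auto simp: ipath_append)
      then have "v' \<in> B" using k(3) vS unfolding B_def S_def mk_def by blast
      moreover have "v' \<in> set r'" using sp by simp
      ultimately have "v' = last r'" using r'(5) by blast
      moreover have "v' \<noteq> last r'" using ipath_distinct[OF r'(1)] unfolding sp
        by (auto simp: last_append)
      ultimately show False by simp
    qed
  qed
  have offr': "off v" "\<not> major G C v" if "v \<in> set r'" for v
    using that notC[OF that] r'S nm[of v] SV unfolding off_def S_def by auto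
  have hin: "hd r' \<in> set r'" "last r' \<in> set r'" using r'(2) by simp_all
  \<comment> \<open>A single vertex would see \<open>C\<close> both inside and outside
    \<open>?I\<close>. But its neighbours differ by at most three steps, and at least three
    positions next to \<open>?I\<close> on either side are in \<open>J\<close>.\<close>
  have len: "2 \<le> length r'"
  proof (rule ccontr)
    assume "\<not> 2 \<le> length r'"
    then obtain v where "r' = [v]" using r'(2) by (cases r'; cases "tl r'") auto
    then have "hd r' = last r'" by simp
    then have "hd r' \<in> B" using r'(5) by auto
    then obtain k' where k': "mk (hd r') k'" "c k' \<notin> ?I" by (auto simp: B_def)
    obtain k where k: "s + R \<le> k" "k \<le> t - R" "mk (hd r') k" using hdA hd_eq by auto
    obtain d where d: "\<bar>d\<bar> \<le> 3" "mk (hd r') (k + d)" "c (k + d) = c k'"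
      using nonmajor_close[OF offr'[OF hin(1)] k(3) k'(1)] by blast
    have "s \<le> k + d" "k + d \<le> t" using d(1) k R by auto
    then have "s + R \<le> k + d \<and> k + d \<le> t - R" using Sv[of "hd r'" "k + d"] hin(1) r'S d(2) by blast
    then have "c (k + d) \<in> ?I" by simp
    then show False using d(3) k'(2) by simp
  qed
  have hl: "hd r' \<noteq> last r'"
    using len ipath_distinct[OF r'(1)] r'(2) by (cases r') auto
  have hnB: "hd r' \<notin> B" using r'(5) hl hin(1) by blast
  have hI: "c k \<in> ?I" if "mk (hd r') k" for k using hnB that by (auto simp: B_def)
  obtain k0 where k0: "s + R \<le> k0" "k0 \<le> t - R" "mk (hd r') k0" using hdA hd_eq by auto
  obtain p1 where p1: "s + R \<le> p1" "p1 \<le> k0" "mk (hd r') p1" "\<And>k. s + R \<le> k \<Longrightarrow> k < p1 \<Longrightarrow> \<not> mk (hd r') k"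
    using next_mark[OF k0(3,1)] by blast
  obtain p2 where p2: "k0 \<le> p2" "p2 \<le> t - R" "mk (hd r') p2" "\<And>k. p2 < k \<Longrightarrow> k \<le> t - R \<Longrightarrow> \<not> mk (hd r') k"
    using prev_mark[OF k0(3,2)] by blast
  have h12: "c k \<in> c ` {p1..p2}" if m: "mk (hd r') k" for k
  proof -
    obtain k' where k': "s + R \<le> k'" "k' \<le> t - R" "c k = c k'" using hI[OF m] by auto
    then have "mk (hd r') k'" using m by (simp add: mk_def)
    then have "p1 \<le> k'" "k' \<le> p2" using p1(4)[of k'] p2(4)[of k'] k' by (meson not_le)+
    then show ?thesis using k'(3) by auto
  qed
  have xr: "x \<notin> set r" "y \<notin> set r" "\<And>v. v \<in> set r \<Longrightarrow> \<not> adj G x v" "\<And>v. v \<in> set r \<Longrightarrow> \<not> adj G y v"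
    using rS xy adj_sym[OF G xy] unfolding S_def allowed_def by blast+
  show False
  proof (cases "p2 = p1 + 1")
    case True
    show False
    proof (rule no_prism_path[OF x y xy, of s p1 t p0 r])
      show "s < p1" "p1 + 1 < t" "L - 1 \<le> p1 - s" "L - 1 \<le> t - (p1 + 1)"
        using p1 p2 True R unfolding R_def by linarith+
      show "t + 2 \<le> p0" "p0 \<le> s + N - 2" "mk x p0" "mk y p0" using p0 ord by auto
      show "c p0 \<notin> set r" using xr(3)[of "c p0"] p0(4) unfolding mk_def by blast
      show "set r \<inter> set (seg s t) = {}"
      proof (rule ccontr)
        assume "set r \<inter> set (seg s t) \<noteq> {}"
        then obtain v where "v \<in> set r" "v \<in> c ` {s..t}" unfolding set_seg by blast
        then obtain k where k: "s \<le> k" "k \<le> t" "c k \<in> set r" by auto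
        have kS: "c k \<in> S" using k rS by blast
        have a: "mk (c k) (k - 1)" "mk (c k) (k + 1)"
          using adj_c_succ[of "k - 1"] adj_c_succ[of k] adj_commute[OF G] by (auto simp: mk_def)
        have "\<not> (s + R \<le> k \<and> k \<le> t - R)" using kS unfolding S_def by auto
        then show False
          using nJ[of "c k" "k - 1"] nJ[of "c k" "k + 1"] a kS Js[of "k - 1"] Jt[of "k + 1"] k
          unfolding S_def by auto
      qed
      show "mk (hd r) k \<longleftrightarrow> k = p1 \<or> k = p1 + 1" if "s \<le> k" "k \<le> t" for k
      proof
        assume "mk (hd r) k"
        moreover from this have "s + R \<le> k \<and> k \<le> t - R" using Sv[OF hdS _ that] by blast
        ultimately show "k = p1 \<or> k = p1 + 1" using p1(4)[of k] p2(4)[of k] True hd_eq by force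
      qed (use p1 p2 True hd_eq in auto)
      show "\<not> mk v k" if v: "v \<in> set r" "v \<noteq> hd r" "s \<le> k" "k \<le> t" for v k
      proof
        assume m: "mk v k"
        have "v \<in> S" using v(1) rS by blast
        from Sv[OF this m v(3,4)] have "v \<in> A" using m unfolding A_def by blast
        then show False using v(1,2) r(4) by blast
      qed
      show "mk v p0 \<longleftrightarrow> v = last r" if "v \<in> set r" for v using r(5) that by blast
    qed (use xr r(1,2) xm ym in auto)
  next
    case False
    let ?z = "last r'"
    have zS: "?z \<in> S" using hin(2) r'S by blast
    have zA: "?z \<notin> A" using hin(2) r'(4) hl by (metis IntI singletonD)
    have zpos: "t + 2 \<le> k \<and> k \<le> s + N - 2 \<and> (k \<le> b - 2 \<or> b + 2 \<le> k)"
      if m: "mk ?z k" "s \<le> k" "k < s + N" for k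
    proof -
      have kJ: "c k \<notin> J" using nJ[OF _ m(1)] zS by (simp add: S_def)
      have "\<not> (s \<le> k \<and> k \<le> t)"
      proof
        assume "s \<le> k \<and> k \<le> t"
        then have "s + R \<le> k \<and> k \<le> t - R" using Sv[OF zS m(1)] by blast
        then show False using zA m(1) unfolding A_def by blast
      qed
      moreover have "k \<noteq> t + 1" using Jt[of "t + 1"] kJ R by auto
      moreover have "k \<noteq> s - 1 + N" using Js[of "s - 1"] kJ R by auto
      moreover have "\<not> (b - 1 \<le> k \<and> k \<le> b + 1)" using Jb[of k] kJ by blast
      ultimately show ?thesis using m by linarith
    qed
    have "\<exists>k. mk ?z k" using r'(5) by (auto simp: B_def)
    then obtain k1' where "mk ?z k1'" by blast
    then obtain k1 where k1: "mk ?z k1" "s \<le> k1" "k1 < s + N"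
      using shift_into[of s k1'] unfolding mk_def by metis
    note zk1 = zpos[OF k1]
    have side: "\<exists>k'. c k' = c k \<and> mk ?z k' \<and> s \<le> k' \<and> k' < s + N \<and> \<bar>k' - k1\<bar> \<le> 3" if m: "mk ?z k" for k
    proof -
      obtain d where d: "\<bar>d\<bar> \<le> 3" "mk ?z (k1 + d)" "c (k1 + d) = c k"
        using nonmajor_close[OF offr'[OF hin(2)] k1(1) m] by blast
      have "k1 + d < s + N"
      proof (rule ccontr)
        assume a: "\<not> k1 + d < s + N"
        have "c (k1 + d - N) \<in> J" using a d(1) zk1 R by (intro Js) auto
        then show False using nJ[of ?z "k1 + d"] zS d(2) by (simp add: S_def)
      qed
      moreover have "s \<le> k1 + d" using d(1) zk1 ord R by linarith
      ultimately show ?thesis using d by (intro exI[of _ "k1 + d"]) auto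
    qed
    have md: "\<not> mk v k" if "v \<in> set r'" "v \<noteq> hd r'" "v \<noteq> ?z" for v k
    proof
      assume m: "mk v k"
      have "v \<notin> A" "v \<notin> B" using that r'(4,5) by auto
      then have "c k \<in> ?I" using m by (auto simp: B_def)
      then obtain k' where "s + R \<le> k'" "k' \<le> t - R" "c k = c k'" by auto
      then have "v \<in> A" using m unfolding A_def mk_def by auto
      then show False using \<open>v \<notin> A\<close> by simp
    qed
    have r'C: "set r' \<inter> set C = {}" using notC by blast
    have r'x: "x \<notin> set r'" "y \<notin> set r'" "\<And>v. v \<in> set r' \<Longrightarrow> \<not> adj G x v" "\<And>v. v \<in> set r' \<Longrightarrow> \<not> adj G y v"
      using xr r'(3) by blast+
    show False
    \<comment> \<open>Neighbours at most three steps apart cannot lie on both sides of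
      \<open>b - 1\<close>, \<open>b\<close>, \<open>b + 1\<close>, which are all in
      \<open>J\<close>. Beyond \<open>b\<close> the path leaves the gap of \<open>x\<close>; before
      \<open>b\<close> it has already left the gap of \<open>y\<close>, which ends in
      \<open>t\<close>.\<close>
    proof (cases "b + 2 \<le> k1")
      case True
      have zz: "c k \<in> c ` {b + 2..s + N - 2}" if m: "mk ?z k" for k
      proof -
        obtain k' where k': "c k' = c k" "mk ?z k'" "s \<le> k'" "k' < s + N" "\<bar>k' - k1\<bar> \<le> 3" using side[OF m] by blast
        then have "b + 2 \<le> k' \<and> k' \<le> s + N - 2" using zpos[OF k'(2-4)] True by linarith
        then show ?thesis using k'(1) by (metis atLeastAtMost_iff imageI)
      qed
      show False
        by (rule no_leaving_path[OF x gx _ _ _ _ _ _ r'(1) len r'C r'x(1) r'x(3) p1(3) p2(3) h12 md k1(1) zz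
            p0(4,1,2)]) (use p1 p2 False ord R in \<open>auto simp: R_def\<close>)
    next
      case F: False
      have zz: "c k \<in> c ` {t + 2..e + N - 2}" if m: "mk ?z k" for k
      proof -
        obtain k' where k': "c k' = c k" "mk ?z k'" "s \<le> k'" "k' < s + N" "\<bar>k' - k1\<bar> \<le> 3" using side[OF m] by blast
        then have "t + 2 \<le> k' \<and> k' \<le> b - 2" using zpos[OF k'(2-4)] F zk1 by linarith
        then have "t + 2 \<le> k' \<and> k' \<le> e + N - 2" using p0 by linarith
        then show ?thesis using k'(1) by (metis atLeastAtMost_iff imageI)
      qed
      have "t + 2 \<le> p0" using p0 ord by linarith
      moreover have "p0 \<le> e + N - 2" using p0 by linarith
      ultimately show False
        by (intro no_leaving_path[OF y gy _ _ _ _ _ _ r'(1) len r'C r'x(2) r'x(4) p1(3) p2(3) h12 md k1(1) zz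
            p0(5)]) (use p1 p2 False ord R in \<open>auto simp: R_def\<close>)
    qed
  qed
qed

end

section \<open>Covering the major vertices\<close>

text \<open>Synchronous search with a bounded number of rounds, the lower bound for what the program
  has marked.\<close>

primrec nreach :: "'a sgraph \<Rightarrow> ('a \<Rightarrow> bool) \<Rightarrow> 'a set \<Rightarrow> nat \<Rightarrow> 'a set" where
  "nreach G A Q 0 = Q"
| "nreach G A Q (Suc n) = nreach G A Q n \<union> {v. A v \<and> (\<exists>u\<in>nreach G A Q n. adj G u v)}"

lemma nreach_mono: "m \<le> n \<Longrightarrow> nreach G A Q m \<subseteq> nreach G A Q n"
  by (induction n) (auto simp: le_Suc_eq)

section \<open>Pseudo-gaps, their covers, and clean guesses\<close>

context shortest_hole begin

text \<open>Pseudo-gaps, given as the list of their gaps. Lemma \<open>nonadjacent_major\<close> does not always yield a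
  longer gap, but sometimes two long gaps separated by a single edge of \<open>C\<close>; the second case makes
  the notion stable under that step.\<close>

definition pgap :: "'a \<Rightarrow> (int \<times> int) list \<Rightarrow> bool" where
  "pgap v P \<longleftrightarrow> (\<exists>a b. P = [(a, b)] \<and> gap v a b) \<or>
     (\<exists>a h b. P = [(a, h), (h + 1, b)] \<and> 5 \<le> l \<and> gap v a h \<and> gap v (h + 1) b \<and>
        L - 2 \<le> h - a \<and> L - 2 \<le> b - (h + 1))"

definition lo :: "(int \<times> int) list \<Rightarrow> int" where "lo P = fst (hd P)"
definition hi :: "(int \<times> int) list \<Rightarrow> int" where "hi P = snd (last P)"

text \<open>The margins of width \<open>rho\<close> in each gap and the positions just outside the
  whole. The position just outside an inner end needs no separate entry, since it begins the margin
  of the other gap.\<close>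

definition cov :: "(int \<times> int) list \<Rightarrow> int set" where
  "cov P = {lo P - 1, hi P + 1} \<union> (\<Union>(i, j)\<in>set P. {i..<i + rho} \<union> {j - rho<..j})"

text \<open>Where a neighbour on \<open>C\<close> of a covered position can lie if it is not covered
  itself; these vertices have to be subtracted from the output.\<close>

definition bd :: "(int \<times> int) list \<Rightarrow> int set" where
  "bd P = {lo P - 2, hi P + 2} \<union> (\<Union>(i, j)\<in>set P. {i + rho, j - rho})"

lemma lo_hi [simp]: "lo [(a, b)] = a" "hi [(a, b)] = b" "lo [(a, h), (h', b)] = a" "hi [(a, h), (h', b)] = b"
  by (simp_all add: lo_def hi_def)

lemma pgap_cases:
  assumes "pgap v P"
  obtains (one) a b where "P = [(a, b)]" "gap v a b"
  | (two) a h b where "P = [(a, h), (h + 1, b)]" "5 \<le> l" "gap v a h" "gap v (h + 1) b"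
      "L - 2 \<le> h - a" "L - 2 \<le> b - (h + 1)"
  using assms unfolding pgap_def by blast

lemma pgap_piece: "pgap v P \<Longrightarrow> (i, j) \<in> set P \<Longrightarrow> gap v i j \<and> lo P \<le> i \<and> j \<le> hi P"
  unfolding pgap_def by (auto simp: gap_def)

lemma pgap_marks: "pgap v P \<Longrightarrow> mk v (lo P) \<and> mk v (hi P) \<and> lo P < hi P"
  unfolding pgap_def gap_def by auto

lemma pgap_inside:
  assumes "pgap v P" "lo P < k" "k < hi P"
  shows "mk v k \<or> (\<exists>i j. (i, j) \<in> set P \<and> i < k \<and> k < j)"
  using assms(1)
proof (cases rule: pgap_cases)
  case (one a b) then show ?thesis using assms(2,3) by auto
next
  case (two a h b)
  then have "k = h \<or> k = h + 1 \<or> k < h \<or> h + 1 < k" by linarith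
  then show ?thesis using two assms(2,3) unfolding gap_def by auto
qed

lemma cov_step:
  assumes "pgap v P" "w \<in> cov P"
  shows "w - 1 \<in> cov P \<union> bd P \<and> w + 1 \<in> cov P \<union> bd P"
  using assms(1)
proof (cases rule: pgap_cases)
  case (one a b)
  have M: "k \<in> cov P \<longleftrightarrow> k = a - 1 \<or> k = b + 1 \<or> a \<le> k \<and> k < a + rho \<or> b - rho < k \<and> k \<le> b"
    "k \<in> bd P \<longleftrightarrow> k = a - 2 \<or> k = b + 2 \<or> k = a + rho \<or> k = b - rho" for k
    unfolding one(1) cov_def bd_def by auto
  show ?thesis using assms(2) rho(1) unfolding Un_iff M by smt
next
  case (two a h b)
  have M: "k \<in> cov P \<longleftrightarrow> k = a - 1 \<or> k = b + 1 \<or> a \<le> k \<and> k < a + rho \<or> h - rho < k \<and> k \<le> h \<or>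
      h + 1 \<le> k \<and> k < h + 1 + rho \<or> b - rho < k \<and> k \<le> b"
    "k \<in> bd P \<longleftrightarrow> k = a - 2 \<or> k = b + 2 \<or> k = a + rho \<or> k = h - rho \<or> k = h + 1 + rho \<or> k = b - rho" for k
    unfolding two(1) cov_def bd_def by auto
  show ?thesis using assms(2) rho(1) unfolding Un_iff M by smt
qed

lemma cov_piece:
  assumes "pgap v P" "(i, j) \<in> set P"
  shows "{i - 1..<i + rho} \<subseteq> cov P" "{j - rho<..j + 1} \<subseteq> cov P"
proof -
  from assms(1) have "{i - 1..<i + rho} \<subseteq> cov P \<and> {j - rho<..j + 1} \<subseteq> cov P"
  proof (cases rule: pgap_cases)
    case (one a b)
    then have "i = a" "j = b" using assms(2) by auto
    then show ?thesis unfolding one(1) cov_def by auto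
  next
    case (two a h b)
    then consider "i = a" "j = h" | "i = h + 1" "j = b" using assms(2) by auto
    then show ?thesis unfolding two(1) cov_def using rho(1) by cases auto
  qed
  then show "{i - 1..<i + rho} \<subseteq> cov P" "{j - rho<..j + 1} \<subseteq> cov P" by auto
qed

text \<open>With two gaps, the mark at \<open>lo P\<close> reappears at \<open>lo P + N\<close>, and
  the second gap cannot pass over it. The bound guarantees that longest pseudo-gaps exist.\<close>

lemma pgap_span:
  assumes "major G C v" "pgap v P"
  shows "hi P \<le> lo P + N"
  using assms(2)
proof (cases rule: pgap_cases)
  case (one a b)
  then show ?thesis using major_gap[OF assms(1), of a b] by simp
next
  case (two a h b)
  have "h - a \<le> N - 4" using major_gap[OF assms(1) two(3)] .
  moreover have "mk v (a + N)" using two(3) by (simp add: gap_def)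
  moreover from this have "\<not> (h + 1 < a + N \<and> a + N < b)" using two(4) unfolding gap_def by blast
  ultimately have "b \<le> a + N" by linarith
  then show ?thesis using two(1) by simp
qed

text \<open>Two gaps occur only for \<open>5 \<le> l\<close> and cost at most
  \<open>2 + 4 * (l - 3)\<close>. For \<open>l = 4\<close> the single gap with
  \<open>rho = 2\<close> costs at most 6, which is again \<open>4 * l - 10\<close>.\<close>

lemma card_cov: assumes "pgap v P" shows "finite (cov P)" "int (card (cov P)) \<le> 4 * L - 10"
proof -
  have c1: "finite ({i..<i + rho} \<union> {j - rho<..j})" "int (card ({i..<i + rho} \<union> {j - rho<..j})) \<le> 2 * rho" for i j
  proof -
    have "card ({i..<i + rho} \<union> {j - rho<..j}) \<le> card {i..<i + rho} + card {j - rho<..j}" by (rule card_Un_le)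
    also have "\<dots> = nat rho + nat rho" by simp
    finally show "int (card ({i..<i + rho} \<union> {j - rho<..j})) \<le> 2 * rho" using rho(1) by simp
  qed simp
  have c2: "card {x - 1, y + 1} \<le> 2" for x y :: int by (simp add: card_insert_if)
  show "finite (cov P)" by (auto simp: cov_def)
  show "int (card (cov P)) \<le> 4 * L - 10"
    using assms
  proof (cases rule: pgap_cases)
    case (one a b)
    have "cov P = {a - 1, b + 1} \<union> ({a..<a + rho} \<union> {b - rho<..b})" unfolding one by (simp add: cov_def)
    then have "card (cov P) \<le> card {a - 1, b + 1} + card ({a..<a + rho} \<union> {b - rho<..b})"
      using card_Un_le[of "{a - 1, b + 1}"] by metis
    then have "int (card (cov P)) \<le> 2 + 2 * rho" using c1(2)[of a b] c2[of a b] by linarith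
    then show ?thesis using rho l4 by (cases "l = 4") auto
  next
    case (two a h b)
    let ?X = "{a..<a + rho} \<union> {h - rho<..h}" and ?Y = "{h + 1..<h + 1 + rho} \<union> {b - rho<..b}"
    have "cov P = {a - 1, b + 1} \<union> (?X \<union> ?Y)" unfolding two by (simp add: cov_def)
    then have "card (cov P) \<le> card {a - 1, b + 1} + card (?X \<union> ?Y)"
      using card_Un_le[of "{a - 1, b + 1}"] by metis
    moreover have "card (?X \<union> ?Y) \<le> card ?X + card ?Y" by (rule card_Un_le)
    ultimately have "int (card (cov P)) \<le> 2 + 4 * rho" using c1(2)[of a h] c1(2)[of "h + 1" b] c2[of a b] by linarith
    then show ?thesis using rho(4) two(2) by auto
  qed
qed

lemma card_bd: assumes "pgap v P" shows "finite (bd P)" "card (bd P) \<le> 6"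
proof -
  have *: "card {a, b, p, q} \<le> 6" "card {a, b, p, q, r, s} \<le> 6" for a b p q r s :: int
    by (simp_all add: card_insert_if)
  show "finite (bd P)" by (auto simp: bd_def)
  show "card (bd P) \<le> 6"
    using assms
  proof (cases rule: pgap_cases)
    case (one a b)
    have "bd P = {a - 2, b + 2, a + rho, b - rho}" unfolding one by (auto simp: bd_def)
    then show ?thesis using * by simp
  next
    case (two a h b)
    have "bd P = {a - 2, b + 2, a + rho, h - rho, h + 1 + rho, b - rho}" unfolding two by (auto simp: bd_def)
    then show ?thesis using * by simp
  qed
qed

definition free :: "int set \<Rightarrow> 'a \<Rightarrow> bool" where "free W v \<longleftrightarrow> (\<forall>w\<in>W. \<not> mk v w)"

lemma free_image: "free W v \<longleftrightarrow> (\<forall>j\<in>c ` W. \<not> adj G j v)"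
  unfolding free_def mk_def using adj_commute[OF G] by auto

text \<open>The rerouting argument behind both stages: a vertex seen from an inclusion-maximal pseudo-gap is
  either covered or adjacent to the vertex owning it.\<close>

lemma free_major_adjacent:
  assumes x: "major G C x" and z: "major G C z" and P: "pgap x P"
    and max: "\<And>Q. pgap z Q \<Longrightarrow> lo Q < lo P \<Longrightarrow> hi P < hi Q \<Longrightarrow> False"
    and compl: "\<And>i j. gap x i j \<Longrightarrow> L + 2 \<le> N - (j - i)" and fr: "free (cov P) z"
  shows "adj G x z" "\<exists>k. lo P < k \<and> k < hi P \<and> mk z k"
proof -
  let ?a = "lo P" and ?b = "hi P"
  have ends: "\<not> mk z i" "\<not> mk z j" "\<not> mk z (i - 1)" "\<not> mk z (j + 1)" if "(i, j) \<in> set P" for i j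
    using fr cov_piece[OF P that] rho(1) unfolding free_def by (auto simp: subset_iff)
  have zab: "\<not> mk z ?a" "\<not> mk z ?b"
    using P ends by (auto elim!: pgap_cases)
  have xab: "mk x ?a" "mk x ?b" "?a < ?b" using pgap_marks[OF P] by auto
  have xz: "x \<noteq> z" using xab(1) zab(1) by auto
  \<comment> \<open>Without a mark between the ends, the gap of \<open>z\<close> around
    \<open>P\<close> would be a pseudo-gap that \<open>max\<close> forbids.\<close>
  show meets: "\<exists>k. ?a < k \<and> k < ?b \<and> mk z k"
  proof (rule ccontr)
    assume no: "\<not> ?thesis"
    obtain k where k: "mk z k" using major_spread[OF z] by blast
    obtain k1 where k1: "?a - N \<le> k1" "k1 < ?a - N + N" "c k1 = c k" using shift_into by blast
    obtain k2 where k2: "?b \<le> k2" "k2 < ?b + N" "c k2 = c k" using shift_into by blast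
    have m: "mk z k1" "mk z k2" using k k1(3) k2(3) by (simp_all add: mk_def)
    obtain e where e: "e \<le> ?a" "mk z e" "\<And>k. e < k \<Longrightarrow> k \<le> ?a \<Longrightarrow> \<not> mk z k"
      using prev_mark[OF m(1), of ?a] k1(2) by auto
    obtain f where f: "?b \<le> f" "mk z f" "\<And>k. ?b \<le> k \<Longrightarrow> k < f \<Longrightarrow> \<not> mk z k"
      using next_mark[OF m(2) k2(1)] by auto
    have ef: "e < ?a" "?b < f" using e f zab by (auto simp: less_le)
    have "gap z e f" unfolding gap_def
    proof (intro conjI allI impI)
      fix k assume "e < k \<and> k < f"
      then show "\<not> mk z k" using e(3)[of k] f(3)[of k] no zab by (cases "k \<le> ?a"; cases "?b \<le> k") auto
    qed (use e f ef xab in auto)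
    then have "pgap z [(e, f)]" by (simp add: pgap_def)
    then show False using max[of "[(e, f)]"] ef by simp
  qed
  show "adj G x z"
  proof (rule ccontr)
    assume na: "\<not> adj G x z"
    obtain k0 where k0: "?a < k0" "k0 < ?b" "mk z k0" using meets by blast
    have key: "\<exists>e f g m n. 5 \<le> l \<and> e < i - 1 \<and> j + 1 < f \<and> gap z e g \<and> gap z (g + 1) f \<and>
        L - 2 \<le> g - e \<and> L - 2 \<le> f - (g + 1) \<and>
        e \<le> m \<and> m \<le> i \<and> mk x m \<and> (\<forall>k. e \<le> k \<and> k < m \<longrightarrow> \<not> mk x k) \<and> even (i - m) \<and>
        j \<le> n \<and> n \<le> f \<and> mk x n \<and> (\<forall>k. n < k \<and> k \<le> f \<longrightarrow> \<not> mk x k) \<and> even (n - j)"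
      if ij: "(i, j) \<in> set P" and k: "i < k0" "k0 < j" for i j
    proof -
      have g: "gap x i j" using pgap_piece[OF P ij] by simp
      have ni: "\<not> mk z k" if "i - 1 \<le> k" "k < i + rho" for k
        using fr cov_piece(1)[OF P ij] that unfolding free_def by (auto simp: subset_iff)
      have nj: "\<not> mk z k" if "j - rho < k" "k \<le> j + 1" for k
        using fr cov_piece(2)[OF P ij] that unfolding free_def by (auto simp: subset_iff)
      show ?thesis
      proof (rule nonadjacent_major[OF x z na xz g compl[OF g] _ _ k k0(3)])
        show "\<not> mk z k" if "i - 1 \<le> k" "k < i + rho" for k by (rule ni[OF that])
        show "\<not> mk z k" if "j - rho < k" "k \<le> j + 1" for k by (rule nj[OF that])
        fix e f g m n
        assume r: "5 \<le> l" "e < i - 1" "j + 1 < f" "gap z e g" "gap z (g + 1) f"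
          "i + rho \<le> g" "g + 1 \<le> j - rho"
          "e \<le> m" "m \<le> i" "mk x m" "\<And>k. e \<le> k \<Longrightarrow> k < m \<Longrightarrow> \<not> mk x k" "even (i - m)"
          "j \<le> n" "n \<le> f" "mk x n" "\<And>k. n < k \<Longrightarrow> k \<le> f \<Longrightarrow> \<not> mk x k" "even (n - j)"
        have "L - 2 \<le> g - e" "L - 2 \<le> f - (g + 1)" using r(2,3,6,7) rho(2) by linarith+
        then show ?thesis using r by blast
      qed
    qed
    show False
      using P
    proof (cases rule: pgap_cases)
      case (one a b)
      then obtain e f g where *: "5 \<le> l" "e < a - 1" "b + 1 < f" "gap z e g" "gap z (g + 1) f"
        "L - 2 \<le> g - e" "L - 2 \<le> f - (g + 1)"
        using key[of a b] k0 by auto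
      then have "pgap z [(e, g), (g + 1, f)]" by (simp add: pgap_def)
      then show False using max[of "[(e, g), (g + 1, f)]"] * one by simp
    next
      case (two a h b)
      have hm: "mk x h" "mk x (h + 1)" "a < h" "h + 1 < b" using two(3,4) by (auto simp: gap_def)
      have "\<not> mk z h" "\<not> mk z (h + 1)" using ends[of a h] ends[of "h + 1" b] two(1) by auto
      then have "k0 \<noteq> h" "k0 \<noteq> h + 1" using k0(3) by auto
      then consider "k0 < h" | "h + 1 < k0" by linarith
      then show False
      proof cases
        case 1
        then obtain e f g n where *: "5 \<le> l" "e < a - 1" "h + 1 < f" "gap z e g" "gap z (g + 1) f"
          "L - 2 \<le> g - e" "L - 2 \<le> f - (g + 1)" "h \<le> n" "n \<le> f" "mk x n"
          "\<forall>k. n < k \<and> k \<le> f \<longrightarrow> \<not> mk x k" "even (n - h)"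
          using key[of a h] k0 two(1) by auto
        \<comment> \<open>Otherwise \<open>f\<close> lies inside the second gap of \<open>x\<close>,
          so the last mark of \<open>x\<close> up to \<open>f\<close> is \<open>h + 1\<close>,
          whereas \<open>n - h\<close> is even.\<close>
        have "b < f"
        proof (rule ccontr)
          assume "\<not> b < f"
          moreover have "f \<noteq> b" using *(5) zab(2) two(1) by (auto simp: gap_def)
          ultimately have "f < b" by simp
          have "n \<noteq> h" using *(3,11) hm(2) by auto
          moreover have "\<not> h + 1 < n"
            using *(9,10) \<open>f < b\<close> two(4) unfolding gap_def by (meson le_less_trans)
          ultimately have "n = h + 1" using *(8) by linarith
          then show False using *(12) by simp
        qed
        moreover have "pgap z [(e, g), (g + 1, f)]" using * by (simp add: pgap_def)
        ultimately show False using max[of "[(e, g), (g + 1, f)]"] * two(1) by simp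
      next
        case 2
        then obtain e f g m where *: "5 \<le> l" "e < h" "b + 1 < f" "gap z e g" "gap z (g + 1) f"
          "L - 2 \<le> g - e" "L - 2 \<le> f - (g + 1)" "e \<le> m" "m \<le> h + 1" "mk x m"
          "\<forall>k. e \<le> k \<and> k < m \<longrightarrow> \<not> mk x k" "even (h + 1 - m)"
          using key[of "h + 1" b] k0 two(1) by auto
        have "e < a"
        proof (rule ccontr)
          assume "\<not> e < a"
          moreover have "e \<noteq> a" using *(4) zab(1) two(1) by (auto simp: gap_def)
          ultimately have "a < e" by simp
          have "m \<noteq> h + 1" using *(2,11) hm(1) by auto
          moreover have "\<not> m < h"
            using *(8,10) \<open>a < e\<close> two(3) unfolding gap_def by (meson less_le_trans)
          ultimately have "m = h" using *(9) by linarith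
          then show False using *(12) by simp
        qed
        moreover have "pgap z [(e, g), (g + 1, f)]" using * by (simp add: pgap_def)
        ultimately show False using max[of "[(e, g), (g + 1, f)]"] * two(1) by simp
      qed
    qed
  qed
qed

text \<open>A successful guess. The set of reached vertices is only required to lie between \<open>nreach\<close> and \<open>reach\<close>
  (whence the asymmetry between the two clauses), because a program that updates its marks in place
  may run ahead of the round counter.\<close>

definition clean :: "'a set \<Rightarrow> 'a set \<Rightarrow> 'a \<Rightarrow> 'a \<Rightarrow> 'a \<Rightarrow> 'a \<Rightarrow> bool" where
  "clean J E q0 q1 x y \<longleftrightarrow> J \<subseteq> set C \<and> J \<noteq> {} \<and> int (card J) \<le> 8 * L - 16 \<and>
     E \<subseteq> set C \<and> E \<noteq> {} \<and> card E \<le> 12 \<and> q0 \<in> set C \<and> q1 \<in> set C \<and> x \<in> verts G \<and> y \<in> verts G \<and>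
     (\<forall>z. major G C z \<longrightarrow> (\<exists>j\<in>J. adj G j z) \<or> adj G x z \<and> adj G y z \<and>
        (\<exists>w\<in>nreach G (allowed G J x y) {q0, q1} (card (verts G)). adj G w z)) \<and>
     (\<forall>v\<in>set C. v \<notin> J \<union> E \<union> {q0, q1} \<longrightarrow> (\<forall>j\<in>J. \<not> adj G j v) \<and>
        \<not> (adj G x v \<and> adj G y v \<and> (\<exists>w\<in>reach G (allowed G J x y) {q0, q1}. adj G w v)))"

text \<open>Passes from positions to vertices. By \<open>step\<close> every neighbour on
  \<open>C\<close> of a guessed vertex is guessed or subtracted, so the remaining vertices of
  \<open>C\<close> see no guessed vertex.\<close>

lemma cleanI:
  assumes W: "finite W" "w0 \<in> W" "int (card W) \<le> 8 * L - 16" and F: "finite F" "f0 \<in> F" "card F \<le> 12"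
    and step: "\<And>w. w \<in> W \<Longrightarrow> w - 1 \<in> W \<union> F \<union> {k0, k1} \<and> w + 1 \<in> W \<union> F \<union> {k0, k1}"
    and xy: "x \<in> verts G" "y \<in> verts G"
    and maj: "\<And>z. major G C z \<Longrightarrow> free W z \<Longrightarrow> adj G x z \<and> adj G y z \<and>
        (\<exists>w\<in>nreach G (allowed G (c ` W) x y) {c k0, c k1} (card (verts G)). adj G w z)"
    and safe: "\<And>v w. v \<in> set C \<Longrightarrow> v \<notin> c ` W \<Longrightarrow> v \<notin> c ` F \<Longrightarrow> v \<noteq> c k0 \<Longrightarrow> v \<noteq> c k1 \<Longrightarrow> adj G x v \<Longrightarrow> adj G y v \<Longrightarrow>
        w \<in> reach G (allowed G (c ` W) x y) {c k0, c k1} \<Longrightarrow> \<not> adj G w v"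
  shows "clean (c ` W) (c ` F) (c k0) (c k1) x y"
  unfolding clean_def
proof (intro conjI allI ballI impI)
  have "card (c ` W) \<le> card W" "card (c ` F) \<le> card F" using W F by (simp_all add: card_image_le)
  then show "int (card (c ` W)) \<le> 8 * L - 16" "card (c ` F) \<le> 12" using W F by linarith+
  show "(\<exists>j\<in>c ` W. adj G j z) \<or> adj G x z \<and> adj G y z \<and>
      (\<exists>w\<in>nreach G (allowed G (c ` W) x y) {c k0, c k1} (card (verts G)). adj G w z)" if "major G C z" for z
    using maj[OF that] free_image by blast
next
  fix v assume v: "v \<in> set C" "v \<notin> c ` W \<union> c ` F \<union> {c k0, c k1}"
  show "\<not> adj G j v" if "j \<in> c ` W" for j
  proof
    assume a: "adj G j v"
    obtain w where w: "w \<in> W" "j = c w" using \<open>j \<in> c ` W\<close> by blast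
    have "v = c (w + 1) \<or> v = c (w - 1)" using nbr_c a v(1) w(2) by blast
    then show False using step[OF w(1)] v(2) by auto
  qed
  show "\<not> (adj G x v \<and> adj G y v \<and> (\<exists>w\<in>reach G (allowed G (c ` W) x y) {c k0, c k1}. adj G w v))"
    using safe[of v] v by auto
next
  show "c ` W \<subseteq> set C" "c ` F \<subseteq> set C" "c k0 \<in> set C" "c k1 \<in> set C" using c_in by auto
  show "c ` W \<noteq> {}" "c ` F \<noteq> {}" using W(2) F(2) by auto
qed (rule xy)+

text \<open>If \<open>W\<close> alone meets the neighbourhood of every major vertex, the slots for
  \<open>x\<close> and \<open>y\<close> still need values. With the guessed vertex
  \<open>c w0\<close> they do no harm, since all its neighbours on \<open>C\<close> are guessed or
  subtracted.\<close>

lemma cleanI_covered: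
  assumes W: "finite W" "w0 \<in> W" "int (card W) \<le> 8 * L - 16" and F: "finite F" "f0 \<in> F" "card F \<le> 12"
    and step: "\<And>w. w \<in> W \<Longrightarrow> w - 1 \<in> W \<union> F \<union> {k0, k1} \<and> w + 1 \<in> W \<union> F \<union> {k0, k1}"
    and maj: "\<And>z. major G C z \<Longrightarrow> \<not> free W z"
  shows "clean (c ` W) (c ` F) (c k0) (c k1) (c w0) (c w0)"
proof (rule cleanI[OF W F step])
  fix v w assume v: "v \<in> set C" "v \<notin> c ` W" "v \<notin> c ` F" "v \<noteq> c k0" "v \<noteq> c k1" "adj G (c w0) v"
  have "v = c (w0 + 1) \<or> v = c (w0 - 1)" using nbr_c v by blast
  then show "\<not> adj G w v" using step[OF W(2)] v by auto
qed (use maj c_verts in auto)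

text \<open>The search walks along \<open>C\<close> from \<open>c p\<close>; this takes fewer than
  \<open>N\<close> rounds, and \<open>N\<close> is at most the number of vertices of
  \<open>G\<close>.\<close>

lemma nreach_interval:
  assumes "p \<le> k" "k \<le> q" "q - p < N" "\<And>k. p < k \<Longrightarrow> k < q \<Longrightarrow> A (c k)"
  shows "c k \<in> nreach G A {c p, c q} (card (verts G))"
proof (cases "k = q")
  case True
  have "{c p, c q} \<subseteq> nreach G A {c p, c q} (card (verts G))"
    using nreach_mono[of 0 "card (verts G)" G A "{c p, c q}"] by simp
  then show ?thesis using True by blast
next
  case False
  have "c (p + int n) \<in> nreach G A {c p, c q} n" if "p + int n < q" for n
    using that
  proof (induction n)
    case (Suc n)
    then have "c (p + int n) \<in> nreach G A {c p, c q} n" by simp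
    moreover have "adj G (c (p + int n)) (c (p + int (Suc n)))"
      using adj_c_succ[of "p + int n"] by (simp add: add.assoc add.commute[of 1])
    moreover have "A (c (p + int (Suc n)))" using Suc.prems assms(4) by simp
    ultimately show ?case by auto
  qed simp
  then have k: "c k \<in> nreach G A {c p, c q} (nat (k - p))"
    using assms False by (metis add.commute diff_add_cancel int_nat_eq diff_ge_0_iff_ge order_le_less)
  have le: "nat (k - p) \<le> card (verts G)"
  proof -
    have "length C = card (set C)" using C by (simp add: hole_def distinct_card)
    also have "\<dots> \<le> card (verts G)"
      using C G by (intro card_mono) (auto simp: hole_def simple_graph_def)
    finally show ?thesis using assms(2,3) unfolding N_def by linarith
  qed
  show ?thesis by (rule subsetD[OF nreach_mono[OF le] k])
qed

lemma clean_no_major: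
  assumes "\<And>z. \<not> major G C z"
  shows "\<exists>J E q0 q1 x y. clean J E q0 q1 x y"
proof -
  have "clean (c ` {0}) (c ` {1, - 1}) (c 1) (c 1) (c 0) (c 0)"
  proof (rule cleanI_covered[of "{0}" 0 "{1, - 1}" 1])
    show "int (card {0::int}) \<le> 8 * L - 16" using l4 by simp
    show "card {1, - 1 :: int} \<le> 12" by (simp add: card_insert_if)
    show "w - 1 \<in> {0} \<union> {1, - 1} \<union> {1, 1} \<and> w + 1 \<in> {0} \<union> {1, - 1} \<union> {1, 1}" if "w \<in> {0}" for w :: int
      using that by simp
  qed (use assms in simp_all)
  then show ?thesis by blast
qed

text \<open>\<open>W\<close> is the short arc outside the gap, widened by \<open>rho\<close> into
  the gap. A major vertex that \<open>W\<close> misses has all its neighbours on \<open>C\<close>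
  deep inside the gap, hence is adjacent to \<open>x\<close> by \<open>no_major_inside_gap\<close>
  and is found by searching the gap from both sides. All neighbours of \<open>x\<close> on
  \<open>C\<close> are guessed, so \<open>x\<close> can play the role of \<open>y\<close> as
  well.\<close>

lemma clean_long_gap:
  assumes x: "major G C x" and g: "gap x a b" and short: "N - (b - a) \<le> L + 1"
  shows "\<exists>J E q0 q1 x y. clean J E q0 q1 x y"
proof -
  define W where "W = {b - rho<..<a + N + rho}"
  have ba: "b - a \<le> N - 4" using major_gap[OF x g] .
  have xg: "mk x a" "mk x b" "a < b" "\<And>k. a < k \<Longrightarrow> k < b \<Longrightarrow> \<not> mk x k" using g unfolding gap_def by blast+
  have fr: "a + rho \<le> k \<and> k \<le> b - rho" if "free W z" "mk z k" "a < k" "k \<le> a + N" for z k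
  proof -
    have "k \<notin> W" using that unfolding free_def by blast
    moreover have "k + N \<notin> W" using that unfolding free_def by (metis mk_add(1))
    ultimately show ?thesis using that rho(1) ba unfolding W_def by auto
  qed
  have al: "allowed G (c ` W) x x (c k)" if "a + rho < k" "k < b - rho" for k
    unfolding allowed_def
  proof (intro conjI ballI)
    show "c k \<in> verts G" by (rule c_verts)
    have "\<not> mk x k" using xg(4)[of k] that rho(1) by auto
    then show "\<not> adj G x (c k)" "\<not> adj G x (c k)" by (simp_all add: mk_def)
    fix j assume "j \<in> c ` W"
    then obtain w where "b - rho < w" "w < a + N + rho" "j = c w" unfolding W_def by auto
    then show "\<not> adj G j (c k)" using adj_c[of w k] that by auto
  qed
  have eq: "c (a + N + rho) = c (a + rho)"
  proof -
    have "a + N + rho = a + rho + N" by simp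
    then show ?thesis by (simp only: c_add)
  qed
  have "clean (c ` W) (c ` {b - rho}) (c (a + N + rho)) (c (b - rho)) x x"
  proof (rule cleanI)
    show "finite W" "a + N \<in> W" unfolding W_def using rho(1) ba by auto
    have "int (card W) = a + N + rho - (b - rho) - 1" unfolding W_def using rho(1) ba by simp
    then show "int (card W) \<le> 8 * L - 16" using short rho l4 by (cases "l = 4") auto
    show "w - 1 \<in> W \<union> {b - rho} \<union> {a + N + rho, b - rho} \<and> w + 1 \<in> W \<union> {b - rho} \<union> {a + N + rho, b - rho}"
      if "w \<in> W" for w
    proof -
      have "b - rho < w" "w < a + N + rho" using that by (simp_all add: W_def)
      then show ?thesis unfolding W_def by (simp, presburger)
    qed
    show "finite {b - rho}" "b - rho \<in> {b - rho}" "card {b - rho} \<le> 12" by simp_all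
    show "x \<in> verts G" "x \<in> verts G" using x by (simp_all add: major_def)
  next
    fix z assume z: "major G C z" "free W z"
    have xz: "x \<noteq> z" using fr[OF z(2), of "a + N"] xg(1,3) ba rho(1) N4 by auto
    then have a: "adj G x z"
      using no_major_inside_gap[OF x z(1) _ xz g] fr[OF z(2)] by blast
    obtain k' where "mk z k'" using major_spread[OF z(1)] by blast
    then obtain k where k: "a + 1 \<le> k" "k < a + 1 + N" "mk z k"
      using shift_into[of "a + 1" k'] unfolding mk_def by metis
    have "a + rho \<le> k \<and> k \<le> b - rho" using fr[OF z(2) k(3)] k by simp
    then have "c k \<in> nreach G (allowed G (c ` W) x x) {c (a + rho), c (b - rho)} (card (verts G))"
      using al ba rho(1) by (intro nreach_interval) auto
    then show "adj G x z \<and> adj G x z \<and>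
      (\<exists>w\<in>nreach G (allowed G (c ` W) x x) {c (a + N + rho), c (b - rho)} (card (verts G)). adj G w z)"
      using a k(3) adj_commute[OF G, of z] unfolding mk_def eq by blast
  next
    fix v w assume v: "v \<in> set C" "v \<notin> c ` W" "adj G x v"
    obtain k where k: "a + 1 \<le> k" "k < a + 1 + N" "c k = v" using in_C[OF v(1)] by blast
    have "mk x k" using v(3) k(3) by (simp add: mk_def)
    then have "b \<le> k" using xg(4)[of k] k(1) by force
    then have "k \<in> W" using k(2) rho(1) unfolding W_def by auto
    then show "\<not> adj G w v" using v(2) k(3) by blast
  qed
  then show ?thesis by blast
qed

end

section \<open>Two overlapping longest pseudo-gaps\<close>

context shortest_hole begin

lemma gap_from:
  assumes "mk z k" obtains j where "gap z k j"
proof -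
  have "mk z (k + N)" using assms by simp
  then obtain j where "k + 1 \<le> j" "mk z j" "\<And>i. k + 1 \<le> i \<Longrightarrow> i < j \<Longrightarrow> \<not> mk z i"
    using next_mark[of z "k + N" "k + 1"] N4 by auto
  then have "gap z k j" using assms unfolding gap_def by auto
  then show ?thesis using that by blast
qed

lemma gap_around:
  assumes "mk z k" "\<not> mk z a" obtains e f where "gap z e f" "e < a" "a < f"
proof -
  obtain k' where k': "a - N \<le> k'" "k' < a - N + N" "c k' = c k" using shift_into by blast
  have "mk z k'" using assms(1) k'(3) by (simp add: mk_def)
  then obtain e where e: "e \<le> a" "mk z e" "\<And>i. e < i \<Longrightarrow> i \<le> a \<Longrightarrow> \<not> mk z i"
    using prev_mark[of z k' a] k'(2) by auto
  obtain f where f: "gap z e f" using gap_from[OF e(2)] by blast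
  have "e \<noteq> a" using e(2) assms(2) by metis
  moreover have "f \<noteq> a" "\<not> f < a" using f e(3)[of f] assms(2) unfolding gap_def by auto
  ultimately show ?thesis using that f e(1) by auto
qed

lemma longest_pgap:
  assumes "M x0 P0" and M: "\<And>x P. M x P \<Longrightarrow> major G C x \<and> pgap x P"
  shows "\<exists>x P. M x P \<and> (\<forall>y Q. M y Q \<longrightarrow> hi Q - lo Q \<le> hi P - lo P)"
proof -
  define f where "f = (\<lambda>(x :: 'a, P). nat (hi P - lo P))"
  have "\<forall>p. (\<lambda>(x, P). M x P) p \<longrightarrow> f p < nat N + 1"
  proof (clarify)
    fix x P assume "M x P"
    then have "hi P \<le> lo P + N" using M pgap_span by blast
    then show "f (x, P) < nat N + 1" by (simp add: f_def)
  qed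
  then obtain p where p: "(\<lambda>(x, P). M x P) p" "\<forall>q. (\<lambda>(x, P). M x P) q \<longrightarrow> f q \<le> f p"
    using ex_has_greatest_nat[of "\<lambda>(x, P). M x P" "(x0, P0)" f "nat N + 1"] assms(1) by auto
  obtain x P where xP: "p = (x, P)" by (meson surj_pair)
  have "hi Q - lo Q \<le> hi P - lo P" if q: "M y Q" for y Q
  proof -
    have "nat (hi Q - lo Q) \<le> nat (hi P - lo P)" using p(2) q unfolding xP f_def by auto
    moreover have "lo P < hi P" "lo Q < hi Q" using M p(1) q pgap_marks xP by auto
    ultimately show ?thesis by linarith
  qed
  then show ?thesis using p(1) unfolding xP by auto
qed

lemma cov_away:
  assumes "pgap v P" "(s, t) \<in> set P" "w \<in> cov P"
  shows "w < s + rho \<or> t - rho < w"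
  using assms(1)
proof (cases rule: pgap_cases)
  case (one a b)
  then show ?thesis using assms(2,3) rho(1) by (auto simp: cov_def)
next
  case (two a h b)
  then have "a < h" "h + 1 < b" by (auto simp: gap_def)
  moreover have "w = a - 1 \<or> w = b + 1 \<or> a \<le> w \<and> w < a + rho \<or> h - rho < w \<and> w \<le> h \<or>
      h + 1 \<le> w \<and> w < h + 1 + rho \<or> b - rho < w \<and> w \<le> b"
    using assms(3) unfolding two(1) cov_def by auto
  moreover have "s = a \<and> t = h \<or> s = h + 1 \<and> t = b" using assms(2) two(1) by auto
  ultimately show ?thesis using rho(1) by linarith
qed

lemma cov_range:
  assumes "pgap v P" "w \<in> cov P"
  shows "lo P - rho \<le> w" "w \<le> hi P + rho"
proof -
  from assms(1) have "lo P - rho \<le> w \<and> w \<le> hi P + rho"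
  proof (cases rule: pgap_cases)
    case (one a b)
    then have "a < b" by (simp add: gap_def)
    moreover have "w = a - 1 \<or> w = b + 1 \<or> a \<le> w \<and> w < a + rho \<or> b - rho < w \<and> w \<le> b"
      using assms(2) unfolding one(1) cov_def by auto
    ultimately show ?thesis unfolding one(1) lo_hi using rho(1) by linarith
  next
    case (two a h b)
    then have "a < h" "h + 1 < b" by (auto simp: gap_def)
    moreover have "w = a - 1 \<or> w = b + 1 \<or> a \<le> w \<and> w < a + rho \<or> h - rho < w \<and> w \<le> h \<or>
        h + 1 \<le> w \<and> w < h + 1 + rho \<or> b - rho < w \<and> w \<le> b"
      using assms(2) unfolding two(1) cov_def by auto
    ultimately show ?thesis unfolding two(1) lo_hi using rho(1) by linarith
  qed
  then show "lo P - rho \<le> w" "w \<le> hi P + rho" by auto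
qed

lemma cov_ends: "pgap v P \<Longrightarrow> {lo P - 1, lo P, hi P, hi P + 1} \<subseteq> cov P"
proof -
  assume P: "pgap v P"
  obtain i j where "(lo P, j) \<in> set P" "(i, hi P) \<in> set P" using P by (cases rule: pgap_cases) auto
  then have "{lo P - 1..<lo P + rho} \<subseteq> cov P" "{hi P - rho<..hi P + 1} \<subseteq> cov P"
    using cov_piece[OF P] by blast+
  moreover have "lo P \<in> {lo P - 1..<lo P + rho}" "hi P \<in> {hi P - rho<..hi P + 1}" using rho(1) by auto
  ultimately have "lo P \<in> cov P" "hi P \<in> cov P" by blast+
  then show ?thesis by (simp add: cov_def)
qed

text \<open>\<open>P\<close> is a longest pseudo-gap of all major vertices. Among those missed by
  \<open>cov P\<close>, \<open>K\<close> is a longest one that runs across the left end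
  \<open>a\<close> of \<open>P\<close>. A gap \<open>(s, b1)\<close> of \<open>P\<close> and a gap
  \<open>(e, t)\<close> of \<open>K\<close> overlap from \<open>s\<close> to \<open>t\<close>.
  Parity relative to \<open>a\<close> forces every major vertex missed by both covers to have a
  neighbour in this overlap, and once the margins there are widened \<open>no_reach\<close> makes
  the search safe.\<close>

lemma clean_spread:
  assumes x0: "major G C x0" and compl: "\<And>x i j. major G C x \<Longrightarrow> gap x i j \<Longrightarrow> L + 2 \<le> N - (j - i)"
  shows "\<exists>J E q0 q1 x y. clean J E q0 q1 x y"
proof -
  define R where "R = L - 1"
  have R: "3 \<le> R" "rho < R" "R - rho \<le> 2" using l4 rho by (auto simp: R_def rho_def)
  obtain k0 where "mk x0 k0" using major_spread[OF x0] by blast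
  then obtain j0 where "gap x0 k0 j0" using gap_from by blast
  then have "pgap x0 [(k0, j0)]" by (simp add: pgap_def)
  then obtain x P where x: "major G C x" "pgap x P"
    and longest: "\<And>y Q. major G C y \<Longrightarrow> pgap y Q \<Longrightarrow> hi Q - lo Q \<le> hi P - lo P"
    using longest_pgap[of "\<lambda>x P. major G C x \<and> pgap x P" x0 "[(k0, j0)]"] x0 by auto
  define a b where "a = lo P" and "b = hi P"
  have mab: "mk x a" "mk x b" "a < b" using pgap_marks[OF x(2)] by (simp_all add: a_def b_def)
  have stage1: "adj G x z \<and> (\<exists>k. a < k \<and> k < b \<and> mk z k)" if z: "major G C z" "free (cov P) z" for z
  proof -
    have "False" if "pgap z Q" "lo Q < lo P" "hi P < hi Q" for Q
      using longest[OF z(1) that(1)] that(2,3) by linarith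
    then show ?thesis
      using free_major_adjacent[OF x(1) z(1) x(2) _ compl[OF x(1)] z(2)] unfolding a_def b_def by blast
  qed
  have acov: "a \<in> cov P" using cov_ends[OF x(2)] unfolding a_def by simp
  have cP: "finite (cov P)" "int (card (cov P)) \<le> 4 * L - 10" "finite (bd P)" "card (bd P) \<le> 6"
    using card_cov[OF x(2)] card_bd[OF x(2)] by auto
  have bdP: "a - 2 \<in> bd P" by (simp add: bd_def a_def)
  show ?thesis
  proof (cases "\<exists>z. major G C z \<and> free (cov P) z")
    case False
    have "clean (c ` cov P) (c ` bd P) (c a) (c a) (c a) (c a)"
    proof (rule cleanI_covered[OF cP(1) acov _ cP(3) bdP])
      show "w - 1 \<in> cov P \<union> bd P \<union> {a, a} \<and> w + 1 \<in> cov P \<union> bd P \<union> {a, a}" if "w \<in> cov P" for w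
        using cov_step[OF x(2) that] by blast
    qed (use cP l4 False in auto)
    then show ?thesis by blast
  next
    case True
    then obtain z0 where z0: "major G C z0" "free (cov P) z0" by blast
    \<comment> \<open>The condition \<open>lo K < a \<and> a < hi K\<close> passes to every larger
      pseudo-gap containing \<open>K\<close>. Hence a longest such \<open>K\<close> is
      inclusion-maximal among all pseudo-gaps of the major vertices missed by
      \<open>cov P\<close>.\<close>
    define M where "M y K \<longleftrightarrow> major G C y \<and> free (cov P) y \<and> pgap y K \<and> lo K < a \<and> a < hi K" for y K
    have na: "\<not> mk z a" if "free (cov P) z" for z using that acov by (auto simp: free_def)
    obtain k1 where "mk z0 k1" using major_spread[OF z0(1)] by blast
    then obtain e0 f0 where "gap z0 e0 f0" "e0 < a" "a < f0" using gap_around na[OF z0(2)] by blast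
    then have "M z0 [(e0, f0)]" using z0 by (simp add: M_def pgap_def)
    then obtain y K where yK: "M y K" and longK: "\<And>z Q. M z Q \<Longrightarrow> hi Q - lo Q \<le> hi K - lo K"
      using longest_pgap[of M z0 "[(e0, f0)]"] unfolding M_def by auto
    have y: "major G C y" "free (cov P) y" "pgap y K" "lo K < a" "a < hi K" using yK by (simp_all add: M_def)
    obtain e t where et: "(e, t) \<in> set K" "e < a" "a < t"
      using pgap_inside[OF y(3,4,5)] na[OF y(2)] by blast
    have gy: "gap y e t" "lo K \<le> e" "t \<le> hi K" using pgap_piece[OF y(3) et(1)] by auto
    \<comment> \<open>By \<open>stage1\<close> the vertex \<open>y\<close> has a mark between
      \<open>a\<close> and \<open>b\<close>, which its gap cannot pass over.\<close>
    have tb: "t < b"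
    proof -
      obtain k where k: "a < k" "k < b" "mk y k" using stage1[OF y(1,2)] by blast
      moreover have "e < k" using k(1) et(2) by linarith
      ultimately have "\<not> k < t" using gy(1) unfolding gap_def by blast
      then show ?thesis using k(2) by simp
    qed
    have mt: "mk y t" using gy(1) by (simp add: gap_def)
    have piece: "\<exists>i j. (i, j) \<in> set P \<and> i + rho \<le> k \<and> k \<le> j - rho" if k: "a < k" "k < b" "mk z k" "free (cov P) z" for z k
    proof -
      have kc: "k \<notin> cov P" using k(3,4) by (auto simp: free_def)
      have "\<exists>i j. (i, j) \<in> set P \<and> i < k \<and> k < j"
        using x(2)
      proof (cases rule: pgap_cases)
        case (one a' b')
        then show ?thesis using k(1,2) by (auto simp: a_def b_def)
      next
        case (two a' h b')
        have "(a', h) \<in> set P" "(h + 1, b') \<in> set P" using two(1) by auto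
        then have "h \<in> cov P" "h + 1 \<in> cov P"
          using cov_piece(2)[OF x(2), of a' h] rho(1) by auto
        then have "k \<noteq> h" "k \<noteq> h + 1" using kc by auto
        moreover have "a' < k" "k < b'" using two(1) k(1,2) by (simp_all add: a_def b_def)
        ultimately have "a' < k \<and> k < h \<or> h + 1 < k \<and> k < b'" by linarith
        then show ?thesis using two(1) by auto
      qed
      then obtain i j where ij: "(i, j) \<in> set P" "i < k" "k < j" by blast
      have "\<not> (i - 1 \<le> k \<and> k < i + rho)" "\<not> (j - rho < k \<and> k \<le> j + 1)"
        using cov_piece[OF x(2) ij(1)] kc by auto
      then have "i + rho \<le> k" "k \<le> j - rho" using ij by linarith+
      then show ?thesis using ij(1) by blast
    qed
    obtain s b1 where sb: "(s, b1) \<in> set P" "s + rho \<le> t" "t \<le> b1 - rho"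
      using piece[OF et(3) tb mt y(2)] by blast
    have gx: "gap x s b1" "a \<le> s" "b1 \<le> b" using pgap_piece[OF x(2) sb(1)] by (auto simp: a_def b_def)
    have rest: "P = [(s, b1)] \<and> s = a \<or> s = a \<and> (\<exists>b2. P = [(a, b1), (b1 + 1, b2)]) \<or>
        (\<exists>h. s = h + 1 \<and> P = [(a, h), (s, b1)] \<and> gap x a h \<and> odd (h - a))"
      using x(2)
    proof (cases rule: pgap_cases)
      case (one a' b')
      then show ?thesis using sb(1) by (auto simp: a_def)
    next
      case (two a' h b')
      have "odd (h - a')" using gap_odd[OF major_off[OF x(1)] two(3)] compl[OF x(1) two(3)] two(5) l4 by linarith
      then show ?thesis using sb(1) two by (auto simp: a_def)
    qed
    have ord: "e < s" "t < b1" "s < t" using et(2) gx(2) sb rho(1) by linarith+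
    have free_end: "\<not> mk z k" if "free (cov P) z" "k \<in> {a - 1, a, s - 1, s, b, b1}" for z k
    proof -
      have "a - 1 \<in> cov P" "b \<in> cov P"
        using cov_ends[OF x(2)] unfolding a_def b_def by simp_all
      moreover have "s - 1 \<in> cov P" "s \<in> cov P" "b1 \<in> cov P" using cov_piece[OF x(2) sb(1)] rho(1) by auto
      ultimately show ?thesis using that acov unfolding free_def by blast
    qed
    \<comment> \<open>The right end is even relative to the start \<open>i\<close> of the gap of
      \<open>P\<close> containing it, by the hole through \<open>x\<close> and \<open>z\<close>. If
      \<open>i\<close> starts the second gap of \<open>P\<close>, then \<open>i - a\<close> is the
      odd length of the first gap plus one. The left end follows because the gap of \<open>z\<close>
      is odd.\<close>
    have par: "even (t' - a) \<and> odd (a - e') \<and> t' - e' \<le> N - L - 2 \<and> L - 3 \<le> t' - a"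
      if z: "major G C z" "free (cov P) z" "gap z e' t'" "e' < a" "a < t'" "t' < b" for z e' t'
    proof -
      have zx: "adj G x z" using stage1[OF z(1,2)] by blast
      have mz: "mk z t'" "mk z e'" using z(3) by (auto simp: gap_def)
      obtain i j where ij: "(i, j) \<in> set P" "i + rho \<le> t'" "t' \<le> j - rho" using piece[OF z(5,6) mz(1) z(2)] by blast
      have g: "gap x i j" "a \<le> i" using pgap_piece[OF x(2) ij(1)] by (auto simp: a_def)
      have lk: "link x z i t'"
        using g ij z(3,4) rho(1) by (intro linkI1) (auto simp: gap_def)
      have ev: "even (t' - i)"
        by (rule link_even[OF major_off[OF x(1)] major_off[OF z(1)] zx lk])
          (use ij rho(1,2) compl[OF x(1) g(1)] l4 in linarith)+
      have ea: "even (i - a)"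
      proof -
        have "i = a \<or> (\<exists>h. i = h + 1 \<and> gap x a h \<and> L - 2 \<le> h - a)"
          using x(2) ij(1) unfolding a_def by (auto elim!: pgap_cases)
        then show ?thesis
        proof (elim disjE exE conjE)
          fix h assume h: "i = h + 1" "gap x a h" "L - 2 \<le> h - a"
          then have "odd (h - a)"
            using gap_odd[OF major_off[OF x(1)] h(2)] compl[OF x(1) h(2)] l4 by linarith
          then show ?thesis using h(1) by presburger
        qed simp
      qed
      have c1: "t' - e' \<le> N - L - 2" using compl[OF z(1,3)] by linarith
      have c2: "rho \<le> t' - a" using ij g(2) by linarith
      have c3: "e' \<noteq> a - 1" using free_end[OF z(2), of "a - 1"] mz(2) by auto
      have c4: "L - 2 \<le> t' - e'" using c2 c3 z(4) rho(2) by linarith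
      have "odd (t' - e')"
        by (rule gap_odd[OF major_off[OF z(1)] z(3) c4]) (use c1 l4 in linarith)
      moreover have "even (t' - a)" using ev ea by presburger
      ultimately have "odd (a - e')" by presburger
      then show ?thesis using \<open>even (t' - a)\<close> c1 c2 rho(2) by auto
    qed
    \<comment> \<open>Near \<open>s\<close> and \<open>t\<close> the margin \<open>rho\<close> is
      widened to \<open>R = l - 1\<close>, as \<open>no_prism_path\<close> requires. This adds at
      most two positions on either side, so the total is at most
      \<open>2 * (4 * l - 10) + 4 = 8 * l - 16\<close>.\<close>
    define W where "W = cov P \<union> cov K \<union> ({s + rho..<s + R} \<union> {t - R<..t - rho})"
    have Ws: "k \<in> W" if "s - 1 \<le> k" "k < s + R" for k
      using cov_piece(1)[OF x(2) sb(1)] that unfolding W_def by (cases "k < s + rho") auto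
    have Wt: "k \<in> W" if "t - R < k" "k \<le> t + 1" for k
      using cov_piece(2)[OF y(3) et(1)] that unfolding W_def by (cases "t - rho < k") auto
    have Wb: "k \<in> W" if "b1 - 1 \<le> k" "k \<le> b1 + 1" for k
    proof -
      have "k \<in> cov P" using cov_piece(2)[OF x(2) sb(1)] that rho(1) by auto
      then show ?thesis by (simp add: W_def)
    qed
    have We: "e - 1 \<in> W" "e \<in> W"
    proof -
      have "e - 1 \<in> cov K" "e \<in> cov K" using cov_piece(1)[OF y(3) et(1)] rho(1) by auto
      then show "e - 1 \<in> W" "e \<in> W" by (simp_all add: W_def)
    qed
    have cK: "finite (cov K)" "int (card (cov K)) \<le> 4 * L - 10" "finite (bd K)" "card (bd K) \<le> 6"
      using card_cov[OF y(3)] card_bd[OF y(3)] by auto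
    have cW: "finite W" "int (card W) \<le> 8 * L - 16"
    proof -
      have 1: "card W \<le> card (cov P) + card (cov K) + (card {s + rho..<s + R} + card {t - R<..t - rho})"
        unfolding W_def by (intro order.trans[OF card_Un_le] add_mono order.refl card_Un_le)
      have 2: "int (card {s + rho..<s + R}) = R - rho" "int (card {t - R<..t - rho}) = R - rho"
        using R by simp_all
      have "int (card W) \<le> int (card (cov P)) + int (card (cov K)) + (R - rho + (R - rho))"
      proof -
        have "int (card W) \<le> int (card (cov P) + card (cov K) + (card {s + rho..<s + R} + card {t - R<..t - rho}))"
          using 1 by (simp only: of_nat_le_iff)
        then show ?thesis unfolding of_nat_add 2 .
      qed
      then show "int (card W) \<le> 8 * L - 16" using cP(2) cK(2) R(3) by linarith
      show "finite W" using cP cK by (simp add: W_def)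
    qed
    have cF: "finite (bd P \<union> bd K)" "a - 2 \<in> bd P \<union> bd K" "card (bd P \<union> bd K) \<le> 12"
      using cP cK bdP card_Un_le[of "bd P" "bd K"] by auto
    have step: "w - 1 \<in> W \<union> (bd P \<union> bd K) \<union> {s + R, t - R} \<and> w + 1 \<in> W \<union> (bd P \<union> bd K) \<union> {s + R, t - R}"
      if w: "w \<in> W" for w
    proof -
      consider "w \<in> cov P" | "w \<in> cov K" | "s + rho \<le> w" "w < s + R" | "t - R < w" "w \<le> t - rho"
        using w unfolding W_def by auto
      then show ?thesis
      proof cases
        case 1 then show ?thesis using cov_step[OF x(2) 1] unfolding W_def by blast
      next
        case 2 then show ?thesis using cov_step[OF y(3) 2] unfolding W_def by blast
      next
        case 3 then show ?thesis using Ws[of "w - 1"] Ws[of "w + 1"] rho(1) by (cases "w + 1 = s + R") auto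
      next
        case 4 then show ?thesis using Wt[of "w - 1"] Wt[of "w + 1"] rho(1) by (cases "w - 1 = t - R") auto
      qed
    qed
    have acW: "a \<in> W" using acov by (simp add: W_def)
    have claim: "adj G x z \<and> adj G y z \<and> (\<exists>k. s + R \<le> k \<and> k \<le> t - R \<and> mk z k)"
      if z: "major G C z" "free W z" for z
    proof -
      have fP: "free (cov P) z" and fK: "free (cov K) z" using z(2) unfolding free_def W_def by blast+
      have fW: "\<not> mk z k" if "k \<in> W" for k using z(2) that unfolding free_def by blast
      have max: "False" if Q: "pgap z Q" "lo Q < lo K" "hi K < hi Q" for Q
      proof -
        have "M z Q" using z(1) fP Q y(4,5) unfolding M_def by auto
        then show False using longK Q(2,3) by fastforce
      qed
      have "adj G y z \<and> (\<exists>k. lo K < k \<and> k < hi K \<and> mk z k)"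
        using max free_major_adjacent[OF y(1) z(1) y(3) _ compl[OF y(1)] fK] by blast
      then have yz: "adj G y z" "\<exists>k. lo K < k \<and> k < hi K \<and> mk z k" by blast+
      have xz: "adj G x z" and "\<exists>k. a < k \<and> k < b \<and> mk z k" using stage1[OF z(1) fP] by blast+
      then obtain kb where kb: "a < kb" "kb < b" "mk z kb" by blast
      obtain ez tz where gz: "gap z ez tz" "ez < a" "a < tz" using gap_around[OF kb(3) na[OF fP]] by blast
      have zm: "mk z ez" "mk z tz" "\<And>k. ez < k \<Longrightarrow> k < tz \<Longrightarrow> \<not> mk z k" using gz(1) unfolding gap_def by blast+
      have ym: "mk y e" "mk y t" "\<And>k. e < k \<Longrightarrow> k < t \<Longrightarrow> \<not> mk y k" using gy(1) unfolding gap_def by blast+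
      have tzb: "tz < b" using zm(3)[of kb] kb gz(2) by force
      have pz: "even (tz - a)" "odd (a - ez)" using par[OF z(1) fP gz tzb] by auto
      have py: "even (t - a)" "odd (a - e)" "t - e \<le> N - L - 2" "L - 3 \<le> t - a"
        using par[OF y(1,2) gy(1) et(2,3) tb] by auto
      have zt: "\<not> mk z t" "\<not> mk z e" using fW Wt[of t] We R by auto
      note off = major_off[OF x(1)] major_off[OF y(1)] major_off[OF z(1)]
      \<comment> \<open>If \<open>z\<close> has no mark there, its gap around \<open>a\<close> ends
        before \<open>s\<close> or after \<open>t\<close>. In each position of its two ends relative
        to the gaps of \<open>x\<close> and \<open>y\<close>, either some link has a parity that
        contradicts \<open>par\<close>, or the gap violates the maximality of
        \<open>K\<close>.\<close>
      have "\<exists>k. s < k \<and> k < t \<and> mk z k"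
      proof (rule ccontr)
        assume no: "\<not> ?thesis"
        have "tz \<noteq> t" using zm(2) zt by auto
        then consider "tz < t" | "t < tz" by linarith
        then show False
        proof cases
          case 1
          have "tz \<noteq> s" "tz \<noteq> s - 1" using zm(2) free_end[OF fP, of s] free_end[OF fP, of "s - 1"] by auto
          then have tzs: "tz < s - 1" using no zm(2) 1 by force
          \<comment> \<open>An end strictly between \<open>a\<close> and \<open>s\<close> is
            possible only if \<open>s\<close> starts the second gap of \<open>P\<close>.\<close>
          then obtain h where h: "s = h + 1" "P = [(a, h), (s, b1)]" "gap x a h" "odd (h - a)"
            using rest gz(3) by auto
          obtain m where m: "tz \<le> m" "m \<le> h" "mk z m" "\<And>k. m < k \<Longrightarrow> k \<le> h \<Longrightarrow> \<not> mk z k"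
            using prev_mark[OF zm(2), of h] tzs h(1) by auto
          have mh: "m \<le> h - rho"
          proof (rule ccontr)
            assume "\<not> m \<le> h - rho"
            then have "m \<in> cov P" using cov_piece(2)[OF x(2), of a h] h(2) m(2) by auto
            then show False using fP m(3) unfolding free_def by blast
          qed
          have "link x z m h" using m gz(3) h(3) unfolding gap_def by (intro linkI2) auto
          then have 2: "even (h - m)"
            by (rule link_even[OF off(1,3) xz])
              (use mh rho(1,2) gz(3) m(1) compl[OF x(1) h(3)] l4 in linarith)+
          have "link y z m t"
          proof (rule linkI2)
            show "\<not> mk z k" if "m < k" "k \<le> t" for k
            proof -
              have "k \<le> h \<or> k = s \<or> s < k \<and> k < t \<or> k = t" using that(2) h(1) by presburger
              then show ?thesis using m(4)[OF that(1)] free_end[OF fP, of s] no zt by auto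
            qed
            show "\<not> mk y k" if "m \<le> k" "k < t" for k using ym(3)[of k] that m(1) gz(3) et(2) by auto
          qed (use m ym h ord in auto)
          then have "even (t - m)"
            by (rule link_even[OF off(2,3) yz(1)])
              (use mh rho(1,2) gz(3) m(1) h(1) ord py(3) et(2) l4 in linarith)+
          then show False using 2 h(4) py(1) by presburger
        next
          case 2
          have "ez \<noteq> e" using zm(1) zt by auto
          then consider "e < ez" | "ez < e" by linarith
          then show False
          proof cases
            case 1
            have "link y z ez t" using zm ym 1 2 gz(2) et(3) by (intro linkI2) auto
            then have "even (t - ez)"
              by (rule link_even[OF off(2,3) yz(1)]) (use gz(2) py(3,4) 1 l4 in linarith)+
            then show False using py(1) pz(2) by presburger
          next
            case ez: 2
            show False
              using y(3)
            proof (cases rule: pgap_cases)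
              case (one u v)
              then have "pgap z [(ez, tz)]" using gz(1) by (simp add: pgap_def)
              then show False using max[of "[(ez, tz)]"] one et(1) ez 2 by auto
            next
              \<comment> \<open>The gap of \<open>z\<close> swallows one gap of \<open>K\<close>,
                but by \<open>yz\<close> it ends inside the other. The link from that end to the
                middle edge has the wrong parity.\<close>
              case (two u h v)
              obtain k where k: "u < k" "k < v" "mk z k" using yz(2) two(1) by auto
              consider "e = u" "t = h" | "e = h + 1" "t = v" using et(1) two(1) by auto
              then show False
              proof cases
                case uh: 1
                have "tz \<le> k" using zm(3)[of k] k ez uh(1) by force
                have tzr: "h + 1 + rho \<le> tz"
                proof (rule ccontr)
                  assume "\<not> h + 1 + rho \<le> tz"
                  then have "tz \<in> cov K" using cov_piece(1)[OF y(3), of "h + 1" v] two(1) 2 uh(2) by auto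
                  then show False using fK zm(2) unfolding free_def by blast
                qed
                have "link y z (h + 1) tz"
                  using two(4) zm \<open>tz \<le> k\<close> k(2) tzr rho(1) uh ez ord(1,3) unfolding gap_def by (intro linkI1) auto
                then have "even (tz - (h + 1))"
                  by (rule link_even[OF off(2,3) yz(1)])
                    (use tzr rho(1,2) \<open>tz \<le> k\<close> k(2) compl[OF y(1) two(4)] l4 in linarith)+
                then show False using pz(1) py(1) uh(2) by presburger
              next
                case hv: 2
                have "k \<le> ez" using zm(3)[of k] k 2 hv(2) by force
                have ezr: "ez \<le> h - rho"
                proof (rule ccontr)
                  assume "\<not> ez \<le> h - rho"
                  then have "ez \<in> cov K" using cov_piece(2)[OF y(3), of u h] two(1) ez hv(1) by auto
                  then show False using fK zm(1) unfolding free_def by blast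
                qed
                have "link y z ez h"
                  using two(3) zm \<open>k \<le> ez\<close> k(1) ezr rho(1) hv ez 2 ord(1,3) unfolding gap_def by (intro linkI2) auto
                then have "even (h - ez)"
                  by (rule link_even[OF off(2,3) yz(1)])
                    (use ezr rho(1,2) \<open>k \<le> ez\<close> k(1) compl[OF y(1) two(3)] l4 in linarith)+
                then show False using pz(2) py(2) hv(1) by presburger
              qed
            qed
          qed
        qed
      qed
      then obtain k where k: "s < k" "k < t" "mk z k" by blast
      have "k \<notin> W" using fW k(3) by blast
      then have "s + R \<le> k" "k \<le> t - R" using Ws[of k] Wt[of k] k by force+
      then show ?thesis using xz yz(1) k(3) by blast
    qed
    show ?thesis
    proof (cases "s + R \<le> t - R")
      \<comment> \<open>No position is left between the widened margins, so by \<open>claim\<close>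
        every major vertex has a mark in \<open>W\<close>.\<close>
      case False
      have "clean (c ` W) (c ` (bd P \<union> bd K)) (c (s + R)) (c (t - R)) (c a) (c a)"
        by (rule cleanI_covered[OF cW(1) acW cW(2) cF step]) (use claim False in force)+
      then show ?thesis by blast
    next
      case True
      have xk: "\<not> mk x k" "\<not> mk y k" if "s < k" "k < t" for k
        using gx(1) gy(1) ord that unfolding gap_def by auto
      have spanP: "b \<le> a + N" and spanK: "hi K \<le> lo K + N"
        using pgap_span[OF x] pgap_span[OF y(1,3)] by (simp_all add: a_def b_def)
      have len: "t - s < N" using par[OF y(1,2) gy(1) et(2,3) tb] ord(1) l4 by linarith
      \<comment> \<open>The covers may reach around \<open>C\<close>; the bounds on the spans of
        \<open>P\<close> and \<open>K\<close> prevent them from wrapping into the searched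
        stretch.\<close>
      have sep: "c k \<noteq> c w" if k: "s + R \<le> k" "k \<le> t - R" and w: "w \<in> W" for k w
      proof -
        have "(w < s + R \<or> t - R < w) \<and> \<bar>k - w\<bar> < N"
        proof -
          consider "w \<in> cov P" | "w \<in> cov K" | "s + rho \<le> w" "w < s + R" | "t - R < w" "w \<le> t - rho"
            using w unfolding W_def by auto
          then show ?thesis
          proof cases
            case 1
            have "a - rho \<le> w" "w \<le> b + rho" using cov_range[OF x(2) 1] by (simp_all add: a_def b_def)
            then show ?thesis using cov_away[OF x(2) sb(1) 1] sb(3) k spanP gx(2,3) R ord by linarith
          next
            case 2
            have "lo K - rho \<le> w" "w \<le> hi K + rho" using cov_range[OF y(3) 2] by simp_all
            then show ?thesis using cov_away[OF y(3) et(1) 2] k spanK gy(2,3) R ord by linarith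
          next
            case 3 then show ?thesis using k ord len R rho(1) by linarith
          next
            case 4 then show ?thesis using k ord len R rho(1) by linarith
          qed
        qed
        then show ?thesis using c_window[of k w] k by auto
      qed
      have al: "allowed G (c ` W) x y (c k)" if k: "s + R < k" "k < t - R" for k
        unfolding allowed_def
      proof (intro conjI ballI)
        show "c k \<in> verts G" by (rule c_verts)
        show "\<not> adj G x (c k)" "\<not> adj G y (c k)" using xk[of k] k R by (simp_all add: mk_def)
        fix j assume "j \<in> c ` W"
        then obtain w where w: "w \<in> W" "j = c w" by blast
        show "\<not> adj G j (c k)"
        proof
          assume "adj G j (c k)"
          then have "c w = c (k + 1) \<or> c w = c (k - 1)"
            using nbr_c[of k "c w"] c_in adj_commute[OF G, of j] w(2) by simp
          then show False using sep[of "k + 1" w] sep[of "k - 1" w] w(1) k by auto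
        qed
      qed
      have xy: "adj G x y" using stage1[OF y(1,2)] by blast
      have "clean (c ` W) (c ` (bd P \<union> bd K)) (c (s + R)) (c (t - R)) x y"
      proof (rule cleanI[OF cW(1) acW cW(2) cF step])
        show "x \<in> verts G" "y \<in> verts G" using x(1) y(1) by (simp_all add: major_def)
      next
        fix z assume z: "major G C z" "free W z"
        obtain k where k: "s + R \<le> k" "k \<le> t - R" "mk z k" using claim[OF z] by blast
        have "c k \<in> nreach G (allowed G (c ` W) x y) {c (s + R), c (t - R)} (card (verts G))"
          using k al len ord R by (intro nreach_interval) auto
        moreover have "adj G (c k) z" using k(3) adj_commute[OF G, of z] unfolding mk_def by blast
        ultimately show "adj G x z \<and> adj G y z \<and>
          (\<exists>w\<in>nreach G (allowed G (c ` W) x y) {c (s + R), c (t - R)} (card (verts G)). adj G w z)"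
          using claim[OF z] by blast
      next
        fix v w
        assume v: "v \<in> set C" "v \<notin> c ` W" "adj G x v" "adj G y v"
          and w: "w \<in> reach G (allowed G (c ` W) x y) {c (s + R), c (t - R)}"
        \<comment> \<open>Both gaps and the guessed positions at their ends are excluded, so a
          common neighbour of \<open>x\<close> and \<open>y\<close> lies beyond
          \<open>b1 + 1\<close> and before \<open>e + N - 1\<close>, as \<open>no_reach\<close>
          requires.\<close>
        obtain p where p: "s \<le> p" "p < s + N" "c p = v" using in_C[OF v(1)] by blast
        have pW: "p \<notin> W" "p - N \<notin> W" using v(2) p(3) by (metis imageI c_add(2))+
        have mp: "mk x p" "mk y p" using v(3,4) p(3) by (simp_all add: mk_def)
        have "p \<noteq> s" using Ws[of s] pW(1) R by auto
        then have "b1 \<le> p" using gx(1) mp(1) p(1) unfolding gap_def by force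
        then have b1p: "b1 + 2 \<le> p" using Wb[of p] pW(1) by force
        have "p \<noteq> s - 1 + N" using Ws[of "s - 1"] pW(2) R by auto
        then have p2: "p \<le> s + N - 2" using p(2) by linarith
        have ye: "mk y (p - N)" using mp(2) by simp
        have "p - N \<le> e"
        proof (rule ccontr)
          assume "\<not> p - N \<le> e"
          then have "e < p - N" "p - N < t" using p2 ord by linarith+
          then show False using gy(1) ye unfolding gap_def by blast
        qed
        moreover have "p - N \<noteq> e" "p - N \<noteq> e - 1" using We pW(2) by auto
        ultimately have p3: "p + 2 \<le> e + N" by linarith
        have "\<not> adj G w (c p)"
        proof (rule no_reach[OF major_off[OF x(1)] major_off[OF y(1)] xy gx(1) gy(1), of "c ` W" p w, folded R_def])
          show "\<not> major G C u" if u: "allowed G (c ` W) x y u" "u \<notin> set C" for u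
          proof
            assume m: "major G C u"
            have "free W u" using u(1) unfolding free_image allowed_def by blast
            then have "adj G x u" using claim[OF m] by blast
            then show False using u(1) by (simp add: allowed_def)
          qed
        qed (use ord True Ws Wt Wb b1p p2 p3 mp w in auto)
        then show "\<not> adj G w v" using p(3) by simp
      qed
      then show ?thesis by blast
    qed
  qed
qed

theorem clean_exists: "\<exists>J E q0 q1 x y. clean J E q0 q1 x y"
proof (cases "\<exists>x. major G C x")
  case True
  then obtain x where x: "major G C x" by blast
  show ?thesis
  proof (cases "\<exists>x i j. major G C x \<and> gap x i j \<and> N - (j - i) \<le> L + 1")
    case True
    then show ?thesis using clean_long_gap by blast
  next
    case False
    have "L + 2 \<le> N - (j - i)" if "major G C z" "gap z i j" for z i j
      using False that by (metis add1_zle_eq add.assoc linorder_not_less one_add_one)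
    then show ?thesis using clean_spread[OF x] by blast
  qed
qed (use clean_no_major in blast)

end

section \<open>The algorithm\<close>

text \<open>A bound instead of the exact time, so that branches of different cost can be treated
  alike.\<close>

definition exec :: "nat \<Rightarrow> com \<Rightarrow> state \<Rightarrow> nat \<Rightarrow> state \<Rightarrow> bool" where
  "exec W c s T s' \<longleftrightarrow> (\<exists>t\<le>T. run W c s t s')"

lemma exec_mono: "exec W c s T s' \<Longrightarrow> T \<le> T' \<Longrightarrow> exec W c s T' s'"
  unfolding exec_def by (meson order_trans)

lemma exec_Skip: "exec W Skip s 1 s"
  unfolding exec_def using run.Skip by blast

definition setr :: "nat \<Rightarrow> nat \<Rightarrow> state \<Rightarrow> state" where
  "setr r v s = s\<lparr>reg := (reg s)(r := v)\<rparr>"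

lemma setr_simps [simp]: "reg (setr r v s) = (reg s)(r := v)" "mem (setr r v s) = mem s" "out (setr r v s) = out s"
  by (simp_all add: setr_def)

lemma exec_Assign: "val e s = v \<Longrightarrow> v \<le> W \<Longrightarrow> cost e + 1 \<le> T \<Longrightarrow> exec W (Assign r e) s T (setr r v s)"
  unfolding exec_def setr_def using run.Assign by blast

lemma exec_Store: "val e s = u \<Longrightarrow> val f s = v \<Longrightarrow> u \<le> W \<Longrightarrow> v \<le> W \<Longrightarrow> cost e + cost f + 1 \<le> T \<Longrightarrow>
    exec W (Store e f) s T (s\<lparr>mem := (mem s)(u := v)\<rparr>)"
  unfolding exec_def using run.Store by blast

lemma exec_Output: "val e s = v \<Longrightarrow> v \<le> W \<Longrightarrow> cost e + 1 \<le> T \<Longrightarrow> exec W (Output e) s T (s\<lparr>out := out s @ [v]\<rparr>)"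
  unfolding exec_def using run.Output by blast

lemma exec_Seq: "exec W c1 s T1 s' \<Longrightarrow> exec W c2 s' T2 s'' \<Longrightarrow> exec W (Seq c1 c2) s (T1 + T2) s''"
  unfolding exec_def using run.Seq by (meson add_mono)

lemma exec_Cond1: "val e s \<noteq> 0 \<Longrightarrow> exec W c1 s T s' \<Longrightarrow> exec W (Cond e c1 c2) s (cost e + 1 + T) s'"
  unfolding exec_def using run.CondTrue by (meson add_left_mono)

lemma exec_Cond0: "val e s = 0 \<Longrightarrow> exec W c2 s T s' \<Longrightarrow> exec W (Cond e c1 c2) s (cost e + 1 + T) s'"
  unfolding exec_def using run.CondFalse by (meson add_left_mono)

definition For :: "nat \<Rightarrow> com \<Rightarrow> com" where
  "For r c = Seq (Assign r (Const 0))
     (While (Minus (Reg 0) (Reg r)) (Seq c (Assign r (Plus (Reg r) (Const 1)))))"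

text \<open>The 6 pays for the initialisation and the final test, the 8 for the test and the
  increment of each round.\<close>

definition forT :: "nat \<Rightarrow> nat \<Rightarrow> nat" where "forT n T = 6 + n * (T + 8)"

lemma forT_le: "forT n T \<le> (n + 1) * (T + 14)"
  by (simp add: forT_def algebra_simps)

text \<open>The invariant is demanded of the state with the counter already advanced, since the loop
  overwrites register \<open>r\<close> after the body; the body itself must hand \<open>r\<close>
  back unchanged.\<close>

lemma exec_For:
  assumes n: "reg s 0 = n" "n \<le> W" "r \<noteq> 0" and init: "I 0 (setr r 0 s)"
    and body: "\<And>i s. i < n \<Longrightarrow> I i s \<Longrightarrow> reg s r = i \<Longrightarrow> reg s 0 = n \<Longrightarrow>
      \<exists>s'. exec W c s T s' \<and> reg s' r = i \<and> reg s' 0 = n \<and> I (Suc i) (setr r (Suc i) s')"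
  shows "\<exists>s'. exec W (For r c) s (forT n T) s' \<and> I n s' \<and> reg s' 0 = n"
proof -
  let ?w = "While (Minus (Reg 0) (Reg r)) (Seq c (Assign r (Plus (Reg r) (Const 1))))"
  have loop: "\<exists>s'. exec W ?w s (4 + m * (T + 8)) s' \<and> I n s' \<and> reg s' 0 = n"
    if "i + m = n" "I i s" "reg s r = i" "reg s 0 = n" for m i s
    using that
  proof (induction m arbitrary: i s)
    case 0
    then have "run W ?w s (cost (Minus (Reg 0) (Reg r)) + 1) s" by (intro run.WhileFalse) simp
    then have "exec W ?w s (4 + 0 * (T + 8)) s"
      unfolding exec_def by (intro exI[of _ "cost (Minus (Reg 0) (Reg r)) + 1"]) auto
    then show ?case using 0 by auto
  next
    case (Suc m)
    then have i: "i < n" by simp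
    obtain s1 where s1: "exec W c s T s1" "reg s1 r = i" "reg s1 0 = n" "I (Suc i) (setr r (Suc i) s1)"
      using body[OF i Suc.prems(2-4)] by blast
    have a: "exec W (Assign r (Plus (Reg r) (Const 1))) s1 4 (setr r (Suc i) s1)"
      using s1(2) i n(2) by (intro exec_Assign) simp_all
    obtain t where t: "t \<le> T + 4" "run W (Seq c (Assign r (Plus (Reg r) (Const 1)))) s t (setr r (Suc i) s1)"
      using exec_Seq[OF s1(1) a] unfolding exec_def by blast
    obtain s2 where s2: "exec W ?w (setr r (Suc i) s1) (4 + m * (T + 8)) s2" "I n s2" "reg s2 0 = n"
      using Suc.IH[of "Suc i" "setr r (Suc i) s1"] Suc.prems s1 n(3) by auto
    then obtain t2 where t2: "t2 \<le> 4 + m * (T + 8)" "run W ?w (setr r (Suc i) s1) t2 s2" unfolding exec_def by blast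
    have "run W ?w s (cost (Minus (Reg 0) (Reg r)) + 1 + t + t2) s2"
      using Suc.prems i by (intro run.WhileTrue[OF _ t(2) t2(2)]) simp
    then have "exec W ?w s (4 + Suc m * (T + 8)) s2"
      unfolding exec_def using t(1) t2(1)
      by (intro exI[of _ "cost (Minus (Reg 0) (Reg r)) + 1 + t + t2"]) auto
    then show ?case using s2 by blast
  qed
  have a: "exec W (Assign r (Const 0)) s 2 (setr r 0 s)" by (intro exec_Assign) simp_all
  obtain s' where s': "exec W ?w (setr r 0 s) (4 + n * (T + 8)) s'" "I n s'" "reg s' 0 = n"
    using loop[of 0 n "setr r 0 s"] init n by auto
  have "exec W (For r c) s (forT n T) s'"
    unfolding For_def using exec_mono[OF exec_Seq[OF a s'(1)], of "forT n T"] by (simp add: forT_def)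
  then show ?thesis using s' by blast
qed

text \<open>Layout. Register 1 holds \<open>n * n\<close>, registers 2, 3, 4 are loop variables, register 5 is a
  flag, and the guess is kept in the registers from 6 on: \<open>A = 8 * l - 16\<close> vertices for \<open>J\<close>, 12 for
  \<open>E\<close>, then \<open>q0\<close>, \<open>q1\<close>, \<open>x\<close>, \<open>y\<close>. As there is no multiplication, the row offsets \<open>u * n\<close> of the
  adjacency matrix are tabulated in the cells \<open>n * n + u\<close>; the cells \<open>n * n + n + v\<close> mark the
  reached vertices.\<close>

definition adjE :: "nat \<Rightarrow> nat \<Rightarrow> expr" where
  "adjE a b = Mem (Plus (Mem (Plus (Reg 1) (Reg a))) (Reg b))"

definition markE :: "nat \<Rightarrow> expr" where "markE a = Plus (Plus (Reg 1) (Reg 0)) (Reg a)"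

lemma cost_E [simp]: "cost (adjE a b) = 7" "cost (markE a) = 5" by (simp_all add: adjE_def markE_def)

text \<open>A sum of adjacency bits acts as a disjunction. It is unrolled because the machine cannot
  address registers indirectly.\<close>

primrec jE :: "nat \<Rightarrow> expr" where
  "jE 0 = Const 0"
| "jE (Suc i) = Plus (jE i) (adjE (6 + i) 3)"

lemma cost_jE [simp]: "cost (jE m) = 8 * m + 1" by (induction m) simp_all

definition table_com :: com where
  "table_com = Seq (For 2 (Assign 1 (Plus (Reg 1) (Reg 0))))
     (Seq (Assign 5 (Const 0))
       (For 2 (Seq (Store (Plus (Reg 1) (Reg 2)) (Reg 5)) (Assign 5 (Plus (Reg 5) (Reg 0))))))"

definition block :: "nat \<Rightarrow> expr" where
  "block A = Plus (jE A) (Plus (adjE (6 + (A + 14)) 3) (adjE (6 + (A + 15)) 3))"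

definition spread_com :: "nat \<Rightarrow> com" where
  "spread_com A = Cond (block A) Skip
     (Cond (Mem (markE 2)) (Cond (adjE 2 3) (Store (markE 3) (Const 1)) Skip) Skip)"

definition reach_com :: "nat \<Rightarrow> com" where
  "reach_com A = Seq (For 3 (Store (markE 3) (Const 0)))
     (Seq (Seq (Store (markE (6 + (A + 12))) (Const 1)) (Store (markE (6 + (A + 13))) (Const 1)))
       (For 4 (For 2 (For 3 (spread_com A)))))"

definition touch_com :: com where
  "touch_com = Seq (Assign 5 (Const 0))
     (For 2 (Cond (Mem (markE 2)) (Cond (adjE 2 3) (Assign 5 (Const 1)) Skip) Skip))"

definition neE :: "nat \<Rightarrow> nat \<Rightarrow> expr" where
  "neE a b = Plus (Minus (Reg a) (Reg b)) (Minus (Reg b) (Reg a))"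

lemma neE [simp]: "cost (neE a b) = 7" "val (neE a b) s = 0 \<longleftrightarrow> reg s a = reg s b"
  by (auto simp: neE_def)

text \<open>The comparisons with the slots come before the adjacency tests: a vertex of
  \<open>C\<close> in \<open>J\<close>, in \<open>E\<close> or at an end of the search is output as
  0 even if it sees a guessed vertex.\<close>

primrec emit_com :: "nat \<Rightarrow> nat \<Rightarrow> com" where
  "emit_com A 0 = Cond (jE A) (Output (Const 1))
     (Cond (adjE (6 + (A + 14)) 3)
       (Cond (adjE (6 + (A + 15)) 3) (Output (Reg 5)) (Output (Const 0))) (Output (Const 0)))"
| "emit_com A (Suc i) = Cond (neE 3 (6 + i)) (emit_com A i) (Output (Const 0))"

definition guess_com :: "nat \<Rightarrow> com" where
  "guess_com A = Seq (reach_com A) (For 3 (Seq touch_com (emit_com A (A + 14))))"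

primrec nest_com :: "nat \<Rightarrow> nat \<Rightarrow> com" where
  "nest_com A 0 = guess_com A"
| "nest_com A (Suc j) = For (6 + j) (nest_com A j)"

definition guessT :: "nat \<Rightarrow> nat \<Rightarrow> nat" where
  "guessT A n = forT n 7 + (14 + forT n (forT n (forT n (8 * A + 60)))) +
     forT n (2 + forT n 30 + (8 * (A + 14) + (8 * A + 20)))"

primrec nestT :: "nat \<Rightarrow> nat \<Rightarrow> nat \<Rightarrow> nat" where
  "nestT A 0 n = guessT A n"
| "nestT A (Suc j) n = forT n (nestT A j n)"

section \<open>Correctness and cost of the programs\<close>

locale ram =
  fixes W n A :: nat and G :: "nat sgraph"
  assumes V: "verts G = {..<n}" and G: "simple_graph G" and W: "n * n + 2 * n + 1 \<le> W"
begin

definition inv :: "state \<Rightarrow> bool" where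
  "inv s \<longleftrightarrow> reg s 0 = n \<and> reg s 1 = n * n \<and>
     (\<forall>u<n. \<forall>v<n. mem s (u * n + v) = of_bool (adj G u v)) \<and> (\<forall>u<n. mem s (n * n + u) = u * n)"

definition marks :: "state \<Rightarrow> nat set" where "marks s = {v. v < n \<and> mem s (n * n + n + v) \<noteq> 0}"

definition frame :: "state \<Rightarrow> state \<Rightarrow> bool" where
  "frame s s' \<longleftrightarrow> (\<forall>r\<ge>6. reg s' r = reg s r) \<and> out s' = out s"

lemma frame_refl: "frame s s" and frame_trans: "frame s s' \<Longrightarrow> frame s' s'' \<Longrightarrow> frame s s''"
  by (auto simp: frame_def)

lemma frame_setr: "r < 6 \<Longrightarrow> frame s (setr r v s') = frame s s'" by (auto simp: frame_def)

lemma inv_setr: "r \<noteq> 0 \<Longrightarrow> r \<noteq> 1 \<Longrightarrow> inv (setr r v s) = inv s" by (simp add: inv_def)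

lemma marks_setr [simp]: "marks (setr r v s) = marks s" by (simp add: marks_def)

lemma val_adjE:
  assumes "inv s" "reg s a < n" "reg s b < n"
  shows "val (adjE a b) s = of_bool (adj G (reg s a) (reg s b))"
  using assms by (simp add: adjE_def inv_def)

lemma val_markE: "inv s \<Longrightarrow> val (markE a) s = n * n + n + reg s a"
  by (simp add: markE_def inv_def)

lemma val_jE:
  assumes "inv s" "reg s 3 < n" "\<And>i. i < m \<Longrightarrow> reg s (6 + i) < n"
  shows "val (jE m) s \<noteq> 0 \<longleftrightarrow> (\<exists>i<m. adj G (reg s (6 + i)) (reg s 3))"
  using assms(3) by (induction m) (auto simp: val_adjE[OF assms(1)] assms(2) less_Suc_eq)

lemma inv_mark: "inv s \<Longrightarrow> inv (s\<lparr>mem := (mem s)(n * n + n + v := k)\<rparr>)"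
proof -
  assume s: "inv s"
  have "u * n + w < n * n + n + v" if "u < n" "w < n" for u w
  proof -
    have "u * n \<le> n * n" using that by simp
    then show ?thesis using that by linarith
  qed
  then show ?thesis using s unfolding inv_def by (auto simp: less_imp_neq)
qed

lemma exec_mark:
  assumes "inv s" "reg s a < n" "k \<le> 1"
  shows "exec W (Store (markE a) (Const k)) s 7 (s\<lparr>mem := (mem s)(n * n + n + reg s a := k)\<rparr>)"
proof -
  show ?thesis using assms W val_markE[OF assms(1), of a] by (intro exec_Store) auto
qed

lemma exec_table:
  "\<exists>s. exec W table_com (input_state n G) (forT n 4 + (2 + forT n 9)) s \<and> inv s \<and> out s = []"
proof -
  let ?s = "input_state n G"
  have nW: "n \<le> W" "i \<le> n \<Longrightarrow> i * n \<le> W" for i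
  proof -
    show "n \<le> W" using W by linarith
    assume "i \<le> n"
    then have "i * n \<le> n * n" by simp
    then show "i * n \<le> W" using W by linarith
  qed
  define I where "I i s \<longleftrightarrow> mem s = mem ?s \<and> out s = [] \<and> reg s 1 = i * n" for i and s :: state
  have "\<exists>s'. exec W (For 2 (Assign 1 (Plus (Reg 1) (Reg 0)))) ?s (forT n 4) s' \<and> I n s' \<and> reg s' 0 = n"
  proof (rule exec_For)
    fix i s assume i: "i < n" and s: "I i s" "reg s 2 = i" "reg s 0 = n"
    have "exec W (Assign 1 (Plus (Reg 1) (Reg 0))) s 4 (setr 1 (Suc i * n) s)"
      using s i nW(2)[of "Suc i"] by (intro exec_Assign) (simp_all add: I_def)
    then show "\<exists>s'. exec W (Assign 1 (Plus (Reg 1) (Reg 0))) s 4 s' \<and> reg s' 2 = i \<and> reg s' 0 = n \<and>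
        I (Suc i) (setr 2 (Suc i) s')"
      using s by (intro exI[of _ "setr 1 (Suc i * n) s"]) (simp add: I_def)
  qed (use nW in \<open>simp_all add: input_state_def I_def\<close>)
  then obtain s1 where s1: "exec W (For 2 (Assign 1 (Plus (Reg 1) (Reg 0)))) ?s (forT n 4) s1"
    "mem s1 = mem ?s" "out s1 = []" "reg s1 1 = n * n" "reg s1 0 = n" unfolding I_def by blast
  have s2: "exec W (Assign 5 (Const 0)) s1 2 (setr 5 0 s1)" by (intro exec_Assign) simp_all
  define J where "J i s \<longleftrightarrow> reg s 1 = n * n \<and> out s = [] \<and> reg s 5 = i * n \<and>
      (\<forall>k<n * n. mem s k = mem ?s k) \<and> (\<forall>u<i. mem s (n * n + u) = u * n)" for i and s :: state
  let ?c = "Seq (Store (Plus (Reg 1) (Reg 2)) (Reg 5)) (Assign 5 (Plus (Reg 5) (Reg 0)))"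
  have "\<exists>s'. exec W (For 2 ?c) (setr 5 0 s1) (forT n 9) s' \<and> J n s' \<and> reg s' 0 = n"
  proof (rule exec_For)
    fix i s assume i: "i < n" and s: "J i s" "reg s 2 = i" "reg s 0 = n"
    let ?t = "s\<lparr>mem := (mem s)(n * n + i := i * n)\<rparr>"
    have 1: "exec W (Store (Plus (Reg 1) (Reg 2)) (Reg 5)) s 5 ?t"
      using s i W nW(2)[of i] by (intro exec_Store) (auto simp: J_def)
    have 2: "exec W (Assign 5 (Plus (Reg 5) (Reg 0))) ?t 4 (setr 5 (Suc i * n) ?t)"
      using s i nW(2)[of "Suc i"] by (intro exec_Assign) (simp_all add: J_def)
    have "exec W ?c s 9 (setr 5 (Suc i * n) ?t)" using exec_Seq[OF 1 2] by simp
    then show "\<exists>s'. exec W ?c s 9 s' \<and> reg s' 2 = i \<and> reg s' 0 = n \<and> J (Suc i) (setr 2 (Suc i) s')"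
      using s by (intro exI[of _ "setr 5 (Suc i * n) ?t"]) (auto simp: J_def less_Suc_eq)
  qed (use nW s1 in \<open>simp_all add: J_def\<close>)
  then obtain s3 where s3: "exec W (For 2 ?c) (setr 5 0 s1) (forT n 9) s3" "J n s3" "reg s3 0 = n" by blast
  have "inv s3"
    unfolding inv_def
  proof (intro conjI allI impI)
    fix u v assume uv: "u < n" "v < n"
    have "u * n + v < Suc u * n" using uv by simp
    also have "\<dots> \<le> n * n" using uv by (intro mult_right_mono) auto
    finally have lt: "u * n + v < n * n" .
    have "mem s3 (u * n + v) = mem ?s (u * n + v)" using s3(2) lt by (simp add: J_def)
    also have "\<dots> = of_bool (adj G u v)" using lt uv by (simp add: input_state_def)
    finally show "mem s3 (u * n + v) = of_bool (adj G u v)" .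
  qed (use s3 in \<open>auto simp: J_def\<close>)
  then show ?thesis
    unfolding table_com_def using exec_Seq[OF s1(1) exec_Seq[OF s2 s3(1)]] s3(2) by (auto simp: J_def)
qed

definition keep :: "state \<Rightarrow> state \<Rightarrow> bool" where "keep s s' \<longleftrightarrow> (\<forall>r\<ge>6. reg s' r = reg s r)"

definition guess :: "state \<Rightarrow> bool" where "guess s \<longleftrightarrow> (\<forall>i<A + 16. reg s (6 + i) < n)"

definition alw :: "(nat \<Rightarrow> nat) \<Rightarrow> nat \<Rightarrow> bool" where
  "alw g = allowed G (g ` {..<A}) (g (A + 14)) (g (A + 15))"

text \<open>The marked set is only known to lie between the two searches. This matches
  \<open>clean\<close>, which uses the smaller one to catch major vertices and the larger one to
  protect \<open>C\<close>.\<close>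

definition ok :: "(nat \<Rightarrow> nat) \<Rightarrow> nat set \<Rightarrow> bool" where
  "ok g X \<longleftrightarrow> (\<exists>B. nreach G (alw g) {g (A + 12), g (A + 13)} n \<subseteq> B \<and>
     B \<subseteq> reach G (alw g) {g (A + 12), g (A + 13)} \<and>
     X = {v. v < n \<and> (\<forall>i<A + 14. v \<noteq> g i) \<and> ((\<exists>i<A. adj G (g i) v) \<or>
       adj G (g (A + 14)) v \<and> adj G (g (A + 15)) v \<and> (\<exists>w\<in>B. adj G w v))})"

abbreviation gs :: "state \<Rightarrow> nat \<Rightarrow> nat" where "gs s \<equiv> \<lambda>i. reg s (6 + i)"

lemma frame_keep: "frame s s' \<Longrightarrow> keep s s'" by (simp add: frame_def keep_def)

lemma keep_gs: "keep s s' \<Longrightarrow> gs s' = gs s" by (auto simp: keep_def)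

lemma keep_guess: "keep s s' \<Longrightarrow> guess s \<Longrightarrow> guess s'" by (simp add: keep_def guess_def)

lemma guess_lt: "guess s \<Longrightarrow> i < A + 16 \<Longrightarrow> reg s (6 + i) < n" by (simp add: guess_def)

lemma alw_lt: "alw g v \<Longrightarrow> v < n" by (simp add: alw_def allowed_def V)

lemma val_block:
  assumes "inv s" "guess s" "reg s 3 < n"
  shows "val (block A) s = 0 \<longleftrightarrow> alw (gs s) (reg s 3)"
proof -
  have "val (jE A) s \<noteq> 0 \<longleftrightarrow> (\<exists>i<A. adj G (reg s (6 + i)) (reg s 3))"
    using assms by (intro val_jE) (auto simp: guess_def)
  moreover have "val (adjE (6 + (A + 14)) 3) s = of_bool (adj G (gs s (A + 14)) (reg s 3))"
    "val (adjE (6 + (A + 15)) 3) s = of_bool (adj G (gs s (A + 15)) (reg s 3))"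
    using guess_lt[OF assms(2), of "A + 14"] guess_lt[OF assms(2), of "A + 15"] assms(1,3) by (simp_all add: val_adjE)
  ultimately show ?thesis
    using assms(3) by (auto simp: block_def alw_def allowed_def V)
qed

lemma val_mark: "inv s \<Longrightarrow> reg s a < n \<Longrightarrow> val (Mem (markE a)) s \<noteq> 0 \<longleftrightarrow> reg s a \<in> marks s"
  by (simp add: val_markE marks_def)

lemma marks_mark: "v < n \<Longrightarrow> marks (s\<lparr>mem := (mem s)(n * n + n + v := k)\<rparr>) =
    (if k = 0 then marks s - {v} else insert v (marks s))"
  by (auto simp: marks_def)

lemma exec_spread:
  assumes s: "inv s" "guess s" "reg s 2 < n" "reg s 3 < n"
  shows "\<exists>s'. exec W (spread_com A) s (8 * A + 60) s' \<and> inv s' \<and> frame s s' \<and> reg s' = reg s \<and>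
    marks s' = marks s \<union> (if alw (gs s) (reg s 3) \<and> reg s 2 \<in> marks s \<and> adj G (reg s 2) (reg s 3)
      then {reg s 3} else {})"
proof (cases "alw (gs s) (reg s 3)")
  case False
  then have "val (block A) s \<noteq> 0" using val_block s by blast
  from exec_mono[OF exec_Cond1[OF this exec_Skip], of "8 * A + 60"]
  have "exec W (spread_com A) s (8 * A + 60) s" unfolding spread_com_def by (simp add: block_def)
  then show ?thesis using False s(1) by (intro exI[of _ s]) (simp add: frame_refl)
next
  case a: True
  then have v: "val (block A) s = 0" using val_block s by blast
  show ?thesis
  proof (cases "reg s 2 \<in> marks s")
    case False
    then have "val (Mem (markE 2)) s = 0" using val_mark s by blast
    from exec_mono[OF exec_Cond0[OF v exec_Cond0[OF this exec_Skip]], of "8 * A + 60"]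
    have "exec W (spread_com A) s (8 * A + 60) s" unfolding spread_com_def by (simp add: block_def)
    then show ?thesis using False s(1) by (intro exI[of _ s]) (simp add: frame_refl)
  next
    case m: True
    then have v2: "val (Mem (markE 2)) s \<noteq> 0" using val_mark s by blast
    show ?thesis
    proof (cases "adj G (reg s 2) (reg s 3)")
      case False
      then have "val (adjE 2 3) s = 0" using val_adjE s by simp
      from exec_mono[OF exec_Cond0[OF v exec_Cond1[OF v2 exec_Cond0[OF this exec_Skip]]], of "8 * A + 60"]
      have "exec W (spread_com A) s (8 * A + 60) s" unfolding spread_com_def by (simp add: block_def)
      then show ?thesis using False s(1) by (intro exI[of _ s]) (simp add: frame_refl)
    next
      case True
      then have v3: "val (adjE 2 3) s \<noteq> 0" using val_adjE s by simp
      let ?s' = "s\<lparr>mem := (mem s)(n * n + n + reg s 3 := 1)\<rparr>"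
      have "exec W (spread_com A) s (8 * A + 60) ?s'"
        unfolding spread_com_def
        using exec_mono[OF exec_Cond0[OF v exec_Cond1[OF v2 exec_Cond1[OF v3 exec_mark[OF s(1,4), of 1]]]]]
        by (simp add: block_def)
      then show ?thesis
        using a m True s inv_mark[OF s(1), of "reg s 3" 1] marks_mark[OF s(4), of s 1]
        by (intro exI[of _ ?s']) (auto simp: frame_def)
    qed
  qed
qed

lemma exec_spread_row:
  assumes s: "inv s" "guess s" "reg s 2 < n"
  shows "\<exists>s'. exec W (For 3 (spread_com A)) s (forT n (8 * A + 60)) s' \<and> inv s' \<and> frame s s' \<and>
    reg s' 2 = reg s 2 \<and> reg s' 4 = reg s 4 \<and>
    marks s' = marks s \<union> {v. alw (gs s) v \<and> reg s 2 \<in> marks s \<and> adj G (reg s 2) v}"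
proof -
  define I where "I i t \<longleftrightarrow> inv t \<and> frame s t \<and> reg t 2 = reg s 2 \<and> reg t 4 = reg s 4 \<and>
      marks t = marks s \<union> {v. v < i \<and> alw (gs s) v \<and> reg s 2 \<in> marks s \<and> adj G (reg s 2) v}" for i t
  have "\<exists>s'. exec W (For 3 (spread_com A)) s (forT n (8 * A + 60)) s' \<and> I n s' \<and> reg s' 0 = n"
  proof (rule exec_For)
    show "reg s 0 = n" using s by (simp add: inv_def)
    show "n \<le> W" using W by linarith
    show "I 0 (setr 3 0 s)" using s by (simp add: I_def inv_setr frame_setr frame_refl)
    fix i t assume i: "i < n" and t: "I i t" "reg t 3 = i" "reg t 0 = n"
    have k: "gs t = gs s" "guess t"
      using t(1) keep_gs keep_guess[OF _ s(2)] frame_keep by (auto simp: I_def)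
    obtain t' where t': "exec W (spread_com A) t (8 * A + 60) t'" "inv t'" "frame t t'" "reg t' = reg t"
      "marks t' = marks t \<union> (if alw (gs s) i \<and> reg s 2 \<in> marks t \<and> adj G (reg s 2) i then {i} else {})"
      using exec_spread[of t] t k s(3) i by (auto simp: I_def)
    \<comment> \<open>Marks set while a row is scanned cannot include the vertex of the row itself,
      since the graph has no loops.\<close>
    have "reg s 2 \<in> marks t \<longleftrightarrow> reg s 2 \<in> marks s"
      using t(1) G by (auto simp: I_def simple_graph_def)
    then have "marks t' = marks s \<union> {v. v < Suc i \<and> alw (gs s) v \<and> reg s 2 \<in> marks s \<and> adj G (reg s 2) v}"
      using t'(5) t(1) by (auto simp: I_def less_Suc_eq)
    then have "I (Suc i) (setr 3 (Suc i) t')"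
      using t' t(1) frame_trans[of s t t'] by (simp add: I_def inv_setr frame_setr)
    then show "\<exists>s'. exec W (spread_com A) t (8 * A + 60) s' \<and> reg s' 3 = i \<and> reg s' 0 = n \<and>
        I (Suc i) (setr 3 (Suc i) s')" using t' t by auto
  qed simp
  then show ?thesis using alw_lt by (auto simp: I_def cong: conj_cong)
qed

lemma exec_spread_all:
  assumes s: "inv s" "guess s"
  shows "\<exists>s'. exec W (For 2 (For 3 (spread_com A))) s (forT n (forT n (8 * A + 60))) s' \<and>
    inv s' \<and> frame s s' \<and> reg s' 4 = reg s 4 \<and>
    marks s \<union> {v. alw (gs s) v \<and> (\<exists>w\<in>marks s. adj G w v)} \<subseteq> marks s' \<and>
    (marks s \<subseteq> reach G (alw (gs s)) Q \<longrightarrow> marks s' \<subseteq> reach G (alw (gs s)) Q)"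
proof -
  define I where "I i t \<longleftrightarrow> inv t \<and> frame s t \<and> reg t 4 = reg s 4 \<and>
      marks s \<union> {v. alw (gs s) v \<and> (\<exists>w\<in>marks s. w < i \<and> adj G w v)} \<subseteq> marks t \<and>
      (marks s \<subseteq> reach G (alw (gs s)) Q \<longrightarrow> marks t \<subseteq> reach G (alw (gs s)) Q)" for i t
  have "\<exists>s'. exec W (For 2 (For 3 (spread_com A))) s (forT n (forT n (8 * A + 60))) s' \<and> I n s' \<and> reg s' 0 = n"
  proof (rule exec_For)
    show "reg s 0 = n" using s by (simp add: inv_def)
    show "n \<le> W" using W by linarith
    show "I 0 (setr 2 0 s)" using s by (simp add: I_def inv_setr frame_setr frame_refl)
    fix i t assume i: "i < n" and t: "I i t" "reg t 2 = i" "reg t 0 = n"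
    have k: "gs t = gs s" "guess t"
      using t(1) keep_gs keep_guess[OF _ s(2)] frame_keep by (auto simp: I_def)
    obtain t' where t': "exec W (For 3 (spread_com A)) t (forT n (8 * A + 60)) t'" "inv t'" "frame t t'"
      "reg t' 2 = i" "reg t' 4 = reg t 4"
      "marks t' = marks t \<union> {v. alw (gs s) v \<and> i \<in> marks t \<and> adj G i v}"
      using exec_spread_row[of t] t k i by (auto simp: I_def)
    have "marks t' \<subseteq> reach G (alw (gs s)) Q" if "marks t \<subseteq> reach G (alw (gs s)) Q"
      using that t'(6) by (auto intro: reach.step)
    moreover have "marks s \<union> {v. alw (gs s) v \<and> (\<exists>w\<in>marks s. w < Suc i \<and> adj G w v)} \<subseteq> marks t'"
      using t'(6) t(1) by (auto simp: I_def less_Suc_eq)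
    ultimately have "I (Suc i) (setr 2 (Suc i) t')"
      using t' t(1) frame_trans[of s t t'] by (simp add: I_def inv_setr frame_setr)
    then show "\<exists>s'. exec W (For 3 (spread_com A)) t (forT n (8 * A + 60)) s' \<and> reg s' 2 = i \<and>
        reg s' 0 = n \<and> I (Suc i) (setr 2 (Suc i) s')"
      using t' by (auto simp: inv_def)
  qed simp
  moreover have "w \<in> marks s \<Longrightarrow> w < n" for w by (simp add: marks_def)
  ultimately show ?thesis by (auto simp: I_def cong: conj_cong)
qed

lemma exec_reach:
  assumes s: "inv s" "guess s"
  defines "Q \<equiv> {gs s (A + 12), gs s (A + 13)}"
  shows "\<exists>s'. exec W (reach_com A) s (forT n 7 + (14 + forT n (forT n (forT n (8 * A + 60))))) s' \<and>
    inv s' \<and> frame s s' \<and> nreach G (alw (gs s)) Q n \<subseteq> marks s' \<and> marks s' \<subseteq> reach G (alw (gs s)) Q"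
proof -
  have nW: "n \<le> W" using W by linarith
  define I where "I i t \<longleftrightarrow> inv t \<and> frame s t \<and> (\<forall>v<i. v \<notin> marks t)" for i t
  have "\<exists>s'. exec W (For 3 (Store (markE 3) (Const 0))) s (forT n 7) s' \<and> I n s' \<and> reg s' 0 = n"
  proof (rule exec_For)
    show "reg s 0 = n" using s by (simp add: inv_def)
    show "I 0 (setr 3 0 s)" using s by (simp add: I_def inv_setr frame_setr frame_refl)
    fix i t assume i: "i < n" and t: "I i t" "reg t 3 = i" "reg t 0 = n"
    let ?t = "t\<lparr>mem := (mem t)(n * n + n + i := 0)\<rparr>"
    have "exec W (Store (markE 3) (Const 0)) t 7 ?t"
      using exec_mark[of t 3 0] t i by (simp add: I_def)
    moreover have "frame s (setr 3 (Suc i) ?t)" using t(1) by (simp add: frame_def I_def)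
    moreover have "inv (setr 3 (Suc i) ?t)" using t(1) inv_mark[of t i 0] by (simp add: inv_setr I_def)
    ultimately show "\<exists>s'. exec W (Store (markE 3) (Const 0)) t 7 s' \<and> reg s' 3 = i \<and> reg s' 0 = n \<and>
        I (Suc i) (setr 3 (Suc i) s')"
      using t i marks_mark[OF i, of t 0] by (intro exI[of _ ?t]) (auto simp: I_def less_Suc_eq)
  qed (use nW in simp_all)
  then obtain s1 where s1: "exec W (For 3 (Store (markE 3) (Const 0))) s (forT n 7) s1" "inv s1" "frame s s1" "marks s1 = {}"
    by (auto simp: I_def marks_def)
  have g1: "gs s1 = gs s" "guess s1" using s1 s keep_gs keep_guess frame_keep by blast+
  let ?a = "gs s (A + 12)" and ?b = "gs s (A + 13)"
  have ab: "?a < n" "?b < n" "reg s1 (6 + (A + 12)) = ?a" "reg s1 (6 + (A + 13)) = ?b"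
    using guess_lt[OF s(2), of "A + 12"] guess_lt[OF s(2), of "A + 13"]
      fun_cong[OF g1(1), of "A + 12"] fun_cong[OF g1(1), of "A + 13"] by simp_all
  let ?s2 = "s1\<lparr>mem := (mem s1)(n * n + n + ?a := 1)\<rparr>"
  let ?s3 = "?s2\<lparr>mem := (mem ?s2)(n * n + n + ?b := 1)\<rparr>"
  have i2: "inv ?s2" and i3: "inv ?s3" using inv_mark s1(2) by blast+
  have e2: "exec W (Store (markE (6 + (A + 12))) (Const 1)) s1 7 ?s2"
    using exec_mark[OF s1(2), of "6 + (A + 12)" 1] ab by simp
  have e3: "exec W (Store (markE (6 + (A + 13))) (Const 1)) ?s2 7 ?s3"
    using exec_mark[OF i2, of "6 + (A + 13)" 1] ab by simp
  have f3: "frame s ?s3" using s1(3) by (simp add: frame_def)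
  have m3: "marks ?s3 = Q"
    using marks_mark[OF ab(1), of s1 1] marks_mark[OF ab(2), of ?s2 1] s1(4) by (auto simp: Q_def)
  define I' where "I' i t \<longleftrightarrow> inv t \<and> frame s t \<and> nreach G (alw (gs s)) Q i \<subseteq> marks t \<and>
      marks t \<subseteq> reach G (alw (gs s)) Q" for i t
  have "\<exists>s'. exec W (For 4 (For 2 (For 3 (spread_com A)))) ?s3 (forT n (forT n (forT n (8 * A + 60)))) s' \<and>
      I' n s' \<and> reg s' 0 = n"
  proof (rule exec_For)
    show "reg ?s3 0 = n" using i3 by (simp add: inv_def)
    show "I' 0 (setr 4 0 ?s3)"
      unfolding I'_def marks_setr m3 using i3 f3 by (auto simp: inv_setr frame_setr intro: reach.base)
    fix i t assume i: "i < n" and t: "I' i t" "reg t 4 = i" "reg t 0 = n"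
    have k: "gs t = gs s" "guess t"
      using t(1) keep_gs keep_guess[OF _ s(2)] frame_keep by (auto simp: I'_def)
    obtain t' where t': "exec W (For 2 (For 3 (spread_com A))) t (forT n (forT n (8 * A + 60))) t'" "inv t'" "frame t t'"
      "reg t' 4 = i" "marks t \<union> {v. alw (gs s) v \<and> (\<exists>w\<in>marks t. adj G w v)} \<subseteq> marks t'"
      "marks t' \<subseteq> reach G (alw (gs s)) Q"
      using exec_spread_all[of t Q] t k by (auto simp: I'_def)
    have "nreach G (alw (gs s)) Q (Suc i) \<subseteq> marks t'" using t'(5) t(1) by (auto simp: I'_def)
    then have "I' (Suc i) (setr 4 (Suc i) t')"
      using t' t(1) frame_trans[of s t t'] by (simp add: I'_def inv_setr frame_setr)
    then show "\<exists>s'. exec W (For 2 (For 3 (spread_com A))) t (forT n (forT n (8 * A + 60))) s' \<and> reg s' 4 = i \<and>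
        reg s' 0 = n \<and> I' (Suc i) (setr 4 (Suc i) s')"
      using t' by (auto simp: inv_def)
  qed (use nW in simp_all)
  then obtain s4 where s4: "exec W (For 4 (For 2 (For 3 (spread_com A)))) ?s3 (forT n (forT n (forT n (8 * A + 60)))) s4"
    "I' n s4" by blast
  have "exec W (reach_com A) s (forT n 7 + (14 + forT n (forT n (forT n (8 * A + 60))))) s4"
    unfolding reach_com_def
    using exec_Seq[OF s1(1) exec_Seq[OF exec_Seq[OF e2 e3] s4(1)]] by simp
  then show ?thesis using s4(2) unfolding I'_def by blast
qed

lemma exec_touch:
  assumes s: "inv s" "reg s 3 < n"
  shows "\<exists>s'. exec W touch_com s (2 + forT n 30) s' \<and> inv s' \<and> frame s s' \<and> reg s' 3 = reg s 3 \<and>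
    marks s' = marks s \<and> reg s' 5 = of_bool (\<exists>w\<in>marks s. adj G w (reg s 3))"
proof -
  let ?v = "reg s 3"
  let ?c = "Cond (Mem (markE 2)) (Cond (adjE 2 3) (Assign 5 (Const 1)) Skip) Skip"
  have 1: "exec W (Assign 5 (Const 0)) s 2 (setr 5 0 s)" by (intro exec_Assign) simp_all
  define I where "I i t \<longleftrightarrow> inv t \<and> frame s t \<and> reg t 3 = ?v \<and> marks t = marks s \<and>
      reg t 5 = of_bool (\<exists>w\<in>marks s. w < i \<and> adj G w ?v)" for i t
  have "\<exists>s'. exec W (For 2 ?c) (setr 5 0 s) (forT n 30) s' \<and> I n s' \<and> reg s' 0 = n"
  proof (rule exec_For)
    show "reg (setr 5 0 s) 0 = n" using s by (simp add: inv_def)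
    show "n \<le> W" using W by linarith
    show "I 0 (setr 2 0 (setr 5 0 s))" using s by (simp add: I_def inv_setr frame_setr frame_refl)
    fix i t assume i: "i < n" and t: "I i t" "reg t 2 = i" "reg t 0 = n"
    have it: "inv t" using t by (simp add: I_def)
    have sk: "I (Suc i) (setr 2 (Suc i) t)" if "\<not> (i \<in> marks s \<and> adj G i ?v)"
      using t(1) that by (auto simp: I_def inv_setr frame_setr less_Suc_eq)
    consider "i \<notin> marks s" | "i \<in> marks s" "\<not> adj G i ?v" | "i \<in> marks s" "adj G i ?v" by blast
    then show "\<exists>s'. exec W ?c t 30 s' \<and> reg s' 2 = i \<and> reg s' 0 = n \<and> I (Suc i) (setr 2 (Suc i) s')"
    proof cases
      case 1
      then have "val (Mem (markE 2)) t = 0" using val_mark[OF it, of 2] t i by (simp add: I_def)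
      from exec_mono[OF exec_Cond0[OF this exec_Skip], of 30] show ?thesis using sk 1 t by auto
    next
      case 2
      then have v: "val (Mem (markE 2)) t \<noteq> 0" using val_mark[OF it, of 2] t i by (simp add: I_def)
      have "val (adjE 2 3) t = 0" using val_adjE[OF it, of 2 3] t i s 2 by (simp add: I_def)
      from exec_mono[OF exec_Cond1[OF v exec_Cond0[OF this exec_Skip]], of 30] show ?thesis using sk 2 t by auto
    next
      case 3
      then have v: "val (Mem (markE 2)) t \<noteq> 0" using val_mark[OF it, of 2] t i by (simp add: I_def)
      have v2: "val (adjE 2 3) t \<noteq> 0" using val_adjE[OF it, of 2 3] t i s 3 by (simp add: I_def)
      have "exec W (Assign 5 (Const 1)) t 2 (setr 5 1 t)" using W by (intro exec_Assign) simp_all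
      from exec_mono[OF exec_Cond1[OF v exec_Cond1[OF v2 this]], of 30]
      have "exec W ?c t 30 (setr 5 1 t)" by simp
      moreover have "I (Suc i) (setr 2 (Suc i) (setr 5 1 t))"
        using t(1) 3 by (auto simp: I_def inv_setr frame_setr less_Suc_eq)
      ultimately show ?thesis using t by (intro exI[of _ "setr 5 1 t"]) simp
    qed
  qed simp
  then obtain s' where s': "exec W (For 2 ?c) (setr 5 0 s) (forT n 30) s'" "I n s'" by blast
  have "(\<exists>w\<in>marks s. w < n \<and> adj G w ?v) = (\<exists>w\<in>marks s. adj G w ?v)" by (auto simp: marks_def)
  then show ?thesis
    using exec_Seq[OF 1 s'(1)] s'(2) unfolding touch_com_def I_def by (intro exI[of _ s']) simp
qed

lemma exec_Out: "k \<le> 1 \<Longrightarrow> val e s = k \<Longrightarrow> cost e = 1 \<Longrightarrow> exec W (Output e) s 2 (s\<lparr>out := out s @ [k]\<rparr>)"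
  using W by (intro exec_Output) simp_all

lemma exec_emit:
  assumes s: "inv s" "guess s" "reg s 3 < n" "reg s 5 = of_bool b" and m: "m \<le> A + 14"
    and k: "k = of_bool ((\<forall>i<m. reg s 3 \<noteq> gs s i) \<and> ((\<exists>i<A. adj G (gs s i) (reg s 3)) \<or>
      adj G (gs s (A + 14)) (reg s 3) \<and> adj G (gs s (A + 15)) (reg s 3) \<and> b))"
  shows "exec W (emit_com A m) s (8 * m + (8 * A + 20)) (s\<lparr>out := out s @ [k]\<rparr>)"
  using m k
proof (induction m)
  case 0
  have j: "val (jE A) s \<noteq> 0 \<longleftrightarrow> (\<exists>i<A. adj G (reg s (6 + i)) (reg s 3))"
    using s by (intro val_jE) (auto simp: guess_def)
  have xy: "val (adjE (6 + (A + 14)) 3) s = of_bool (adj G (gs s (A + 14)) (reg s 3))"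
    "val (adjE (6 + (A + 15)) 3) s = of_bool (adj G (gs s (A + 15)) (reg s 3))"
    using guess_lt[OF s(2), of "A + 14"] guess_lt[OF s(2), of "A + 15"] s(1,3) by (simp_all add: val_adjE)
  note o1 = exec_Out[of 1 "Const 1" s] and o0 = exec_Out[of 0 "Const 0" s]
    and ob = exec_Out[of "of_bool b" "Reg 5" s]
  consider "\<exists>i<A. adj G (gs s i) (reg s 3)"
    | "\<not> (\<exists>i<A. adj G (gs s i) (reg s 3))" "\<not> adj G (gs s (A + 14)) (reg s 3)"
    | "\<not> (\<exists>i<A. adj G (gs s i) (reg s 3))" "adj G (gs s (A + 14)) (reg s 3)" "\<not> adj G (gs s (A + 15)) (reg s 3)"
    | "\<not> (\<exists>i<A. adj G (gs s i) (reg s 3))" "adj G (gs s (A + 14)) (reg s 3)" "adj G (gs s (A + 15)) (reg s 3)"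
    by blast
  then show ?case
  proof cases
    case 1
    then have k: "k = 1" using 0(2) by auto
    have v: "val (jE A) s \<noteq> 0" using j 1 by blast
    show ?thesis
      using exec_mono[OF exec_Cond1[OF v o1], of "8 * 0 + (8 * A + 20)"] unfolding k by simp
  next
    case 2
    then have k: "k = 0" using 0(2) by auto
    have v: "val (jE A) s = 0" "val (adjE (6 + (A + 14)) 3) s = 0" using j xy 2 by (blast, simp)
    show ?thesis
      using exec_mono[OF exec_Cond0[OF v(1) exec_Cond0[OF v(2) o0]], of "8 * 0 + (8 * A + 20)"] unfolding k by simp
  next
    case 3
    then have k: "k = 0" using 0(2) by auto
    have v: "val (jE A) s = 0" "val (adjE (6 + (A + 14)) 3) s \<noteq> 0" "val (adjE (6 + (A + 15)) 3) s = 0"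
      using j xy 3 by (blast, simp_all)
    show ?thesis
      using exec_mono[OF exec_Cond0[OF v(1) exec_Cond1[OF v(2) exec_Cond0[OF v(3) o0]]], of "8 * 0 + (8 * A + 20)"] unfolding k by simp
  next
    case 4
    then have k: "k = of_bool b" using 0(2) by auto
    have v: "val (jE A) s = 0" "val (adjE (6 + (A + 14)) 3) s \<noteq> 0" "val (adjE (6 + (A + 15)) 3) s \<noteq> 0"
      using j xy 4 by (blast, simp_all)
    show ?thesis
      using exec_mono[OF exec_Cond0[OF v(1) exec_Cond1[OF v(2) exec_Cond1[OF v(3) ob]]], of "8 * 0 + (8 * A + 20)"] s(4) unfolding k by simp
  qed
next
  case (Suc m)
  show ?case
  proof (cases "reg s 3 = gs s m")
    case True
    then have v: "val (neE 3 (6 + m)) s = 0" by simp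
    have "k = 0" using True Suc.prems(2) by auto
    then show ?thesis
      using exec_mono[OF exec_Cond0[OF v exec_Out[of 0 "Const 0" s]], of "8 * Suc m + (8 * A + 20)"] by simp
  next
    case False
    then have v: "val (neE 3 (6 + m)) s \<noteq> 0" by simp
    have "(\<forall>i<Suc m. reg s 3 \<noteq> gs s i) = (\<forall>i<m. reg s 3 \<noteq> gs s i)" using False by (auto simp: less_Suc_eq)
    then have em: "exec W (emit_com A m) s (8 * m + (8 * A + 20)) (s\<lparr>out := out s @ [k]\<rparr>)"
      using Suc.prems by (intro Suc.IH) simp_all
    show ?thesis
      using exec_mono[OF exec_Cond1[OF v em], of "8 * Suc m + (8 * A + 20)"] by simp
  qed
qed

lemma exec_guess:
  assumes s: "inv s" "guess s"
  shows "\<exists>s' X. exec W (guess_com A) s (guessT A n) s' \<and> inv s' \<and> keep s s' \<and>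
    out s' = out s @ encode_sets n [X] \<and> X \<subseteq> {..<n} \<and> ok (gs s) X"
proof -
  obtain s1 where s1: "exec W (reach_com A) s (forT n 7 + (14 + forT n (forT n (forT n (8 * A + 60))))) s1"
    "inv s1" "frame s s1" "nreach G (alw (gs s)) {gs s (A + 12), gs s (A + 13)} n \<subseteq> marks s1"
    "marks s1 \<subseteq> reach G (alw (gs s)) {gs s (A + 12), gs s (A + 13)}"
    using exec_reach[OF s] by blast
  let ?g = "gs s"
  define P where "P v \<longleftrightarrow> (\<forall>i<A + 14. v \<noteq> ?g i) \<and> ((\<exists>i<A. adj G (?g i) v) \<or>
      adj G (?g (A + 14)) v \<and> adj G (?g (A + 15)) v \<and> (\<exists>w\<in>marks s1. adj G w v))" for v
  let ?T = "2 + forT n 30 + (8 * (A + 14) + (8 * A + 20))"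
  define I where "I i t \<longleftrightarrow> inv t \<and> keep s t \<and> marks t = marks s1 \<and>
      out t = out s @ map (\<lambda>v. of_bool (P v)) [0..<i]" for i t
  have ks: "keep s (setr 3 v t) = keep s t" for v t by (auto simp: keep_def)
  have "\<exists>s'. exec W (For 3 (Seq touch_com (emit_com A (A + 14)))) s1 (forT n ?T) s' \<and> I n s' \<and> reg s' 0 = n"
  proof (rule exec_For)
    show "reg s1 0 = n" using s1 by (simp add: inv_def)
    show "n \<le> W" using W by linarith
    show "I 0 (setr 3 0 s1)" using s1 by (simp add: I_def inv_setr ks frame_keep) (simp add: frame_def)
    fix i t assume i: "i < n" and t: "I i t" "reg t 3 = i" "reg t 0 = n"
    obtain t1 where t1: "exec W touch_com t (2 + forT n 30) t1" "inv t1" "frame t t1" "reg t1 3 = i"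
      "marks t1 = marks s1" "reg t1 5 = of_bool (\<exists>w\<in>marks s1. adj G w i)"
      using exec_touch[of t] t i by (auto simp: I_def)
    have k: "keep s t1" using t t1(3) by (simp add: I_def keep_def frame_def)
    have g: "gs t1 = ?g" "guess t1" using keep_gs[OF k] keep_guess[OF k s(2)] by blast+
    have o: "out t1 = out t" using t1(3) by (simp add: frame_def)
    let ?t = "t1\<lparr>out := out t1 @ [of_bool (P i)]\<rparr>"
    have gi: "reg t1 (6 + j) = ?g j" for j using fun_cong[OF g(1), of j] .
    have "exec W (emit_com A (A + 14)) t1 (8 * (A + 14) + (8 * A + 20)) ?t"
      using exec_emit[OF t1(2) g(2) _ t1(6), of "A + 14"] i unfolding t1(4) gi P_def by simp
    from exec_Seq[OF t1(1) this] have "exec W (Seq touch_com (emit_com A (A + 14))) t ?T ?t" .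
    moreover have "I (Suc i) (setr 3 (Suc i) ?t)"
      using t1 t(1) k o by (simp add: I_def inv_def keep_def marks_def)
    ultimately show "\<exists>s'. exec W (Seq touch_com (emit_com A (A + 14))) t ?T s' \<and> reg s' 3 = i \<and>
        reg s' 0 = n \<and> I (Suc i) (setr 3 (Suc i) s')"
      using t1 by (intro exI[of _ ?t]) (simp add: inv_def)
  qed simp
  then obtain s2 where s2: "exec W (For 3 (Seq touch_com (emit_com A (A + 14)))) s1 (forT n ?T) s2" "I n s2" by blast
  let ?X = "{v. v < n \<and> P v}"
  have "map (\<lambda>v. of_bool (P v)) [0..<n] = encode_sets n [?X]" by (simp add: encode_sets_def)
  moreover have "ok ?g ?X" unfolding ok_def P_def using s1(4,5) by blast
  moreover have "exec W (guess_com A) s (guessT A n) s2"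
    unfolding guess_com_def guessT_def using exec_Seq[OF s1(1) s2(1)] .
  ultimately show ?thesis using s2(2) by (intro exI[of _ s2] exI[of _ ?X]) (auto simp: I_def)
qed

lemma ok_cong:
  assumes "\<And>i. i < A + 16 \<Longrightarrow> g i = h i" shows "ok g X = ok h X"
proof -
  have "g ` {..<A} = h ` {..<A}" using assms by (intro image_cong) auto
  moreover have "g (A + 12) = h (A + 12)" "g (A + 13) = h (A + 13)" "g (A + 14) = h (A + 14)" "g (A + 15) = h (A + 15)"
    using assms by simp_all
  moreover have "(\<forall>i<A + 14. v \<noteq> g i) = (\<forall>i<A + 14. v \<noteq> h i)" "(\<exists>i<A. adj G (g i) v) = (\<exists>i<A. adj G (h i) v)" for v
    using assms by auto
  ultimately show ?thesis unfolding ok_def alw_def by simp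
qed

lemma encode_append: "encode_sets n (Xs @ Ys) = encode_sets n Xs @ encode_sets n Ys"
  by (simp add: encode_sets_def)

text \<open>The lowest \<open>j\<close> slots vary while the others are fixed by the state; the
  induction peels off the outermost loop. When all slots vary, every possible guess is tried, so the
  program need not know which one is clean.\<close>

lemma exec_nest:
  assumes "inv s" "j \<le> A + 16" "\<And>i. j \<le> i \<Longrightarrow> i < A + 16 \<Longrightarrow> gs s i < n"
  shows "\<exists>s' Xs. exec W (nest_com A j) s (nestT A j n) s' \<and> inv s' \<and> (\<forall>i\<ge>j. gs s' i = gs s i) \<and>
    out s' = out s @ encode_sets n Xs \<and> length Xs = n ^ j \<and> (\<forall>X\<in>set Xs. X \<subseteq> {..<n}) \<and>
    (\<forall>g. (\<forall>i<A + 16. g i < n) \<longrightarrow> (\<forall>i. j \<le> i \<longrightarrow> i < A + 16 \<longrightarrow> g i = gs s i) \<longrightarrow> (\<exists>X\<in>set Xs. ok g X))"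
  using assms
proof (induction j arbitrary: s)
  case 0
  then have "guess s" by (simp add: guess_def)
  then obtain s' X where s': "exec W (guess_com A) s (guessT A n) s'" "inv s'" "keep s s'"
    "out s' = out s @ encode_sets n [X]" "X \<subseteq> {..<n}" "ok (gs s) X"
    using exec_guess 0 by blast
  have "ok g X" if "\<forall>i. 0 \<le> i \<longrightarrow> i < A + 16 \<longrightarrow> g i = gs s i" for g
    using ok_cong[of g "gs s" X] that s'(6) by simp
  then show ?case using s' by (intro exI[of _ s'] exI[of _ "[X]"]) (auto simp: keep_def)
next
  case (Suc j)
  \<comment> \<open>The assignments tried in the first \<open>i\<close> rounds of the outermost
    loop: their \<open>j\<close>-th entry is below \<open>i\<close>.\<close>
  define D where "D i g \<longleftrightarrow> (\<forall>i<A + 16. g i < n) \<and> (\<forall>i. Suc j \<le> i \<longrightarrow> i < A + 16 \<longrightarrow> g i = gs s i) \<and> g j < i"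
    for i and g :: "nat \<Rightarrow> nat"
  define R where "R i t Xs \<longleftrightarrow> out t = out s @ encode_sets n Xs \<and> length Xs = i * n ^ j \<and>
      (\<forall>X\<in>set Xs. X \<subseteq> {..<n}) \<and> (\<forall>g. D i g \<longrightarrow> (\<exists>X\<in>set Xs. ok g X))" for i and t :: state and Xs
  define I where "I i t \<longleftrightarrow> inv t \<and> (\<forall>i\<ge>Suc j. gs t i = gs s i) \<and> (\<exists>Xs. R i t Xs)" for i t
  have "\<exists>s'. exec W (For (6 + j) (nest_com A j)) s (forT n (nestT A j n)) s' \<and> I n s' \<and> reg s' 0 = n"
  proof (rule exec_For)
    show "reg s 0 = n" using Suc by (simp add: inv_def)
    show "n \<le> W" using W by linarith
    have "R 0 (setr (6 + j) 0 s) []" by (simp add: R_def D_def encode_sets_def)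
    then show "I 0 (setr (6 + j) 0 s)" using Suc.prems by (auto simp: I_def inv_setr)
    fix i t assume i: "i < n" and t: "I i t" "reg t (6 + j) = i" "reg t 0 = n"
    obtain Xs where Xs: "R i t Xs" using t(1) by (auto simp: I_def)
    have lt: "gs t m < n" if m: "j \<le> m" "m < A + 16" for m
    proof (cases "m = j")
      case False
      then have "gs t m = gs s m" "gs s m < n" using t(1) m Suc.prems(3)[of m] by (auto simp: I_def)
      then show ?thesis by simp
    qed (use t i in simp)
    obtain t' Ys where t': "exec W (nest_com A j) t (nestT A j n) t'" "inv t'" "\<forall>i\<ge>j. gs t' i = gs t i"
      "out t' = out t @ encode_sets n Ys" "length Ys = n ^ j" "\<forall>X\<in>set Ys. X \<subseteq> {..<n}"
      "\<forall>g. (\<forall>i<A + 16. g i < n) \<longrightarrow> (\<forall>i. j \<le> i \<longrightarrow> i < A + 16 \<longrightarrow> g i = gs t i) \<longrightarrow> (\<exists>X\<in>set Ys. ok g X)"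
      using Suc.IH[of t] t(1) Suc.prems(2) lt by (auto simp: I_def)
    have "\<exists>X\<in>set (Xs @ Ys). ok g X" if g: "D (Suc i) g" for g
    proof (cases "g j < i")
      case True
      then have "D i g" using g by (simp add: D_def)
      then show ?thesis using Xs by (auto simp: R_def)
    next
      case False
      then have gj: "g j = i" using g by (simp add: D_def)
      have "g m = gs t m" if m: "j \<le> m" "m < A + 16" for m
      proof (cases "m = j")
        case False
        then have "gs t m = gs s m" "g m = gs s m" using t(1) m g by (auto simp: I_def D_def)
        then show ?thesis by simp
      qed (use t gj in simp)
      then show ?thesis using t'(7) g by (auto simp: D_def)
    qed
    then have "R (Suc i) (setr (6 + j) (Suc i) t') (Xs @ Ys)"
      using Xs t' by (auto simp: R_def encode_append)
    then have "I (Suc i) (setr (6 + j) (Suc i) t')" using t' t(1) by (auto simp: I_def inv_setr)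
    then show "\<exists>s'. exec W (nest_com A j) t (nestT A j n) s' \<and> reg s' (6 + j) = i \<and> reg s' 0 = n \<and>
        I (Suc i) (setr (6 + j) (Suc i) s')"
      using t' t by (intro exI[of _ t']) (auto simp: inv_def)
  qed simp
  then obtain s' Xs where s': "exec W (For (6 + j) (nest_com A j)) s (forT n (nestT A j n)) s'"
    "inv s'" "\<forall>i\<ge>Suc j. gs s' i = gs s i" "R n s' Xs" unfolding I_def by blast
  have "\<exists>X\<in>set Xs. ok g X"
    if g: "\<forall>i<A + 16. g i < n" "\<forall>i. Suc j \<le> i \<longrightarrow> i < A + 16 \<longrightarrow> g i = gs s i" for g
  proof -
    have "D n g" using g Suc.prems(2) by (simp add: D_def)
    then show ?thesis using s'(4) by (simp add: R_def)
  qed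
  then show ?case using s' unfolding R_def by (intro exI[of _ s'] exI[of _ Xs]) simp
qed

end

section \<open>Polynomial bounds on the running time\<close>

definition poly_bounded :: "nat \<Rightarrow> (nat \<Rightarrow> nat) \<Rightarrow> bool" where
  "poly_bounded p f \<longleftrightarrow> (\<exists>K. \<forall>n. f n \<le> K * (n + 1) ^ p)"

lemma poly_bounded_const: "poly_bounded p (\<lambda>n. c)"
  unfolding poly_bounded_def by (intro exI[of _ c]) simp

lemma poly_bounded_add: "poly_bounded p f \<Longrightarrow> poly_bounded p g \<Longrightarrow> poly_bounded p (\<lambda>n. f n + g n)"
proof -
  assume "poly_bounded p f" "poly_bounded p g"
  then obtain K L where "f n \<le> K * (n + 1) ^ p" "g n \<le> L * (n + 1) ^ p" for n unfolding poly_bounded_def by blast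
  then have "f n + g n \<le> (K + L) * (n + 1) ^ p" for n by (simp only: add_mono distrib_right)
  then show ?thesis unfolding poly_bounded_def by blast
qed

lemma poly_bounded_mono: "poly_bounded p f \<Longrightarrow> p \<le> q \<Longrightarrow> poly_bounded q f"
proof -
  assume "poly_bounded p f" and q: "p \<le> q"
  then obtain K where K: "f n \<le> K * (n + 1) ^ p" for n unfolding poly_bounded_def by blast
  have "f n \<le> K * (n + 1) ^ q" for n
    by (rule order_trans[OF K]) (intro mult_left_mono power_increasing q, simp_all)
  then show ?thesis unfolding poly_bounded_def by blast
qed

text \<open>Each loop raises the exponent by one. The base \<open>n + 1\<close> keeps the bound
  valid for \<open>n = 0\<close>, where a loop still costs 6.\<close>

lemma poly_bounded_forT: "poly_bounded p f \<Longrightarrow> poly_bounded (Suc p) (\<lambda>n. forT n (f n))"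
proof -
  assume "poly_bounded p f"
  then obtain K where K: "f n \<le> K * (n + 1) ^ p" for n unfolding poly_bounded_def by blast
  have "forT n (f n) \<le> (K + 14) * (n + 1) ^ Suc p" for n
  proof -
    have "forT n (f n) \<le> (n + 1) * (f n + 14)" by (rule forT_le)
    also have "\<dots> \<le> (n + 1) * (K * (n + 1) ^ p + 14 * (n + 1) ^ p)"
      by (intro mult_left_mono add_mono K) simp_all
    also have "\<dots> = (K + 14) * (n + 1) ^ Suc p" by (simp add: algebra_simps)
    finally show ?thesis .
  qed
  then show ?thesis unfolding poly_bounded_def by blast
qed

lemma poly_bounded_guessT: "poly_bounded 3 (guessT A)"
proof -
  have f: "poly_bounded 3 (\<lambda>n. forT n c)" for c by (rule poly_bounded_mono[OF poly_bounded_forT[OF poly_bounded_const[of 0]]]) simp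
  have g: "poly_bounded 3 (\<lambda>n. forT n (forT n (forT n c)))" for c
    unfolding numeral_3_eq_3 by (intro poly_bounded_forT poly_bounded_const)
  have h: "poly_bounded 3 (\<lambda>n. forT n (2 + forT n 30 + c))" for c
    by (rule poly_bounded_mono[OF poly_bounded_forT[OF poly_bounded_add[OF poly_bounded_add[OF poly_bounded_const poly_bounded_forT[OF poly_bounded_const[of 0]]] poly_bounded_const]]]) simp
  show ?thesis unfolding guessT_def by (intro poly_bounded_add poly_bounded_const f g h)
qed

lemma poly_bounded_nestT: "poly_bounded (j + 3) (nestT A j)"
proof (induction j)
  case 0
  have "nestT A 0 = guessT A" by (simp add: fun_eq_iff)
  then show ?case using poly_bounded_guessT by simp
next
  case (Suc j)
  have "nestT A (Suc j) = (\<lambda>n. forT n (nestT A j n))" by (simp add: fun_eq_iff)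
  then show ?case using poly_bounded_forT[OF Suc] by simp
qed

lemma poly_bounded_bigo: "poly_bounded p f \<Longrightarrow> (\<lambda>n. real (f n)) \<in> O(\<lambda>n. real n ^ p)"
proof -
  assume "poly_bounded p f"
  then obtain K where K: "f n \<le> K * (n + 1) ^ p" for n unfolding poly_bounded_def by blast
  have "norm (real (f n)) \<le> real (K * 2 ^ p) * norm (real n ^ p)" if "1 \<le> n" for n
  proof -
    have "f n \<le> K * (n + 1) ^ p" by (rule K)
    also have "\<dots> \<le> K * (2 * n) ^ p" using that by (intro mult_left_mono power_mono) simp_all
    also have "\<dots> = K * 2 ^ p * n ^ p" by (simp add: power_mult_distrib)
    finally have "real (f n) \<le> real (K * 2 ^ p * n ^ p)" by (simp only: of_nat_le_iff)
    then show ?thesis by simp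
  qed
  note * = this
  show ?thesis by (rule bigoI[of _ "real (K * 2 ^ p)"], rule eventually_mono[OF eventually_ge_at_top[of 1]], rule *)
qed

section \<open>From clean guesses to the output list\<close>

lemma finite_image_lessThan:
  fixes m :: nat
  assumes "finite S" "S \<noteq> {}" "card S \<le> m"
  shows "\<exists>f :: nat \<Rightarrow> _. f ` {..<m} = S"
proof -
  obtain h where h: "bij_betw h {0..<card S} S" using ex_bij_betw_nat_finite assms(1) by blast
  obtain a where a: "a \<in> S" using assms(2) by blast
  \<comment> \<open>Surplus slots repeat the element \<open>a\<close>; for this purpose
    \<open>clean\<close> demands nonempty \<open>J\<close> and \<open>E\<close>.\<close>
  have "f ` {..<m} = S" if f: "f = (\<lambda>i. if i < card S then h i else a)" for f
  proof (intro subset_antisym subsetI)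
    fix v assume "v \<in> f ` {..<m}"
    then show "v \<in> S" using a bij_betwE[OF h] f by auto
  next
    fix v assume "v \<in> S"
    then obtain i where "i < card S" "h i = v"
      using bij_betw_imp_surj_on[OF h] by (metis atLeastLessThan_iff imageE)
    then show "v \<in> f ` {..<m}" using assms(3) f by (intro image_eqI[of _ _ i]) auto
  qed
  then show ?thesis by blast
qed

text \<open>Relates the largest number the programs handle to the word bound
  \<open>n ^ d + d\<close> with \<open>d = 3\<close>; for \<open>n = 1\<close> both sides are
  4.\<close>

lemma square_le_cube: "n * n + 2 * n + 1 \<le> n ^ 3 + (3 :: nat)"
proof (cases "n \<le> 2")
  case True
  then have "n = 0 \<or> n = 1 \<or> n = 2" by auto
  then show ?thesis by (auto simp: eval_nat_numeral)
next
  case False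
  then have n: "3 \<le> n" by simp
  have "3 * (n * n) \<le> n * (n * n)" "3 * n \<le> n * n" using n by (simp_all only: mult_right_mono)
  then have "n * n + 2 * n \<le> n * (n * n)" by linarith
  then show ?thesis by (simp add: power3_eq_cube mult.assoc)
qed

lemma guess_exists:
  fixes G :: "nat sgraph"
  assumes sh: "shortest_hole G C l" and V: "verts G = {..<n}" and A: "A = 8 * l - 16" and ram: "ram W n G"
  obtains g where "\<And>i. i < A + 16 \<Longrightarrow> g i < n"
    "\<And>X. ram.ok n A G g X \<Longrightarrow> {v. major G C v} \<subseteq> X \<and> X \<inter> set C = {}"
proof -
  interpret ram W n A G by (rule ram)
  interpret shortest_hole G C l by (rule sh)
  obtain J E q0 q1 x y where cl: "clean J E q0 q1 x y" using clean_exists by blast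
  have sub: "set C \<subseteq> {..<n}" using sh V by (simp add: shortest_hole_def hole_graph_def hole_def)
  have JE: "J \<subseteq> set C" "J \<noteq> {}" "E \<subseteq> set C" "E \<noteq> {}" "card E \<le> 12" "q0 \<in> set C" "q1 \<in> set C" "x < n" "y < n"
    and cJ: "int (card J) \<le> 8 * int l - 16"
    using cl V unfolding clean_def by auto
  have J: "card J \<le> A" using cJ A by linarith
  have fin: "finite J" "finite E" using JE finite_subset by blast+
  obtain f :: "nat \<Rightarrow> nat" where f: "f ` {..<A} = J" using finite_image_lessThan[OF fin(1) JE(2) J] by blast
  obtain h :: "nat \<Rightarrow> nat" where h: "h ` {..<12} = E" using finite_image_lessThan[OF fin(2) JE(4,5)] by blast
  define g where "g i = (if i < A then f i else if i < A + 12 then h (i - A) else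
      if i = A + 12 then q0 else if i = A + 13 then q1 else if i = A + 14 then x else y)" for i
  have gJ: "g ` {..<A} = J" using f by (auto simp: g_def image_iff)
  have g4: "g (A + 12) = q0" "g (A + 13) = q1" "g (A + 14) = x" "g (A + 15) = y" by (simp_all add: g_def)
  have range: "g ` {..<A + 14} = J \<union> E \<union> {q0, q1}"
  proof -
    have "{..<A + 14} = {..<A} \<union> (\<lambda>i. A + i) ` {..<12} \<union> {A + 12, A + 13}"
    proof (intro set_eqI iffI)
      fix i assume "i \<in> {..<A + 14}"
      then consider "i < A" | "A \<le> i" "i < A + 12" | "i = A + 12" | "i = A + 13" by force
      then show "i \<in> {..<A} \<union> (\<lambda>i. A + i) ` {..<12} \<union> {A + 12, A + 13}"
        by cases (auto intro!: image_eqI[of _ _ "i - A"])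
    qed auto
    moreover have "g (A + i) = h i" if "i \<in> {..<12}" for i using that by (simp add: g_def)
    then have "g ` (\<lambda>i. A + i) ` {..<12} = E" unfolding image_image h[symmetric] by (rule image_cong[OF refl])
    ultimately show ?thesis using gJ g4 by (simp add: image_Un)
  qed
  have bound: "g i < n" if "i < A + 16" for i
  proof -
    consider "i < A + 14" | "i = A + 14" | "i = A + 15" using \<open>i < A + 16\<close> by linarith
    then show ?thesis
    proof cases
      case 1
      then have "g i \<in> set C" using range JE by blast
      then show ?thesis using sub by blast
    qed (use JE g4 in auto)
  qed
  have ex: "(\<exists>i<A. adj G (g i) v) \<longleftrightarrow> (\<exists>j\<in>J. adj G j v)" for v unfolding gJ[symmetric] by auto
  have all: "(\<forall>i<A + 14. v \<noteq> g i) \<longleftrightarrow> v \<notin> J \<union> E \<union> {q0, q1}" for v unfolding range[symmetric] by auto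
  have aw: "alw g = allowed G J x y" unfolding alw_def gJ g4 ..
  have "{v. major G C v} \<subseteq> X \<and> X \<inter> set C = {}" if X: "ok g X" for X
  proof -
    obtain B where B: "nreach G (allowed G J x y) {q0, q1} n \<subseteq> B" "B \<subseteq> reach G (allowed G J x y) {q0, q1}"
      and XB: "X = {v. v < n \<and> v \<notin> J \<union> E \<union> {q0, q1} \<and> ((\<exists>j\<in>J. adj G j v) \<or>
        adj G x v \<and> adj G y v \<and> (\<exists>w\<in>B. adj G w v))}"
      using X[unfolded ok_def aw g4 ex all] by (elim exE conjE) (rule that)
    have "z \<in> X" if z: "major G C z" for z
    proof -
      \<comment> \<open>The slots that are subtracted hold vertices of \<open>C\<close>, so no major
        vertex is lost.\<close>
      have zn: "z < n" "z \<notin> J \<union> E \<union> {q0, q1}" using z V JE by (auto simp: major_def)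
      have "(\<exists>j\<in>J. adj G j z) \<or> adj G x z \<and> adj G y z \<and>
          (\<exists>w\<in>nreach G (allowed G J x y) {q0, q1} n. adj G w z)"
        using cl z V unfolding clean_def by auto
      then have "(\<exists>j\<in>J. adj G j z) \<or> adj G x z \<and> adj G y z \<and> (\<exists>w\<in>B. adj G w z)"
        using B(1) by blast
      then show ?thesis unfolding XB using zn by simp
    qed
    moreover have "v \<notin> X" if v: "v \<in> set C" for v
    proof
      assume vX: "v \<in> X"
      then have "v \<notin> J \<union> E \<union> {q0, q1}" unfolding XB by simp
      then have "(\<forall>j\<in>J. \<not> adj G j v) \<and> \<not> (adj G x v \<and> adj G y v \<and>
          (\<exists>w\<in>reach G (allowed G J x y) {q0, q1}. adj G w v))"
        using cl v unfolding clean_def by simp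
      then show False using vX B(2) unfolding XB by blast
    qed
    ultimately show ?thesis by blast
  qed
  then show thesis using bound that by blast
qed

theorem theorem2p32:
  fixes l :: nat
  assumes "l \<ge> 4"
  shows "\<exists>(prog :: com) (d :: nat) (T :: nat \<Rightarrow> real) (S :: nat \<Rightarrow> real).
    T \<in> O(\<lambda>n. real n ^ (8 * l + 4)) \<and>
    S \<in> O(\<lambda>n. real n ^ (8 * l + 2)) \<and>
    (\<forall>(n :: nat) (G :: nat sgraph).
       verts G = {..<n} \<and> candidate l G \<longrightarrow>
       (\<exists>Xs :: nat set list.
          outputs_in_time (n ^ d + d) prog n G (T n) Xs \<and>
          real (length Xs) \<le> S n \<and>
          (\<forall>X \<in> set Xs. X \<subseteq> verts G) \<and>
          (\<forall>C. shortest_long_even_hole l G C \<longrightarrow>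
             (\<exists>X \<in> set Xs. {v. major G C v} \<subseteq> X \<and> X \<inter> set C = {}))))"
proof -
  define A where "A = 8 * l - 16"
  have A: "A + 16 = 8 * l" using assms by (simp add: A_def)
  define T where "T n = forT n 4 + (2 + forT n 9) + nestT A (8 * l) n" for n
  define prog where "prog = Seq table_com (nest_com A (8 * l))"
  have "poly_bounded (8 * l + 4) (\<lambda>n. forT n c)" for c
    by (rule poly_bounded_mono[OF poly_bounded_forT[OF poly_bounded_const[of 0]]]) simp
  \<comment> \<open>The \<open>8 * l\<close> loops around a cubic body give the exponent
    \<open>8 * l + 3\<close>, which is within the bound.\<close>
  then have "poly_bounded (8 * l + 4) T"
    unfolding T_def by (intro poly_bounded_add poly_bounded_const poly_bounded_mono[OF poly_bounded_nestT]) simp_all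
  then have T: "(\<lambda>n. real (T n)) \<in> O(\<lambda>n. real n ^ (8 * l + 4))" by (rule poly_bounded_bigo)
  have "poly_bounded (8 * l + 2) (\<lambda>n. n ^ (8 * l))"
  proof (rule poly_bounded_mono)
    show "poly_bounded (8 * l) (\<lambda>n. n ^ (8 * l))" unfolding poly_bounded_def by (intro exI[of _ 1]) (simp add: power_mono)
  qed simp
  then have S: "(\<lambda>n. real (n ^ (8 * l))) \<in> O(\<lambda>n. real n ^ (8 * l + 2))" by (rule poly_bounded_bigo)
  have main: "\<exists>Xs. outputs_in_time (n ^ 3 + 3) prog n G (real (T n)) Xs \<and>
      real (length Xs) \<le> real (n ^ (8 * l)) \<and> (\<forall>X\<in>set Xs. X \<subseteq> verts G) \<and>
      (\<forall>C. shortest_long_even_hole l G C \<longrightarrow> (\<exists>X\<in>set Xs. {v. major G C v} \<subseteq> X \<and> X \<inter> set C = {}))"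
    if V: "verts G = {..<n}" and c: "candidate l G" for n and G :: "nat sgraph"
  proof -
    have G: "simple_graph G" using c by (simp add: candidate_def)
    interpret ram "n ^ 3 + 3" n A G by unfold_locales (fact V G square_le_cube)+
    obtain s1 where s1: "exec (n ^ 3 + 3) table_com (input_state n G) (forT n 4 + (2 + forT n 9)) s1" "inv s1" "out s1 = []"
      using exec_table by blast
    obtain s2 Xs where s2: "exec (n ^ 3 + 3) (nest_com A (8 * l)) s1 (nestT A (8 * l) n) s2"
      "out s2 = out s1 @ encode_sets n Xs" "length Xs = n ^ (8 * l)" "\<forall>X\<in>set Xs. X \<subseteq> {..<n}"
      "\<forall>g. (\<forall>i<8 * l. g i < n) \<longrightarrow> (\<exists>X\<in>set Xs. ok g X)"
      using exec_nest[OF s1(2), of "8 * l"] unfolding A by auto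
    have "exec (n ^ 3 + 3) prog (input_state n G) (T n) s2"
      unfolding prog_def T_def by (rule exec_Seq[OF s1(1) s2(1)])
    then have out: "outputs_in_time (n ^ 3 + 3) prog n G (real (T n)) Xs"
      unfolding outputs_in_time_def exec_def using s1(3) s2(2) by fastforce
    have holes: "\<exists>X\<in>set Xs. {v. major G C v} \<subseteq> X \<and> X \<inter> set C = {}" if C: "shortest_long_even_hole l G C" for C
    proof -
      interpret shortest_hole G C l
        using G c C assms
        by unfold_locales (simp_all add: shortest_long_even_hole_def long_even_hole_def)
      obtain g where g: "\<And>i. i < A + 16 \<Longrightarrow> g i < n"
        "\<And>X. ok g X \<Longrightarrow> {v. major G C v} \<subseteq> X \<and> X \<inter> set C = {}"
        using guess_exists[OF shortest_hole_axioms V A_def ram_axioms] by blast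
      have "\<forall>i<8 * l. g i < n" using g(1) unfolding A by blast
      then obtain X where X: "X \<in> set Xs" "ok g X" using s2(5) by blast
      show ?thesis using g(2)[OF X(2)] X(1) by (rule bexI)
    qed
    show ?thesis
      using out s2(3,4) holes unfolding V by (intro exI[of _ Xs] conjI allI impI) simp_all
  qed
  show ?thesis
    by (rule exI[of _ prog], rule exI[of _ 3], rule exI[of _ "\<lambda>n. real (T n)"],
        rule exI[of _ "\<lambda>n. real (n ^ (8 * l))"]) (use T S main in blast)
qed

end
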